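(* Fix $\beta>0$, $\beta'=\beta/2$, and let $(\theta_1,\dots,\theta_n)\in[0,2\pi)^n$ be distributed according to the circular $\beta$-ensemble density $\mathbf P^C_{n,\beta}$ (see context). Let $\mathcal L^C_{n,\beta}=\log\mathbf P^C_{n,\beta}(\theta_1,\dots,\theta_n)$. 1. The sequence $\left(n^{-1}\mathcal L^C_{n,\beta}\right)_n$ satisfies the large deviation principle at speed $n$ with good rate function $$\Lambda^*_{\beta,C}(x)=\Lambda^*_{\beta,H}\left(x+\tfrac12\right),$$ where $\Lambda^*_{\beta,H}(x)=\sup_{t>-1}\left(tx-\Lambda_{\beta,H}(t)\right)$ and $\Lambda_{\beta,H}(t)=f_0((1+t)\beta)-(1+t)f_0(\beta)$ for $t>-1$. 2. Let $Y^C_{n,\beta}=\mathcal L^C_{n,\beta}+nE^C_\beta$, where $E^C_\beta=E^H_\beta+\frac12$ and $E^H_\beta=\log2\pi-\frac12-\beta'+\beta'\Psi(1+\beta')-\ell(1+\beta')$. Then the sequence $\left(n^{-1/3}Y^C_{n,\beta}\right)_n$ converges mod-Gaussian on the strip $S_1=\{z\in\mathbb C:\Re z>-1\}$, as $n\to\infty$, with parameters $t_n^\beta=n^{1/3}\sigma^2_\beta$ and limiting function $\psi^\beta(z)=e^{-A_\beta z^3/6}$, where $$\sigma_\beta^2=\beta'-\beta'^2\,\ell''(1+\beta'),\qquad A_\beta=\beta'^3\,\ell'''(1+\beta')+\beta'.$$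
   Context: Circular ensemble: $$\mathbf P^C_{n,\beta}(\theta_1,\dots,\theta_n)=\frac1{\mathcal Z^C_n(\beta)}\prod_{1\le j<k\le n}|e^{i\theta_k}-e^{i\theta_j}|^\beta$$ with respect to $d\theta_1\cdots d\theta_n$ on $[0,2\pi)^n$, with normalizing constant $\mathcal Z_n^C(\beta)=(2\pi)^n\frac{\Gamma(1+n\beta')}{\Gamma(1+\beta')^n}$. $\ell(x)=\log\Gamma(x)$, $\Psi=\ell'$ is the digamma function, and with $\beta'=\beta/2$, $f_0(\beta)=\log2\pi-\ell(1+\beta')+\beta'\log\beta'-\frac12(1+\beta')$. Large deviation principle: a sequence of real random variables $(X_n)$ satisfies the LDP at speed (scale) $u_n$ ($u_n\uparrow\infty$) with rate function $I$ if $I:\mathbb R\to[0,\infty]$ is lower semicontinuous and for every Borel set $A$, $-\inf_{\mathrm{int}A}I\le\liminf\frac1{u_n}\log\mathbb P(X_n\in A)\le\limsup\frac1{u_n}\log\mathbb P(X_n\in A)\le-\inf_{\mathrm{clo}A}I$. It is good if its level sets $\{I\le a\}$ are compact. Mod-Gaussian convergence: for $-\infty\le c<0<d\le\infty$ let $S_{(c,d)}=\{z\in\mathbb C:c<\Re z<d\}$. Real random variables $(X_n)$ whose moment generating functions $\mathbb E[e^{zX_n}]$ exist on $S_{(c,d)}$ converge mod-Gaussian on $S_{(c,d)}$ with parameters $t_n\to\infty$ and limiting function $\psi$ if $\psi$ is analytic on $S_{(c,d)}$, does not vanish on the real part of $S_{(c,d)}$, and $\mathbb E[e^{zX_n}]e^{-t_nz^2/2}\to\psi(z)$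 locally uniformly on $S_{(c,d)}$. The strip $S_1$ is $S_{(-1,\infty)}$. *)

theory Defs
  imports "HOL-Probability.Probability" "HOL-Complex_Analysis.Complex_Analysis"
begin

section \<open>Large deviation principle\<close>

text \<open>Logarithm of a probability, with \<open>log 0 = -\<infinity>\<close> (whereas \<^term>\<open>ln (0::real)\<close> is \<open>0\<close>).\<close>

definition log_prob :: "real \<Rightarrow> ereal" where
  "log_prob p = (if p = 0 then -\<infinity> else ereal (ln p))"

definition lower_semicontinuous :: "(real \<Rightarrow> ereal) \<Rightarrow> bool" where
  "lower_semicontinuous I \<longleftrightarrow> (\<forall>x. I x \<le> Liminf (at x) I)"

text \<open>
  Sequences are indexed by \<open>n \<ge> 1\<close>; the terms of index \<open>0\<close> are irrelevant. The \<open>n\<close>-th random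
  variable \<open>X n\<close> lives on its own probability space \<open>M n\<close>. Infima are taken in \<^typ>\<open>ereal\<close>, so
  the infimum over the empty set is \<open>\<infinity>\<close>.
\<close>

definition real_random_variables :: "(nat \<Rightarrow> 'a measure) \<Rightarrow> (nat \<Rightarrow> 'a \<Rightarrow> real) \<Rightarrow> bool" where
  "real_random_variables M X \<longleftrightarrow>
     (\<forall>n\<ge>1. prob_space (M n) \<and> X n \<in> borel_measurable (M n))"

definition satisfies_LDP ::
  "(nat \<Rightarrow> 'a measure) \<Rightarrow> (nat \<Rightarrow> 'a \<Rightarrow> real) \<Rightarrow> (nat \<Rightarrow> real) \<Rightarrow> (real \<Rightarrow> ereal) \<Rightarrow> bool" where
  "satisfies_LDP M X u I \<longleftrightarrow>
     real_random_variables M X \<and>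
     incseq u \<and> filterlim u at_top sequentially \<and>
     (\<forall>x. 0 \<le> I x) \<and> lower_semicontinuous I \<and>
     (\<forall>A \<in> sets borel.
        - (INF x\<in>interior A. I x)
          \<le> liminf (\<lambda>n. ereal (1 / u n) * log_prob (measure (M n) {\<omega> \<in> space (M n). X n \<omega> \<in> A})) \<and>
        limsup (\<lambda>n. ereal (1 / u n) * log_prob (measure (M n) {\<omega> \<in> space (M n). X n \<omega> \<in> A}))
          \<le> - (INF x\<in>closure A. I x))"

definition good_rate_function :: "(real \<Rightarrow> ereal) \<Rightarrow> bool" where
  "good_rate_function I \<longleftrightarrow> (\<forall>a::real. compact {x. I x \<le> ereal a})"


section \<open>Mod-Gaussian convergence\<close>

definition strip :: "ereal \<Rightarrow> ereal \<Rightarrow> complex set" where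
  "strip c d = {z. c < ereal (Re z) \<and> ereal (Re z) < d}"

definition locally_uniform_limit ::
  "complex set \<Rightarrow> (nat \<Rightarrow> complex \<Rightarrow> complex) \<Rightarrow> (complex \<Rightarrow> complex) \<Rightarrow> bool" where
  "locally_uniform_limit S f g \<longleftrightarrow>
     (\<forall>z\<in>S. \<exists>U. open U \<and> z \<in> U \<and> U \<subseteq> S \<and> uniform_limit U f g sequentially)"

definition mod_gaussian_convergent ::
  "(nat \<Rightarrow> 'a measure) \<Rightarrow> (nat \<Rightarrow> 'a \<Rightarrow> real) \<Rightarrow> ereal \<Rightarrow> ereal \<Rightarrow> (nat \<Rightarrow> real)
    \<Rightarrow> (complex \<Rightarrow> complex) \<Rightarrow> bool" where
  "mod_gaussian_convergent M X c d t \<psi> \<longleftrightarrow>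
     c < 0 \<and> 0 < d \<and>
     real_random_variables M X \<and>
     (\<forall>n\<ge>1. \<forall>z\<in>strip c d. integrable (M n) (\<lambda>\<omega>. exp (z * complex_of_real (X n \<omega>)))) \<and>
     filterlim t at_top sequentially \<and>
     \<psi> analytic_on strip c d \<and>
     (\<forall>x::real. complex_of_real x \<in> strip c d \<longrightarrow> \<psi> (complex_of_real x) \<noteq> 0) \<and>
     locally_uniform_limit (strip c d)
       (\<lambda>n z. (LINT \<omega>|M n. exp (z * complex_of_real (X n \<omega>)))
                * exp (- complex_of_real (t n) * z\<^sup>2 / 2))
       \<psi>"


section \<open>The circular ensemble\<close>

text \<open>Throughout, \<open>\<beta>' = \<beta> / 2\<close> is written out.\<close>

definition circ_Z :: "nat \<Rightarrow> real \<Rightarrow> real" where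
  "circ_Z n \<beta> = (2 * pi) ^ n * (Gamma (1 + real n * (\<beta> / 2)) / Gamma (1 + \<beta> / 2) ^ n)"

definition circ_density :: "nat \<Rightarrow> real \<Rightarrow> (nat \<Rightarrow> real) \<Rightarrow> real" where
  "circ_density n \<beta> \<theta> =
     1 / circ_Z n \<beta> * (\<Prod>k\<in>{1..n}. \<Prod>j\<in>{1..<k}. cmod (cis (\<theta> k) - cis (\<theta> j)) powr \<beta>)"

text \<open>The reference measure \<open>d\<theta>\<^sub>1 \<cdots> d\<theta>\<^sub>n\<close> on \<open>[0,2\<pi>)\<^sup>n\<close>, with coordinates indexed by \<open>1, \<dots>, n\<close>.\<close>

definition circ_base :: "nat \<Rightarrow> (nat \<Rightarrow> real) measure" where
  "circ_base n = (\<Pi>\<^sub>M i\<in>{1..n}. restrict_space lborel {0..<2 * pi})"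

text \<open>
  The density vanishes only where two angles coincide, which is a null set; there \<^const>\<open>ln\<close> gives
  the junk value \<open>0\<close>.
\<close>

definition circ_loglik :: "nat \<Rightarrow> real \<Rightarrow> (nat \<Rightarrow> real) \<Rightarrow> real" where
  "circ_loglik n \<beta> \<theta> = ln (circ_density n \<beta> \<theta>)"


section \<open>Constants and rate functions\<close>

definition ell :: "real \<Rightarrow> real" where
  "ell x = ln (Gamma x)"

definition f0 :: "real \<Rightarrow> real" where
  "f0 \<beta> = ln (2 * pi) - ell (1 + \<beta> / 2) + \<beta> / 2 * ln (\<beta> / 2) - 1 / 2 * (1 + \<beta> / 2)"

definition Lambda_H :: "real \<Rightarrow> real \<Rightarrow> real" where
  "Lambda_H \<beta> t = f0 ((1 + t) * \<beta>) - (1 + t) * f0 \<beta>"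

definition Lambda_H_star :: "real \<Rightarrow> real \<Rightarrow> ereal" where
  "Lambda_H_star \<beta> x = (SUP t\<in>{-1<..}. ereal (t * x - Lambda_H \<beta> t))"

definition Lambda_C_star :: "real \<Rightarrow> real \<Rightarrow> ereal" where
  "Lambda_C_star \<beta> x = Lambda_H_star \<beta> (x + 1 / 2)"

definition E_H :: "real \<Rightarrow> real" where
  "E_H \<beta> = ln (2 * pi) - 1 / 2 - \<beta> / 2 + \<beta> / 2 * Digamma (1 + \<beta> / 2) - ell (1 + \<beta> / 2)"

definition E_C :: "real \<Rightarrow> real" where
  "E_C \<beta> = E_H \<beta> + 1 / 2"

definition sigma2 :: "real \<Rightarrow> real" where
  "sigma2 \<beta> = \<beta> / 2 - (\<beta> / 2)\<^sup>2 * (deriv ^^ 2) ell (1 + \<beta> / 2)"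

definition A_const :: "real \<Rightarrow> real" where
  "A_const \<beta> = (\<beta> / 2) ^ 3 * (deriv ^^ 3) ell (1 + \<beta> / 2) + \<beta> / 2"

definition Y_C :: "nat \<Rightarrow> real \<Rightarrow> (nat \<Rightarrow> real) \<Rightarrow> real" where
  "Y_C n \<beta> \<theta> = circ_loglik n \<beta> \<theta> + real n * E_C \<beta>"

end

theory Submission
  imports Defs
begin

text \<open>
  Write \<open>b = \<beta> / 2\<close> and let \<open>V\<close> be the squared modulus of the Vandermonde determinant of the points
  \<open>cis \<theta>\<^sub>j\<close>. The density is \<open>V\<close> to the power \<open>b\<close> divided by its normalisation, so the moment generating
  function of the log-likelihood at \<open>w\<close> is again an integral of a power of \<open>V\<close>, with exponent
  \<open>s = (1 + w) b\<close>. Both claims thus follow from the closed form of Dyson's integral,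
  \<open>\<integral> V\<^sup>s = (2\<pi>)\<^sup>n \<Gamma>(1 + n s) / \<Gamma>(1 + s)\<^sup>n\<close> for \<open>Re s > 0\<close> (lemma \<open>dyson_integral\<close>), together with
  asymptotics of the Gamma function.

  Dyson's integral is proved in three stages. For integer \<open>s\<close> it is the constant term of a Laurent
  polynomial; Good's argument turns Lagrange interpolation at zero into the recursion of the
  multinomial coefficients. By Gauss's multiplication formula, the right-hand side is also a moment of
  order \<open>s\<close>, namely of a multiple of a product of independent beta variables. Two bounded random
  variables with the same integer moments have the same law by the Weierstrass approximation theorem,
  which gives all real \<open>s > 0\<close>. Finally both sides are holomorphic in the right half-plane.

  Let \<open>\<phi>(x) = log \<Gamma>(1 + x) - x log x\<close> and \<open>N = n b\<close>. The logarithm of the moment generating function at \<open>w\<close>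
  splits exactly into \<open>n \<Lambda>(w)\<close> and the remainder \<open>\<phi>(N (1 + w)) - (1 + w) \<phi>(N)\<close>. Since
  \<open>\<phi>''(x) = \<Psi>'(1 + x) - 1 / x\<close> is \<open>O(x\<^sup>-\<^sup>2)\<close>, by comparison of the trigamma series with a telescoping one, Taylor's
  formula bounds the remainder by \<open>O(|w|\<^sup>2 + |w| log n)\<close> on half-planes \<open>Re (1 + w) \<ge> r > 0\<close>.

  For real \<open>w = t\<close> the remainder is negligible after division by \<open>n\<close>, so \<open>\<Lambda>\<close> is the limiting cumulant
  generating function on \<open>t > -1\<close>. It is convex, and its derivative decreases to \<open>-\<infinity>\<close> at \<open>-1\<close>; a
  Gaertner-Ellis argument then yields the large deviation principle with the Legendre transform of
  \<open>\<Lambda>\<close> as good rate function. The function \<open>\<Lambda>(t)\<close> differs from the one in the statement by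
  \<open>t / 2\<close>, which is the shift by \<open>1 / 2\<close> in the rate function.

  For mod-Gaussian convergence put \<open>w = z / n\<^sup>1\<^sup>/\<^sup>3\<close>. The constant \<open>E_C \<beta>\<close> cancels the linear term of \<open>\<Lambda>\<close>, the
  quadratic term is the Gaussian factor with variance \<open>n\<^sup>1\<^sup>/\<^sup>3 \<sigma>\<^sup>2\<close>, the cubic term is exactly the exponent
  \<open>- A z\<^sup>3 / 6\<close> because \<open>n w\<^sup>3 = z\<^sup>3\<close>, and the error is \<open>n O(|w|\<^sup>4)\<close> plus the remainder above, which tends to zero.
\<close>

section \<open>Dyson's constant term identity for integer exponents\<close>

definition circle_measure :: "real measure" where
  "circle_measure = restrict_space lborel {0..<2 * pi}"

text \<open>
  The polynomial that interpolates the constant 1 at the nodes \<open>x i\<close> is 1 itself; this is its value at 0.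
\<close>

lemma lagrange_interpolation_at_zero:
  fixes x :: "'i \<Rightarrow> complex"
  assumes "finite I" "I \<noteq> {}" "inj_on x I"
  shows "(\<Sum>i\<in>I. \<Prod>j\<in>I-{i}. x j / (x j - x i)) = 1"
proof -
  define p where "p = (\<Sum>i\<in>I. \<Prod>j\<in>I-{i}. [:x j / (x j - x i), - 1 / (x j - x i):]) - [:1:]"
  have root: "poly p (x k) = 0" if "k \<in> I" for k
  proof -
    have "(\<Prod>j\<in>I-{i}. x j / (x j - x i) - x k / (x j - x i)) = (if i = k then 1 else 0)"
      if "i \<in> I" for i
    proof (cases "i = k")
      case True
      have "x j / (x j - x i) - x k / (x j - x i) = 1" if "j \<in> I - {i}" for j
        using that \<open>k \<in> I\<close> True assms(3)
        by (auto simp: diff_divide_distrib [symmetric] inj_on_def)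
      then show ?thesis using True by simp
    next
      case False
      then have "k \<in> I - {i}" using \<open>k \<in> I\<close> by auto
      then have "\<exists>j\<in>I-{i}. x j / (x j - x i) - x k / (x j - x i) = 0" by auto
      then show ?thesis using False assms(1) by (simp add: prod_zero)
    qed
    then show ?thesis
      using \<open>k \<in> I\<close> assms(1) by (simp add: p_def poly_sum poly_prod)
  qed
  have deg: "degree p < card I"
  proof -
    have "degree (\<Prod>j\<in>I-{i}. [:x j / (x j - x i), - 1 / (x j - x i):]) \<le> card I - 1" if "i \<in> I" for i
    proof -
      have "degree (\<Prod>j\<in>I-{i}. [:x j / (x j - x i), - 1 / (x j - x i):])
          \<le> (\<Sum>j\<in>I-{i}. degree [:x j / (x j - x i), - 1 / (x j - x i):])"
        using degree_prod_sum_le [of "I - {i}" "\<lambda>j. [:x j / (x j - x i), - 1 / (x j - x i):]"] assms(1) by (simp add: o_def)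
      also have "\<dots> \<le> (\<Sum>j\<in>I-{i}. 1)" by (intro sum_mono) auto
      also have "\<dots> = card I - 1" using that by simp
      finally show ?thesis .
    qed
    then have "degree p \<le> card I - 1"
      unfolding p_def by (intro degree_diff_le degree_sum_le) (use assms(1) in auto)
    moreover have "card I > 0" using assms by (simp add: card_gt_0_iff)
    ultimately show ?thesis by linarith
  qed
  have "p = 0"
  proof (rule ccontr)
    assume "p \<noteq> 0"
    have "card I = card (x ` I)" using assms(3) by (simp add: card_image)
    also have "\<dots> \<le> card {z. poly p z = 0}"
      using root poly_roots_finite [OF \<open>p \<noteq> 0\<close>] by (intro card_mono) auto
    also have "\<dots> \<le> degree p" by (rule card_poly_roots_bound [OF \<open>p \<noteq> 0\<close>])
    finally show False using deg by simp
  qed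
  then have "poly p 0 = 0" by simp
  then show ?thesis by (simp add: p_def poly_sum poly_prod)
qed

text \<open>
  The coordinates get individual exponents, since the recursion behind Dyson's identity lowers
  one of them at a time.
\<close>

definition dyson_product :: "'i set \<Rightarrow> ('i \<Rightarrow> nat) \<Rightarrow> ('i \<Rightarrow> real) \<Rightarrow> complex" where
  "dyson_product I a \<theta> = (\<Prod>i\<in>I. \<Prod>j\<in>I-{i}. (1 - cis (\<theta> i - \<theta> j)) ^ a i)"

text \<open>
  For distinct points this is Lagrange interpolation at 0, multiplied by the product. If two points coincide,
  then every term contains a vanishing factor: lowering the exponent of one of the two points leaves
  the factor that belongs to the other one. Hence the recursion holds pointwise, without discarding
  a null set.
\<close>

lemma dyson_product_recursion:
  assumes I: "finite I" "I \<noteq> {}" and a: "\<And>i. i \<in> I \<Longrightarrow> a i \<ge> 1"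
  shows "dyson_product I a \<theta> = (\<Sum>i\<in>I. dyson_product I (a(i := a i - 1)) \<theta>)"
proof (cases "inj_on (\<lambda>i. cis (\<theta> i)) I")
  case True
  define F where "F i = (\<Prod>j\<in>I-{i}. 1 - cis (\<theta> i - \<theta> j))" for i
  have nz: "1 - cis (\<theta> i - \<theta> j) = (cis (\<theta> j) - cis (\<theta> i)) / cis (\<theta> j)" for i j
    by (simp add: cis_divide [symmetric] field_simps)
  have nz': "cis (\<theta> j) - cis (\<theta> i) \<noteq> 0" if "i \<in> I" "j \<in> I - {i}" for i j
    using True that by (auto simp: inj_on_def)
  have F: "F i \<noteq> 0" if "i \<in> I" for i
    using nz' [OF that] I unfolding F_def nz by (auto simp: prod_zero_iff)
  have "dyson_product I a \<theta> / F i = dyson_product I (a(i := a i - 1)) \<theta>" if i: "i \<in> I" for i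
  proof -
    have "(\<Prod>j\<in>I-{i}. (1 - cis (\<theta> i - \<theta> j)) ^ a i) = F i * (\<Prod>j\<in>I-{i}. (1 - cis (\<theta> i - \<theta> j)) ^ (a i - 1))"
      unfolding F_def prod.distrib [symmetric] power_Suc [symmetric] using a [OF i] by simp
    then show ?thesis
      using F [OF i] I i by (simp add: dyson_product_def prod.remove [of I i])
  qed
  then have "(\<Sum>i\<in>I. dyson_product I (a(i := a i - 1)) \<theta>) = dyson_product I a \<theta> * (\<Sum>i\<in>I. 1 / F i)"
    by (simp add: sum_distrib_left del: fun_upd_apply)
  also have "(\<Sum>i\<in>I. 1 / F i) = (\<Sum>i\<in>I. \<Prod>j\<in>I-{i}. cis (\<theta> j) / (cis (\<theta> j) - cis (\<theta> i)))"
    unfolding F_def nz by (simp add: prod_dividef)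
  also have "\<dots> = 1" by (rule lagrange_interpolation_at_zero [OF I True])
  finally show ?thesis by (simp only: mult_1_right)
next
  case False
  then obtain p q where pq: "p \<in> I" "q \<in> I" "p \<noteq> q" "cis (\<theta> p) = cis (\<theta> q)"
    by (auto simp: inj_on_def)
  have *: "dyson_product I b \<theta> = 0"
    if "r \<in> I" "s \<in> I" "r \<noteq> s" "cis (\<theta> r) = cis (\<theta> s)" "b r \<ge> 1" for b r s
  proof -
    have "(1 - cis (\<theta> r - \<theta> s)) ^ b r = 0" using that by (simp add: cis_divide [symmetric])
    then have "(\<Prod>j\<in>I-{r}. (1 - cis (\<theta> r - \<theta> j)) ^ b r) = 0"
      using that I by (intro prod_zero) auto
    then show ?thesis unfolding dyson_product_def using that I by (intro prod_zero) auto
  qed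
  have "dyson_product I (a(i := a i - 1)) \<theta> = 0" for i
  proof (cases "i = p")
    case True
    then show ?thesis using pq a by (intro * [of q p]) auto
  next
    case False
    then show ?thesis using pq a by (intro * [of p q]) auto
  qed
  moreover have "dyson_product I a \<theta> = 0" using pq a by (intro * [of p q]) auto
  ultimately show ?thesis by simp
qed

lemma borel_measurable_cis [measurable]: "cis \<in> borel_measurable borel"
  by (intro borel_measurable_continuous_onI continuous_intros)

lemma space_circle_measure [simp]: "space circle_measure = {0..<2 * pi}"
  by (simp add: circle_measure_def space_restrict_space)

lemma measurable_circle_measure:
  "f \<in> borel_measurable borel \<Longrightarrow> f \<in> borel_measurable circle_measure"
  unfolding circle_measure_def by (intro measurable_restrict_space1) simp

lemma emeasure_circle_measure: "emeasure circle_measure (space circle_measure) = ennreal (2 * pi)"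
  unfolding circle_measure_def by (simp add: emeasure_restrict_space space_restrict_space)

lemma finite_measure_circle: "finite_measure circle_measure"
  by (rule finite_measureI) (simp only: emeasure_circle_measure, simp)

lemma integral_cis_circle:
  "(\<integral>y. cis (- y) ^ m \<partial>circle_measure) = (if m = 0 then 2 * pi else 0)"
proof (cases "m = 0")
  case True
  have "measure circle_measure (space circle_measure) = 2 * pi"
    using emeasure_circle_measure by (simp add: measure_def)
  then show ?thesis using True by (simp add: scaleR_conv_of_real)
next
  case False
  define F where "F y = \<i> / of_nat m * cis (- (of_nat m * y))" for y :: real
  have "(\<integral>y. cis (- y) ^ m \<partial>circle_measure) = (\<integral>y. indicator {0..<2*pi} y *\<^sub>R cis (- y) ^ m \<partial>lborel)"
    unfolding circle_measure_def by (subst integral_restrict_space) auto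
  also have "\<dots> = (\<integral>y. indicator {0..2*pi} y *\<^sub>R cis (- y) ^ m \<partial>lborel)"
  proof (rule integral_cong_AE)
    show "AE y in lborel. indicator {0..<2*pi} y *\<^sub>R cis (- y) ^ m = indicator {0..2*pi} y *\<^sub>R cis (- y) ^ m"
      using AE_lborel_singleton [of "2 * pi"]
      by eventually_elim (auto simp: indicator_def)
  qed measurable
  also have "\<dots> = F (2 * pi) - F 0"
  proof (rule integral_FTC_atLeastAtMost)
    fix y :: real
    have "((\<lambda>z. \<i> / of_nat m * exp (- (\<i> * of_nat m * z))) has_field_derivative exp (- (\<i> * of_nat m * of_real y)))
        (at (of_real y))"
      using False by (auto intro!: derivative_eq_intros)
    then have "((\<lambda>z. \<i> / of_nat m * exp (- (\<i> * of_nat m * of_real z))) has_vector_derivative exp (- (\<i> * of_nat m * of_real y)))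
        (at y within {0..2 * pi})"
      by (rule has_vector_derivative_real_field)
    then show "(F has_vector_derivative cis (- y) ^ m) (at y within {0..2 * pi})"
      unfolding F_def Complex.DeMoivre unfolding cis_conv_exp by (simp only: of_real_mult of_real_of_nat_eq of_real_minus mult.assoc mult_minus_right)
  qed (auto intro!: continuous_intros)
  also have "\<dots> = 0"
  proof -
    have "cis (- (of_nat m * (2 * pi))) = 1"
      using cis_power_int [of "2 * pi" "- int m"] by (simp add: cis_2pi)
    then show ?thesis by (simp add: F_def)
  qed
  finally show ?thesis using False by simp
qed

text \<open>
  Integration over the circle extracts the constant term.
\<close>

lemma integral_poly_circle:
  "(\<integral>y. poly p (cis (- y)) \<partial>circle_measure) = 2 * pi * poly p 0"
proof -
  interpret finite_measure circle_measure by (rule finite_measure_circle)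
  have int: "integrable circle_measure (\<lambda>y. coeff p i * cis (- y) ^ i)" for i
    by (rule integrable_const_bound [of _ "norm (coeff p i)"])
       (auto simp: norm_mult norm_power intro!: measurable_circle_measure)
  have "(\<integral>y. poly p (cis (- y)) \<partial>circle_measure) = (\<Sum>i\<le>degree p. coeff p i * (\<integral>y. cis (- y) ^ i \<partial>circle_measure))"
    unfolding poly_altdef using int by (subst Bochner_Integration.integral_sum) auto
  also have "\<dots> = (\<Sum>i\<le>degree p. if i = 0 then coeff p 0 * (2 * pi) else 0)"
    by (intro sum.cong) (auto simp: integral_cis_circle)
  also have "\<dots> = 2 * pi * poly p 0" by (simp add: poly_0_coeff_0)
  finally show ?thesis .
qed

lemma finite_measure_circle_PiM: "finite I \<Longrightarrow> finite_measure (\<Pi>\<^sub>M i\<in>I. circle_measure)"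
proof -
  assume I: "finite I"
  interpret finite_measure circle_measure by (rule finite_measure_circle)
  interpret product_sigma_finite "\<lambda>_. circle_measure" by unfold_locales
  have "emeasure (\<Pi>\<^sub>M i\<in>I. circle_measure) (\<Pi>\<^sub>E i\<in>I. space circle_measure) \<noteq> \<infinity>"
    using I by (subst emeasure_PiM) (auto simp: ennreal_power emeasure_circle_measure simp del: space_circle_measure)
  then show ?thesis by (intro finite_measureI) (simp add: space_PiM del: space_circle_measure)
qed

lemma integrable_dyson_product:
  assumes "finite I"
  shows "integrable (\<Pi>\<^sub>M i\<in>I. circle_measure) (dyson_product I a)"
proof -
  interpret finite_measure "\<Pi>\<^sub>M i\<in>I. circle_measure" by (rule finite_measure_circle_PiM) fact
  have cis: "(\<lambda>\<theta>. \<theta> i) \<in> borel_measurable (\<Pi>\<^sub>M i\<in>I. circle_measure)" if "i \<in> I" for i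
  proof -
    have "(\<lambda>x. x) \<in> borel_measurable circle_measure" by (rule measurable_circle_measure) simp
    from measurable_compose [OF measurable_component_singleton [OF that] this] show ?thesis by simp
  qed
  have "norm (dyson_product I a \<theta>) \<le> (\<Prod>i\<in>I. \<Prod>j\<in>I-{i}. 2 ^ a i)" for \<theta>
  proof -
    have 2: "norm (1 - cis t) \<le> 2" for t using norm_triangle_ineq4 [of 1 "cis t"] by simp
    have "norm (dyson_product I a \<theta>) = (\<Prod>i\<in>I. \<Prod>j\<in>I-{i}. norm (1 - cis (\<theta> i - \<theta> j)) ^ a i)"
      by (simp only: dyson_product_def prod_norm [symmetric] norm_power)
    also have "\<dots> \<le> (\<Prod>i\<in>I. \<Prod>j\<in>I-{i}. 2 ^ a i)"
      by (intro prod_mono conjI prod_nonneg power_mono ballI zero_le_power norm_ge_zero 2)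
    finally show ?thesis .
  qed
  moreover have "dyson_product I a \<in> borel_measurable (\<Pi>\<^sub>M i\<in>I. circle_measure)"
    unfolding dyson_product_def [abs_def]
    by (intro borel_measurable_prod borel_measurable_power borel_measurable_diff borel_measurable_const
         measurable_compose [OF _ borel_measurable_cis] cis) simp_all
  ultimately show ?thesis by (intro integrable_const_bound AE_I2)
qed

text \<open>
  Good's proof of Dyson's conjecture. Both sides satisfy the recursion of the multinomial coefficients.
  When an exponent vanishes, its coordinate occurs only through negative powers of its point on the
  circle, with constant term 1, so it can be integrated out.
\<close>

lemma integral_dyson_product:
  assumes "finite I"
  shows "(\<integral>\<theta>. dyson_product I a \<theta> \<partial>(\<Pi>\<^sub>M i\<in>I. circle_measure)) =
    (2 * pi) ^ card I * (fact (sum a I) / (\<Prod>i\<in>I. fact (a i)))"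
  using assms
proof (induction "card I + sum a I" arbitrary: I a rule: less_induct)
  case (less I a)
  note fin = \<open>finite I\<close>
  interpret finite_measure circle_measure by (rule finite_measure_circle)
  interpret product_sigma_finite "\<lambda>_. circle_measure" by unfold_locales
  consider "I = {}" | k where "k \<in> I" "a k = 0" | "I \<noteq> {}" "\<And>i. i \<in> I \<Longrightarrow> a i \<ge> 1"
    by (metis less_one linorder_not_less)
  then show ?case
  proof cases
    case 1
    interpret P: finite_measure "\<Pi>\<^sub>M i\<in>({}::'a set). circle_measure" by (rule finite_measure_circle_PiM) simp
    show ?thesis using 1 by (simp add: dyson_product_def [abs_def] measure_def space_PiM_empty emeasure_PiM_empty)
  next
    case (2 k)
    define J where "J = I - {k}"
    have J: "finite J" "k \<notin> J" "I = insert k J" using 2 fin by (auto simp: J_def)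
    have "(\<integral>y. dyson_product I a (\<theta>(k := y)) \<partial>circle_measure) = 2 * pi * dyson_product J a \<theta>" for \<theta>
    proof -
      define p where "p = (\<Prod>i\<in>J. [:1, - cis (\<theta> i):] ^ a i)"
      have "dyson_product I a (\<theta>(k := y)) = dyson_product J a \<theta> * poly p (cis (- y))" for y
      proof -
        have "dyson_product I a (\<theta>(k := y)) = (\<Prod>i\<in>J. \<Prod>j\<in>I-{i}. (1 - cis ((\<theta>(k := y)) i - (\<theta>(k := y)) j)) ^ a i)"
          using J 2 by (simp add: dyson_product_def)
        also have "\<dots> = (\<Prod>i\<in>J. (1 - cis (\<theta> i - y)) ^ a i * (\<Prod>j\<in>J-{i}. (1 - cis (\<theta> i - \<theta> j)) ^ a i))"
        proof (rule prod.cong [OF refl])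
          fix i assume i: "i \<in> J"
          then have eq: "I - {i} = insert k (J - {i})" and k: "k \<notin> J - {i}" "i \<noteq> k" using J by auto
          have "(\<Prod>j\<in>J-{i}. (1 - cis ((\<theta>(k := y)) i - (\<theta>(k := y)) j)) ^ a i) = (\<Prod>j\<in>J-{i}. (1 - cis (\<theta> i - \<theta> j)) ^ a i)"
            using k J(2) by (intro prod.cong refl) auto
          then show "(\<Prod>j\<in>I-{i}. (1 - cis ((\<theta>(k := y)) i - (\<theta>(k := y)) j)) ^ a i) =
             (1 - cis (\<theta> i - y)) ^ a i * (\<Prod>j\<in>J-{i}. (1 - cis (\<theta> i - \<theta> j)) ^ a i)"
            unfolding eq using k J(1) by (subst prod.insert) simp_all
        qed
        also have "\<dots> = dyson_product J a \<theta> * (\<Prod>i\<in>J. (1 - cis (\<theta> i - y)) ^ a i)"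
          by (simp add: prod.distrib dyson_product_def)
        also have "(\<Prod>i\<in>J. (1 - cis (\<theta> i - y)) ^ a i) = poly p (cis (- y))"
          by (simp add: p_def poly_prod cis_mult mult.commute)
        finally show ?thesis .
      qed
      then have "(\<integral>y. dyson_product I a (\<theta>(k := y)) \<partial>circle_measure) = dyson_product J a \<theta> * (2 * pi * poly p 0)"
        by (simp add: integral_poly_circle)
      also have "poly p 0 = 1" by (simp add: p_def poly_prod)
      finally show ?thesis by (simp del: fun_upd_apply)
    qed
    then have "(\<integral>\<theta>. dyson_product I a \<theta> \<partial>(\<Pi>\<^sub>M i\<in>I. circle_measure)) =
       2 * pi * (\<integral>\<theta>. dyson_product J a \<theta> \<partial>(\<Pi>\<^sub>M i\<in>J. circle_measure))"
      using product_integral_insert [OF J(1,2), of "dyson_product I a"] integrable_dyson_product [OF fin, of a]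
      by (simp add: J(3) del: fun_upd_apply)
    also have "\<dots> = 2 * pi * ((2 * pi) ^ card J * (fact (sum a J) / (\<Prod>i\<in>J. fact (a i))))"
      using J 2 by (subst less.hyps) auto
    also have "\<dots> = (2 * pi) ^ card I * (fact (sum a I) / (\<Prod>i\<in>I. fact (a i)))"
      using J 2 by simp
    finally show ?thesis .
  next
    case 3
    have step: "sum (a(i := a i - 1)) I = sum a I - 1" "sum a I \<ge> 1"
      "(\<Prod>j\<in>I. fact ((a(i := a i - 1)) j)) = (\<Prod>j\<in>I. fact (a j)) / (of_nat (a i) :: real)" if "i \<in> I" for i
    proof -
      have "sum (a(i := a i - 1)) I = a i - 1 + sum a (I - {i})"
        using that fin by (simp add: sum.remove [of I i])
      moreover have "sum a I = a i + sum a (I - {i})" using that fin by (simp add: sum.remove [of I i])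
      ultimately show "sum (a(i := a i - 1)) I = sum a I - 1" "sum a I \<ge> 1" using 3(2) [OF that] by auto
      have "fact (a i) = of_nat (a i) * (fact (a i - 1) :: real)"
        using 3(2) [OF that] by (intro fact_reduce) auto
      then show "(\<Prod>j\<in>I. fact ((a(i := a i - 1)) j)) = (\<Prod>j\<in>I. fact (a j)) / (of_nat (a i) :: real)"
        using that fin 3(2) [OF that] by (simp add: prod.remove [of I i])
    qed
    have "(\<integral>\<theta>. dyson_product I a \<theta> \<partial>(\<Pi>\<^sub>M i\<in>I. circle_measure)) =
       (\<Sum>i\<in>I. \<integral>\<theta>. dyson_product I (a(i := a i - 1)) \<theta> \<partial>(\<Pi>\<^sub>M i\<in>I. circle_measure))"
    proof -
      have "(\<integral>\<theta>. dyson_product I a \<theta> \<partial>(\<Pi>\<^sub>M i\<in>I. circle_measure)) =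
         (\<integral>\<theta>. (\<Sum>i\<in>I. dyson_product I (a(i := a i - 1)) \<theta>) \<partial>(\<Pi>\<^sub>M i\<in>I. circle_measure))"
        by (intro Bochner_Integration.integral_cong refl dyson_product_recursion [OF fin 3])
      also have "\<dots> = (\<Sum>i\<in>I. \<integral>\<theta>. dyson_product I (a(i := a i - 1)) \<theta> \<partial>(\<Pi>\<^sub>M i\<in>I. circle_measure))"
        by (intro Bochner_Integration.integral_sum integrable_dyson_product fin)
      finally show ?thesis .
    qed
    also have "\<dots> = (\<Sum>i\<in>I. of_real ((2 * pi) ^ card I * (fact (sum a I - 1) / (\<Prod>i\<in>I. fact (a i))) * real (a i)))"
    proof (rule sum.cong [OF refl])
      fix i assume i: "i \<in> I"
      have "card I + sum (a(i := a i - 1)) I < card I + sum a I"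
        unfolding step(1) [OF i] using step(2) [OF i] by simp
      from less.hyps [OF this fin]
      have "(\<integral>\<theta>. dyson_product I (a(i := a i - 1)) \<theta> \<partial>(\<Pi>\<^sub>M i\<in>I. circle_measure)) =
        of_real ((2 * pi) ^ card I * (fact (sum a I - 1) / ((\<Prod>i\<in>I. fact (a i)) / real (a i))))"
        unfolding step(1) [OF i] step(3) [OF i] .
      also have "(2 * pi) ^ card I * (fact (sum a I - 1) / ((\<Prod>i\<in>I. fact (a i)) / real (a i))) =
         (2 * pi) ^ card I * (fact (sum a I - 1) / (\<Prod>i\<in>I. fact (a i))) * real (a i)"
        by simp
      finally show "(\<integral>\<theta>. dyson_product I (a(i := a i - 1)) \<theta> \<partial>(\<Pi>\<^sub>M i\<in>I. circle_measure)) =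
         of_real ((2 * pi) ^ card I * (fact (sum a I - 1) / (\<Prod>i\<in>I. fact (a i))) * real (a i))" .
    qed
    also have "\<dots> = of_real ((2 * pi) ^ card I * (fact (sum a I - 1) / (\<Prod>i\<in>I. fact (a i))) * real (sum a I))"
      by (simp only: sum_distrib_left [symmetric] of_nat_sum of_real_sum [symmetric])
    also have "(2 * pi) ^ card I * (fact (sum a I - 1) / (\<Prod>i\<in>I. fact (a i))) * real (sum a I) =
       (2 * pi) ^ card I * ((real (sum a I) * fact (sum a I - 1)) / (\<Prod>i\<in>I. fact (a i)))"
      by (simp only: times_divide_eq_right times_divide_eq_left mult_ac)
    also have "real (sum a I) * fact (sum a I - 1) = fact (sum a I)"
    proof -
      obtain i where "i \<in> I" using 3(1) by blast
      from step(2) [OF this] have "0 < sum a I" by linarith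
      then show ?thesis by (rule fact_reduce [symmetric])
    qed
    finally show ?thesis .
  qed
qed

definition vandermonde_sq :: "nat \<Rightarrow> (nat \<Rightarrow> real) \<Rightarrow> real" where
  "vandermonde_sq n \<theta> = (\<Prod>k\<in>{1..n}. \<Prod>j\<in>{1..<k}. (cmod (cis (\<theta> k) - cis (\<theta> j)))\<^sup>2)"

text \<open>
  The two factors of a pair of points are complex conjugate and multiply to the squared distance.
\<close>

lemma dyson_product_const: "dyson_product {1..n} (\<lambda>_. k) \<theta> = of_real (vandermonde_sq n \<theta> ^ k)"
proof -
  let ?f = "\<lambda>i j. (1 - cis (\<theta> i - \<theta> j)) ^ k"
  have "dyson_product {1..n} (\<lambda>_. k) \<theta> = (\<Prod>i\<in>{1..n}. (\<Prod>j\<in>{1..<i}. ?f i j) * (\<Prod>j\<in>{i<..n}. ?f i j))"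
    unfolding dyson_product_def
  proof (rule prod.cong [OF refl])
    fix i assume "i \<in> {1..n}"
    then have eq: "{1..n} - {i} = {1..<i} \<union> {i<..n}" by auto
    show "(\<Prod>j\<in>{1..n}-{i}. ?f i j) = (\<Prod>j\<in>{1..<i}. ?f i j) * (\<Prod>j\<in>{i<..n}. ?f i j)"
      unfolding eq by (rule prod.union_disjoint) auto
  qed
  also have "\<dots> = (\<Prod>i\<in>{1..n}. \<Prod>j\<in>{1..<i}. ?f i j) * (\<Prod>i\<in>{1..n}. \<Prod>j\<in>{i<..n}. ?f i j)"
    by (rule prod.distrib)
  also have "(\<Prod>i\<in>{1..n}. \<Prod>j\<in>{i<..n}. ?f i j) = (\<Prod>i\<in>{1..n}. \<Prod>j\<in>{1..<i}. ?f j i)"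
    unfolding prod.Sigma [OF finite_atLeastAtMost]
    by (subst prod.Sigma, simp, simp, subst prod.Sigma, simp, simp,
        rule prod.reindex_bij_witness [where i = "\<lambda>(a,b). (b,a)" and j = "\<lambda>(a,b). (b,a)"]) auto
  also have "(\<Prod>i\<in>{1..n}. \<Prod>j\<in>{1..<i}. ?f i j) * (\<Prod>i\<in>{1..n}. \<Prod>j\<in>{1..<i}. ?f j i) =
     (\<Prod>i\<in>{1..n}. \<Prod>j\<in>{1..<i}. ?f i j * ?f j i)"
    by (simp add: prod.distrib)
  also have "\<dots> = (\<Prod>i\<in>{1..n}. \<Prod>j\<in>{1..<i}. of_real (((cmod (cis (\<theta> i) - cis (\<theta> j)))\<^sup>2) ^ k))"
  proof (intro prod.cong refl)
    fix i j
    have "(1 - cis (\<theta> i - \<theta> j)) * (1 - cis (\<theta> j - \<theta> i)) = (cis (\<theta> i) - cis (\<theta> j)) * cnj (cis (\<theta> i) - cis (\<theta> j))"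
      by (simp add: algebra_simps cis_mult cis_cnj)
    also have "\<dots> = of_real ((cmod (cis (\<theta> i) - cis (\<theta> j)))\<^sup>2)" by (simp only: complex_norm_square)
    finally show "?f i j * ?f j i = of_real (((cmod (cis (\<theta> i) - cis (\<theta> j)))\<^sup>2) ^ k)"
      by (simp add: power_mult_distrib [symmetric])
  qed
  also have "\<dots> = of_real (vandermonde_sq n \<theta> ^ k)"
    by (simp add: vandermonde_sq_def prod_power_distrib)
  finally show ?thesis .
qed

lemma circ_base_eq: "circ_base n = (\<Pi>\<^sub>M i\<in>{1..n}. circle_measure)"
  by (simp add: circ_base_def circle_measure_def)

theorem integral_vandermonde_sq_power:
  "(\<integral>\<theta>. vandermonde_sq n \<theta> ^ k \<partial>circ_base n) = (2 * pi) ^ n * (fact (n * k) / fact k ^ n)"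
proof -
  have "of_real (\<integral>\<theta>. vandermonde_sq n \<theta> ^ k \<partial>circ_base n) = (\<integral>\<theta>. dyson_product {1..n} (\<lambda>_. k) \<theta> \<partial>circ_base n)"
    unfolding dyson_product_const by (simp only: integral_complex_of_real)
  also have "\<dots> = of_real ((2 * pi) ^ n * (fact (n * k) / fact k ^ n))"
    unfolding circ_base_eq by (subst integral_dyson_product) auto
  finally show ?thesis by (simp only: of_real_eq_iff)
qed

section \<open>Gauss's multiplication formula and moments of beta variables\<close>

text \<open>
  This is the product limit of the Gamma function, rewritten with the functional equation.
\<close>

lemma Gamma_shift_asymptotics:
  fixes z :: real
  assumes "z \<ge> 0"
  shows "(\<lambda>n. Gamma (z + real n + 1) / (fact n * real n powr z)) \<longlonglongrightarrow> 1"
proof (cases "z = 0")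
  case True
  have "eventually (\<lambda>n. Gamma (z + real n + 1) / (fact n * real n powr z) = 1) sequentially"
    using eventually_gt_at_top [of 0]
  proof eventually_elim
    case (elim n)
    then show ?case using True Gamma_fact [of n, where 'a = real] by (simp add: add.commute)
  qed
  then show ?thesis by (rule tendsto_eventually)
next
  case False
  then have z: "z > 0" "z \<notin> \<int>\<^sub>\<le>\<^sub>0" using assms by (auto elim!: nonpos_Ints_cases)
  have "(\<lambda>n. Gamma z / Gamma_series z n) \<longlonglongrightarrow> Gamma z / Gamma z"
    by (intro tendsto_intros) (use z in \<open>simp add: Gamma_eq_zero_iff\<close>)
  moreover have "eventually (\<lambda>n. Gamma z / Gamma_series z n = Gamma (z + real n + 1) / (fact n * real n powr z)) sequentially"
    using eventually_gt_at_top [of 0]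
  proof eventually_elim
    case (elim n)
    have "pochhammer z (n + 1) = Gamma (z + real n + 1) / Gamma z"
      using pochhammer_Gamma [OF z(2), of "n + 1"] by (simp add: add_ac)
    then show ?case using elim z by (simp add: Gamma_series_def powr_def Gamma_eq_zero_iff)
  qed
  ultimately have "(\<lambda>n. Gamma (z + real n + 1) / (fact n * real n powr z)) \<longlonglongrightarrow> Gamma z / Gamma z"
    by (rule Lim_transform_eventually)
  then show ?thesis using z by (simp add: Gamma_eq_zero_iff)
qed

text \<open>
  The quotient of the two sides has period 1 in \<open>s\<close>. As \<open>s\<close> runs to infinity along integer shifts, the
  asymptotics of the Gamma function show that it does not depend on \<open>s\<close>, and for \<open>s = 0\<close> it is 1.
\<close>

theorem Gauss_multiplication:
  fixes s :: real
  assumes "p \<ge> 1" "s \<ge> 0"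
  shows "Gamma (1 + real p * s) = real p powr (real p * s) * (\<Prod>j\<in>{1..p}. Gamma (s + real j / real p) / Gamma (real j / real p))"
proof -
  have p: "real p > 0" using assms by simp
  define r where "r s = Gamma (1 + real p * s) / (real p powr (real p * s) * (\<Prod>j\<in>{1..p}. Gamma (s + real j / real p)))" for s
  have pos: "s + real j / real p > 0" if "s \<ge> 0" "j \<in> {1..p}" for s j
    using that p by (intro add_nonneg_pos divide_pos_pos) auto
  have per: "r (s + 1) = r s" if s: "s \<ge> 0" for s
  proof -
    have "Gamma (1 + real p * (s + 1)) = pochhammer (1 + real p * s) p * Gamma (1 + real p * s)"
    proof -
      have "1 + real p * s > 0" using s p by (simp add: add_pos_nonneg)
      then show ?thesis
        by (subst pochhammer_Gamma) (auto simp: algebra_simps Gamma_eq_zero_iff elim!: nonpos_Ints_cases)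
    qed
    also have "pochhammer (1 + real p * s) p = (\<Prod>j\<in>{1..p}. real p * (s + real j / real p))"
      unfolding pochhammer_prod using p
      by (intro prod.reindex_bij_witness [where i = "\<lambda>j. j - 1" and j = "\<lambda>j. j + 1"]) (auto simp: field_simps)
    also have "\<dots> = real p powr real p * (\<Prod>j\<in>{1..p}. s + real j / real p)"
      using p by (simp add: prod.distrib powr_realpow)
    finally have 1: "Gamma (1 + real p * (s + 1)) =
      real p powr real p * (\<Prod>j\<in>{1..p}. s + real j / real p) * Gamma (1 + real p * s)" .
    have "(\<Prod>j\<in>{1..p}. Gamma (s + 1 + real j / real p)) = (\<Prod>j\<in>{1..p}. (s + real j / real p) * Gamma (s + real j / real p))"
    proof (intro prod.cong refl)
      fix j assume "j \<in> {1..p}"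
      then have "s + real j / real p \<noteq> 0" using pos [OF s] by fastforce
      then show "Gamma (s + 1 + real j / real p) = (s + real j / real p) * Gamma (s + real j / real p)"
        using Gamma_plus1 [of "s + real j / real p"] pos [OF s \<open>j \<in> _\<close>]
        by (metis (no_types, lifting) add.commute add.left_commute nonpos_Ints_nonpos not_le)
    qed
    then have 2: "(\<Prod>j\<in>{1..p}. Gamma (s + 1 + real j / real p)) =
      (\<Prod>j\<in>{1..p}. s + real j / real p) * (\<Prod>j\<in>{1..p}. Gamma (s + real j / real p))"
      by (simp add: prod.distrib)
    have 3: "(\<Prod>j\<in>{1..p}. s + real j / real p) \<noteq> 0"
      using pos [OF s] by (intro less_imp_neq [THEN not_sym] prod_pos)
    show ?thesis
      unfolding r_def 1 2 using 3 p by (simp add: distrib_left powr_add)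
  qed
  have shift: "r (s + real m) = r s" if "s \<ge> 0" for s m
    by (induction m) (use that per [of "s + real m" for m] in \<open>auto simp: add_ac\<close>)
  \<comment> \<open>The leading behaviour of \<open>r (s + m + 1)\<close>, in which \<open>s\<close> does not occur.\<close>
  define K where "K m = fact (p * m + p) / (real p powr (real p * (real m + 1)) * (\<Prod>j\<in>{1..p}. fact m * real m powr (real j / real p)))" for m
  have lim: "(\<lambda>m. r s / K m) \<longlonglongrightarrow> 1" if s: "s \<ge> 0" for s
  proof -
    let ?n = "\<lambda>m. p * m + p"
    have "filterlim ?n at_top sequentially"
      using p by (intro filterlim_subseq) (auto simp: strict_mono_def)
    from filterlim_compose [OF Gamma_shift_asymptotics this, of "real p * s"]
    have 1: "(\<lambda>m. Gamma (real p * s + real (?n m) + 1) / (fact (?n m) * real (?n m) powr (real p * s))) \<longlonglongrightarrow> 1"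
      using s p by simp
    have 2: "(\<lambda>m. \<Prod>j\<in>{1..p}. Gamma ((s + real j / real p) + real m + 1) / (fact m * real m powr (s + real j / real p)))
      \<longlonglongrightarrow> (\<Prod>j\<in>{1..p}. 1)"
      using pos [OF s] by (intro tendsto_prod Gamma_shift_asymptotics) (auto intro: less_imp_le)
    have 3: "(\<lambda>m. ((real m + 1) / real m) powr (real p * s)) \<longlonglongrightarrow> 1"
    proof -
      have "(\<lambda>m. ((real m + 1) / real m) powr (real p * s)) \<longlonglongrightarrow> 1 powr (real p * s)"
        by (intro tendsto_powr tendsto_const) (real_asymp, simp)
      then show ?thesis by simp
    qed
    have "(\<lambda>m. Gamma (real p * s + real (?n m) + 1) / (fact (?n m) * real (?n m) powr (real p * s)) /
       (\<Prod>j\<in>{1..p}. Gamma ((s + real j / real p) + real m + 1) / (fact m * real m powr (s + real j / real p))) *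
       ((real m + 1) / real m) powr (real p * s)) \<longlonglongrightarrow> 1 / (\<Prod>j\<in>{1..p}. 1) * 1"
      by (intro tendsto_mult tendsto_divide 1 2 3) simp
    moreover have "eventually (\<lambda>m. Gamma (real p * s + real (?n m) + 1) / (fact (?n m) * real (?n m) powr (real p * s)) /
       (\<Prod>j\<in>{1..p}. Gamma ((s + real j / real p) + real m + 1) / (fact m * real m powr (s + real j / real p))) *
       ((real m + 1) / real m) powr (real p * s) = r s / K m) sequentially"
      using eventually_gt_at_top [of 0]
    proof eventually_elim
      case (elim m)
      have m: "real m > 0" using elim by simp
      have G: "(\<Prod>j\<in>{1..p}. Gamma (s + real j / real p + real m + 1)) \<noteq> 0"
      proof -
        have "Gamma (s + real j / real p + real m + 1) > 0" if "j \<in> {1..p}" for j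
          using pos [OF s that] m by (intro Gamma_real_pos) linarith
        then show ?thesis by (intro less_imp_neq [THEN not_sym] prod_pos) auto
      qed
      have e1: "(\<Prod>j\<in>{1..p}. Gamma ((s + real j / real p) + real m + 1) / (fact m * real m powr (s + real j / real p))) =
        (\<Prod>j\<in>{1..p}. Gamma (s + real j / real p + real m + 1)) / (real m powr (real p * s) * (\<Prod>j\<in>{1..p}. fact m * real m powr (real j / real p)))"
      proof -
        have "(\<Prod>j\<in>{1..p}. fact m * real m powr (s + real j / real p)) = (\<Prod>j\<in>{1..p}. real m powr s * (fact m * real m powr (real j / real p)))"
          by (simp add: powr_add mult.left_commute)
        also have "\<dots> = (\<Prod>j\<in>{1..p}. real m powr s) * (\<Prod>j\<in>{1..p}. fact m * real m powr (real j / real p))"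
          by (rule prod.distrib)
        also have "(\<Prod>j\<in>{1..p}. real m powr s) = real m powr (real p * s)"
          using m by (simp add: powr_realpow [symmetric] powr_powr mult.commute)
        finally show ?thesis by (simp add: prod_dividef)
      qed
      have e2: "real (?n m) powr (real p * s) = real p powr (real p * s) * (real m + 1) powr (real p * s)"
        using p m by (simp add: powr_mult [symmetric] algebra_simps)
      have e3: "((real m + 1) / real m) powr (real p * s) = (real m + 1) powr (real p * s) / real m powr (real p * s)"
        using m by (simp add: powr_divide)
      have e4: "r s = Gamma (real p * s + real (?n m) + 1) / (real p powr (real p * s) * real p powr (real p * (real m + 1)) * (\<Prod>j\<in>{1..p}. Gamma (s + real j / real p + real m + 1)))"
        using shift [OF s, of "m + 1"] unfolding r_def by (simp add: powr_add [symmetric] algebra_simps)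
      have nz: "real m powr (real p * s) > 0" "(real m + 1) powr (real p * s) > 0" "real p powr (real p * s) > 0" "real p powr (real p * (real m + 1)) > 0"
        using m p by simp_all
      have alg: "u / (f * (w * y)) / (A / (x * k)) * (y / x) = u / (w * z * A) / (f / (z * k))"
        if "x > 0" "y > 0" "w > 0" "z > 0" "A \<noteq> 0" for u f w y A x k z :: real
        using that by (simp add: field_simps)
      show ?case unfolding e1 e2 e3 e4 K_def by (rule alg [OF nz G])
    qed
    ultimately show ?thesis by (simp add: tendsto_cong)
  qed
  have "(\<lambda>m. (r s / K m) / (r 0 / K m)) \<longlonglongrightarrow> 1 / 1"
    using assms by (intro tendsto_divide lim) auto
  moreover have "eventually (\<lambda>m. (r s / K m) / (r 0 / K m) = r s / r 0) sequentially"
    using eventually_gt_at_top [of 0]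
  proof eventually_elim
    case (elim m)
    then have "K m \<noteq> 0" using p by (auto simp: K_def prod_zero_iff)
    then show ?case by simp
  qed
  ultimately have "(\<lambda>m. r s / r 0) \<longlonglongrightarrow> 1 / 1" by (rule Lim_transform_eventually)
  then have "r s = r 0" by (auto simp: LIMSEQ_const_iff divide_eq_1_iff)
  moreover have "(\<Prod>j\<in>{1..p}. Gamma (s + real j / real p)) \<noteq> 0" if "s \<ge> 0" for s
    using pos [OF that] by (intro less_imp_neq [THEN not_sym] prod_pos Gamma_real_pos)
  ultimately show ?thesis
    using assms p by (simp add: r_def field_simps prod_dividef)
qed

text \<open>
  Bounded random variables are determined by their moments: by the Weierstrass theorem, a continuous
  test function on the common range is uniformly close to a polynomial. The constant \<open>C\<close> accommodates
  measures whose total masses differ.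
\<close>

lemma integral_eq_if_moments_eq:
  fixes f :: "real \<Rightarrow> real"
  assumes "finite_measure M" "finite_measure N"
    and U: "U \<in> borel_measurable M" "\<And>x. x \<in> space M \<Longrightarrow> U x \<in> {0..B}"
    and V: "V \<in> borel_measurable N" "\<And>x. x \<in> space N \<Longrightarrow> V x \<in> {0..B}"
    and mom: "\<And>k. (\<integral>x. U x ^ k \<partial>M) = C * (\<integral>x. V x ^ k \<partial>N)"
    and f: "continuous_on {0..B} f" "f \<in> borel_measurable borel"
  shows "(\<integral>x. f (U x) \<partial>M) = C * (\<integral>x. f (V x) \<partial>N)"
proof -
  define c where "c = measure M (space M) + \<bar>C\<bar> * measure N (space N)"
  have c: "c \<ge> 0" by (simp add: c_def)
  have approx: "\<bar>(\<integral>x. f (U x) \<partial>M) - (\<integral>x. (\<Sum>i\<le>n. a i * U x ^ i) \<partial>M)\<bar> \<le> e * measure M (space M)"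
      "integrable M (\<lambda>x. U x ^ i)"
    if "finite_measure M" "U \<in> borel_measurable M" "\<And>x. x \<in> space M \<Longrightarrow> U x \<in> {0..B}"
      "\<And>x. x \<in> {0..B} \<Longrightarrow> \<bar>f x - (\<Sum>i\<le>n. a i * x ^ i)\<bar> < e"
    for M :: "'z measure" and U a e and n i :: nat
  proof -
    interpret finite_measure M by fact
    have pw: "integrable M (\<lambda>x. U x ^ i)" for i
      using that by (intro integrable_const_bound [of _ "B ^ i"]) (auto simp: power_mono)
    then show "integrable M (\<lambda>x. U x ^ i)" .
    obtain b where b: "\<And>x. x \<in> {0..B} \<Longrightarrow> norm (f x) \<le> b"
      using compact_imp_bounded [OF compact_continuous_image [OF f(1) compact_Icc]] unfolding bounded_iff by blast
    have fU: "integrable M (\<lambda>x. f (U x))"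
      using that f b by (intro integrable_const_bound [of _ b]) (auto intro: measurable_compose [OF _ f(2)])
    have pol: "integrable M (\<lambda>x. \<Sum>i\<le>n. a i * U x ^ i)" using pw by auto
    have "\<bar>(\<integral>x. f (U x) \<partial>M) - (\<integral>x. (\<Sum>i\<le>n. a i * U x ^ i) \<partial>M)\<bar> = \<bar>\<integral>x. f (U x) - (\<Sum>i\<le>n. a i * U x ^ i) \<partial>M\<bar>"
      using fU pol by simp
    also have "\<dots> \<le> (\<integral>x. \<bar>f (U x) - (\<Sum>i\<le>n. a i * U x ^ i)\<bar> \<partial>M)"
      using integral_norm_bound [of M "\<lambda>x. f (U x) - (\<Sum>i\<le>n. a i * U x ^ i)"] by simp
    also have "\<dots> \<le> (\<integral>x. e \<partial>M)"
      using fU pol that by (intro integral_mono) (auto intro!: less_imp_le)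
    also have "\<dots> = e * measure M (space M)" by simp
    finally show "\<bar>(\<integral>x. f (U x) \<partial>M) - (\<integral>x. (\<Sum>i\<le>n. a i * U x ^ i) \<partial>M)\<bar> \<le> e * measure M (space M)" .
  qed
  have "\<bar>(\<integral>x. f (U x) \<partial>M) - C * (\<integral>x. f (V x) \<partial>N)\<bar> \<le> e" if e: "e > 0" for e
  proof -
    have "e / (c + 1) > 0" using e c by simp
    then obtain g where g: "real_polynomial_function g" "\<And>x. x \<in> {0..B} \<Longrightarrow> \<bar>f x - g x\<bar> < e / (c + 1)"
      using Stone_Weierstrass_real_polynomial_function [OF compact_Icc f(1)] by metis
    then obtain a n where gs: "g = (\<lambda>x. \<Sum>i\<le>n. a i * x ^ i)"
      by (auto simp: real_polynomial_function_iff_sum)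
    note g = g(2) [unfolded gs]
    have "(\<integral>x. (\<Sum>i\<le>n. a i * U x ^ i) \<partial>M) = C * (\<integral>x. (\<Sum>i\<le>n. a i * V x ^ i) \<partial>N)"
      using approx(2) [OF assms(1) U g] approx(2) [OF assms(2) V g]
      by (subst (1 2) Bochner_Integration.integral_sum) (auto simp: mom sum_distrib_left mult_ac)
    moreover note approx(1) [OF assms(1) U g]
    moreover have "\<bar>C * (\<integral>x. f (V x) \<partial>N) - C * (\<integral>x. (\<Sum>i\<le>n. a i * V x ^ i) \<partial>N)\<bar>
       \<le> \<bar>C\<bar> * (e / (c + 1) * measure N (space N))"
      unfolding right_diff_distrib [symmetric] abs_mult by (intro mult_left_mono approx(1) [OF assms(2) V g]) auto
    ultimately have "\<bar>(\<integral>x. f (U x) \<partial>M) - C * (\<integral>x. f (V x) \<partial>N)\<bar> \<le> e / (c + 1) * measure M (space M) + \<bar>C\<bar> * (e / (c + 1) * measure N (space N))"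
      by linarith
    also have "\<dots> = e / (c + 1) * c" unfolding c_def by (simp only: distrib_left mult.left_commute)
    also have "\<dots> \<le> e" using e c by (simp add: field_simps)
    finally show ?thesis .
  qed
  then have "\<bar>(\<integral>x. f (U x) \<partial>M) - C * (\<integral>x. f (V x) \<partial>N)\<bar> \<le> 0" by (rule field_le_epsilon) auto
  then show ?thesis by simp
qed

text \<open>
  The law \<open>Beta (c, 1 - c)\<close>.
\<close>

definition arcsine_law :: "real \<Rightarrow> real measure" where
  "arcsine_law c = density (restrict_space lborel {0..1})
     (\<lambda>t. ennreal (t powr (c - 1) * (1 - t) powr (- c) / (Gamma c * Gamma (1 - c))))"

lemma space_arcsine_law [simp]: "space (arcsine_law c) = {0..1}"
  by (simp add: arcsine_law_def space_restrict_space)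

lemma sets_arcsine_law: "sets (arcsine_law c) = sets (restrict_space lborel {0..1})"
  by (simp add: arcsine_law_def)

lemma measurable_arcsine_law: "f \<in> borel_measurable borel \<Longrightarrow> f \<in> borel_measurable (arcsine_law c)"
  by (subst measurable_cong_sets [OF sets_arcsine_law refl], rule measurable_restrict_space1) simp

text \<open>
  The function \<open>g\<close> is prescribed only on \<open>(0, 1]\<close> in order to cover both \<open>t powr s\<close> and \<open>t ^ k\<close>, which
  differ at \<open>t = 0\<close> when the exponent is 0.
\<close>

lemma arcsine_law_moment:
  assumes c: "0 < c" "c < 1" and s: "s \<ge> 0"
    and g: "g \<in> borel_measurable borel" "\<And>t. 0 < t \<Longrightarrow> t \<le> 1 \<Longrightarrow> g t = t powr s"
  shows "has_bochner_integral (arcsine_law c) g (Gamma (s + c) / (Gamma c * Gamma (1 + s)))"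
proof -
  define d where "d t = t powr (c - 1) * (1 - t) powr (- c) / (Gamma c * Gamma (1 - c))" for t
  have d: "d \<in> borel_measurable (restrict_space lborel {0..1})" "d t \<ge> 0" for t
    unfolding d_def using c by (auto intro!: measurable_restrict_space1 divide_nonneg_nonneg mult_nonneg_nonneg)
  have eq: "arcsine_law c = density (restrict_space lborel {0..1}) d"
    by (simp add: arcsine_law_def d_def [abs_def])
  have int: "integrable lborel (\<lambda>t. indicator {0..1} t *\<^sub>R (t powr (s + c - 1) * (1 - t) powr (1 - c - 1)))"
    using integrable_Beta [of "s + c" "1 - c"] c s by (simp add: set_integrable_def)
  have "(\<integral>t. indicator {0..1} t *\<^sub>R (t powr (s + c - 1) * (1 - t) powr (1 - c - 1)) \<partial>lborel) = Beta (s + c) (1 - c)"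
    using set_borel_integral_eq_integral(2) [OF integrable_Beta [of "s + c" "1 - c"]]
      has_integral_Beta_real [of "s + c" "1 - c"] c s
    by (simp add: set_lebesgue_integral_def has_integral_iff)
  with int have "has_bochner_integral lborel (\<lambda>t. indicator {0..1} t *\<^sub>R (t powr (s + c - 1) * (1 - t) powr (1 - c - 1))) (Beta (s + c) (1 - c))"
    by (simp add: has_bochner_integral_iff)
  from has_bochner_integral_divide_zero [OF this, of "Gamma c * Gamma (1 - c)"]
  have "has_bochner_integral lborel (\<lambda>t. indicator {0..1} t *\<^sub>R (d t * g t)) (Beta (s + c) (1 - c) / (Gamma c * Gamma (1 - c)))"
  proof (rule has_bochner_integral_cong [THEN iffD1, rotated -1])
    fix t :: real
    show "indicator {0..1} t *\<^sub>R (t powr (s + c - 1) * (1 - t) powr (1 - c - 1)) / (Gamma c * Gamma (1 - c)) =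
      indicator {0..1} t *\<^sub>R (d t * g t)"
    proof (cases "0 < t \<and> t \<le> 1")
      case True
      then have "g t = t powr s" by (intro g) auto
      then show ?thesis
        using powr_add [of t s "c - 1"] by (simp add: d_def algebra_simps)
    next
      case False
      then show ?thesis by (cases "t = 0") (auto simp: indicator_def d_def)
    qed
  qed auto
  also have "Beta (s + c) (1 - c) / (Gamma c * Gamma (1 - c)) = Gamma (s + c) / (Gamma c * Gamma (1 + s))"
  proof -
    have "Gamma (1 - c) > 0" "Gamma c > 0" using c by auto
    then show ?thesis by (simp add: Beta_def add.commute)
  qed
  finally have "has_bochner_integral (restrict_space lborel {0..1}) (\<lambda>t. d t * g t) (Gamma (s + c) / (Gamma c * Gamma (1 + s)))"
    by (simp add: has_bochner_integral_restrict_space)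
  then show ?thesis unfolding eq
    using g(1) d by (intro has_bochner_integral_density) (auto intro!: measurable_restrict_space1)
qed

lemma finite_measure_arcsine_law:
  assumes "0 < c" "c < 1"
  shows "finite_measure (arcsine_law c)"
proof -
  have "has_bochner_integral (arcsine_law c) (\<lambda>t. 1 :: real) (Gamma (0 + c) / (Gamma c * Gamma (1 + 0)))"
    by (rule arcsine_law_moment) (use assms in auto)
  then have "integrable (arcsine_law c) (\<lambda>t. 1 :: real)" by (simp add: has_bochner_integral_iff)
  then show ?thesis by (intro finite_measureI) (simp add: integrable_iff_bounded less_top)
qed

text \<open>
  By Gauss's multiplication formula, the quotient is \<open>p powr (p s)\<close> times the product over \<open>0 < j < p\<close> of
  \<open>\<Gamma>(s + j / p) / (\<Gamma>(j / p) \<Gamma>(1 + s))\<close>. Each factor is the moment of order \<open>s\<close> of the law \<open>Beta (j / p, 1 - j / p)\<close>,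
  so the product is the moment of a product of independent variables with these laws.
\<close>

lemma Gamma_ratio_as_moment:
  assumes "p \<ge> 1"
  obtains N :: "(nat \<Rightarrow> real) measure" and V :: "(nat \<Rightarrow> real) \<Rightarrow> real"
  where "finite_measure N" "V \<in> borel_measurable N" "\<And>x. x \<in> space N \<Longrightarrow> V x \<in> {0..real p powr p}"
    "\<And>k. (\<integral>x. V x ^ k \<partial>N) = Gamma (1 + real p * real k) / Gamma (1 + real k) ^ p"
    "\<And>s. s > 0 \<Longrightarrow> (\<integral>x. V x powr s \<partial>N) = Gamma (1 + real p * s) / Gamma (1 + s) ^ p"
proof -
  have p: "real p > 0" using assms by simp
  define c where "c j = (if j \<in> {1..<p} then real j / real p else 1 / 2)" for j
  have c: "0 < c j" "c j < 1" for j using p by (auto simp: c_def)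
  let ?M = "\<lambda>j. arcsine_law (c j)"
  define N where "N = Pi\<^sub>M {1..<p} ?M"
  define V where "V x = real p powr p * (\<Prod>j\<in>{1..<p}. x j)" for x :: "nat \<Rightarrow> real"
  interpret product_sigma_finite ?M
    by (intro product_sigma_finite.intro finite_measure.sigma_finite_measure finite_measure_arcsine_law c)
  have N: "finite_measure N"
  proof (rule finite_measureI)
    have fin: "emeasure (?M j) (space (?M j)) \<noteq> \<infinity>" for j
      using finite_measure.emeasure_finite [OF finite_measure_arcsine_law [OF c [of j]]] by simp
    then show "emeasure N (space N) \<noteq> \<infinity>"
      unfolding N_def space_PiM using fin by (subst emeasure_PiM) (simp_all add: ennreal_prod_eq_top del: space_arcsine_law)
  qed
  have comp: "(\<lambda>x. x j) \<in> borel_measurable N" if "j \<in> {1..<p}" for j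
  proof -
    have "(\<lambda>x. x) \<in> borel_measurable (?M j)" by (rule measurable_arcsine_law) simp
    from measurable_compose [OF measurable_component_singleton [OF that, of ?M] this] show ?thesis by (simp add: N_def)
  qed
  have V: "V \<in> borel_measurable N"
    unfolding V_def [abs_def] by (intro borel_measurable_times borel_measurable_prod comp) auto
  have range: "x j \<in> {0..1}" if "x \<in> space N" "j \<in> {1..<p}" for x j
    using that by (auto simp: N_def space_PiM PiE_iff)
  have Vr: "V x \<in> {0..real p powr p}" if "x \<in> space N" for x
  proof -
    have "(\<Prod>j\<in>{1..<p}. x j) \<in> {0..1}"
      using range [OF that] by (auto intro!: prod_nonneg prod_le_1)
    then show ?thesis unfolding V_def by (auto intro: mult_left_le)
  qed
  have main: "(\<integral>x. h (V x) \<partial>N) = Gamma (1 + real p * s) / Gamma (1 + s) ^ p"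
    if s: "s \<ge> 0" and h: "\<And>x y. x \<ge> 0 \<Longrightarrow> y \<ge> 0 \<Longrightarrow> h (x * y) = h x * h y" "h 1 = 1"
      "h \<in> borel_measurable borel" "\<And>t. t > 0 \<Longrightarrow> h t = t powr s" for h s
  proof -
    have prod_h: "(\<Prod>j\<in>J. x j) \<ge> 0 \<and> h (\<Prod>j\<in>J. x j) = (\<Prod>j\<in>J. h (x j))" if "finite J" "\<And>j. j \<in> J \<Longrightarrow> x j \<ge> 0"
      for J and x :: "nat \<Rightarrow> real"
      using that by (induction J) (auto simp: h)
    have "(\<integral>x. h (V x) \<partial>N) = (\<integral>x. real p powr (real p * s) * (\<Prod>j\<in>{1..<p}. h (x j)) \<partial>N)"
    proof (intro Bochner_Integration.integral_cong refl)
      fix x assume "x \<in> space N"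
      then have "\<And>j. j \<in> {1..<p} \<Longrightarrow> x j \<ge> 0" using range by auto
      then show "h (V x) = real p powr (real p * s) * (\<Prod>j\<in>{1..<p}. h (x j))"
        using prod_h [of "{1..<p}" x] p unfolding V_def
        by (subst h(1)) (auto simp: h(4) powr_powr)
    qed
    also have "\<dots> = real p powr (real p * s) * (\<integral>x. (\<Prod>j\<in>{1..<p}. h (x j)) \<partial>N)" by simp
    also have "(\<integral>x. (\<Prod>j\<in>{1..<p}. h (x j)) \<partial>N) = (\<Prod>j\<in>{1..<p}. \<integral>t. h t \<partial>?M j)"
      unfolding N_def using arcsine_law_moment [OF c s h(3)] h(4)
      by (intro product_integral_prod) (auto simp: has_bochner_integral_iff)
    also have "\<dots> = (\<Prod>j\<in>{1..<p}. Gamma (s + real j / real p) / (Gamma (real j / real p) * Gamma (1 + s)))"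
    proof (intro prod.cong refl)
      fix j assume j: "j \<in> {1..<p}"
      show "(\<integral>t. h t \<partial>?M j) = Gamma (s + real j / real p) / (Gamma (real j / real p) * Gamma (1 + s))"
        using arcsine_law_moment [OF c [of j] s h(3)] h(4) j by (simp add: has_bochner_integral_iff c_def)
    qed
    also have "real p powr (real p * s) * (\<Prod>j\<in>{1..<p}. Gamma (s + real j / real p) / (Gamma (real j / real p) * Gamma (1 + s)))
      = Gamma (1 + real p * s) / Gamma (1 + s) ^ p"
    proof -
      have G: "Gamma (1 + s) > 0" using s by auto
      have "{1..p} = insert p {1..<p}" using assms by auto
      then have "Gamma (1 + real p * s) = real p powr (real p * s) *
         (\<Prod>j\<in>{1..<p}. Gamma (s + real j / real p) / Gamma (real j / real p)) * Gamma (1 + s)"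
        unfolding Gauss_multiplication [OF assms s] using p by (simp add: add.commute)
      moreover have "(\<Prod>j\<in>{1..<p}. Gamma (s + real j / real p) / (Gamma (real j / real p) * Gamma (1 + s))) =
         (\<Prod>j\<in>{1..<p}. Gamma (s + real j / real p) / Gamma (real j / real p)) / Gamma (1 + s) ^ (p - 1)"
        by (simp add: prod_dividef prod.distrib)
      moreover have "Gamma (1 + s) ^ p = Gamma (1 + s) * Gamma (1 + s) ^ (p - 1)"
        using assms by (simp add: power_eq_if)
      ultimately show ?thesis using G by simp
    qed
    finally show ?thesis .
  qed
  show thesis
  proof (rule that [OF N V Vr])
    show "(\<integral>x. V x ^ k \<partial>N) = Gamma (1 + real p * real k) / Gamma (1 + real k) ^ p" for k
      by (rule main [where h = "\<lambda>x. x ^ k"]) (auto simp: power_mult_distrib powr_realpow)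
    show "(\<integral>x. V x powr s \<partial>N) = Gamma (1 + real p * s) / Gamma (1 + s) ^ p" if "s > 0" for s
      by (rule main [where h = "\<lambda>x. x powr s"]) (use that in \<open>auto simp: powr_mult\<close>)
  qed
qed

text \<open>
  On a disc around a point of the half-plane, the derivative of \<open>W powr s\<close> in \<open>s\<close> is bounded uniformly in
  \<open>W \<in> [0, B]\<close>, since a positive power of \<open>W\<close> beats the logarithm at 0. Hence one may differentiate under
  the integral by dominated convergence.
\<close>

lemma holomorphic_integral_powr:
  assumes "finite_measure M" and W: "W \<in> borel_measurable M" "\<And>x. x \<in> space M \<Longrightarrow> W x \<in> {0..B}"
  shows "(\<lambda>s. \<integral>x. complex_of_real (W x) powr s \<partial>M) holomorphic_on {s. Re s > 0}"
proof -
  interpret finite_measure M by fact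
  define F where "F s = (\<integral>x. complex_of_real (W x) powr s \<partial>M)" for s
  have open_H: "open {s. Re s > 0}" by (rule open_halfspace_Re_gt)
  have meas: "(\<lambda>x. complex_of_real (W x) powr s) \<in> borel_measurable M" for s
    using W by measurable
  have "\<exists>D. (F has_field_derivative D) (at s0)" if s0: "Re s0 > 0" for s0
  proof -
    define r where "r = Re s0 / 2"
    define b where "b = max B 1"
    \<comment> \<open>The first summand is for \<open>w < 1\<close>, where \<open>r * \<bar>ln w\<bar> \<le> w powr (- r)\<close>; the second one is for \<open>w \<ge> 1\<close>.\<close>
    define C where "C = 1 / r + b powr (3 * r) * b"
    define g' where "g' w s = (if w = 0 then 0 else Ln (complex_of_real w) * complex_of_real w powr s)" for w s
    have r: "r > 0" using s0 by (simp add: r_def)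
    have b: "b \<ge> 1" by (simp add: b_def)
    \<comment> \<open>The case \<open>w = 0\<close> is consistent, as \<open>0 powr s\<close> is constantly 0.\<close>
    have der: "((\<lambda>s. complex_of_real w powr s) has_field_derivative g' w s) (at s within A)" for w s A
      by (cases "w = 0") (auto simp: g'_def intro!: has_field_derivative_at_within has_field_derivative_powr_right)
    have bound: "norm (g' w s) \<le> C" if w: "w \<in> {0..B}" and s: "s \<in> cball s0 r" for w s
    proof (cases "w = 0")
      case False
      then have w0: "w > 0" using w by simp
      have "\<bar>Re s0 - Re s\<bar> \<le> r" using s abs_Re_le_cmod [of "s0 - s"] by (simp add: dist_norm)
      then have Re: "Re s \<ge> r" "Re s \<le> 3 * r" unfolding r_def by linarith+
      have "norm (g' w s) = \<bar>ln w\<bar> * w powr Re s"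
        using w0 by (simp add: g'_def norm_mult Ln_of_real norm_powr_real_powr)
      also have "\<dots> \<le> C"
      proof (cases "w \<ge> 1")
        case True
        have "\<bar>ln w\<bar> \<le> b" using True ln_le_minus_one [OF w0] w by (auto simp: b_def)
        moreover have "w powr Re s \<le> w powr (3 * r)" using True Re by (intro powr_mono) auto
        moreover have "w powr (3 * r) \<le> b powr (3 * r)" using w0 w r by (intro powr_mono2) (auto simp: b_def)
        ultimately have "\<bar>ln w\<bar> * w powr Re s \<le> b * b powr (3 * r)" by (intro mult_mono) auto
        then show ?thesis using r by (simp add: C_def mult.commute add_increasing)
      next
        case False
        have "w powr Re s \<le> w powr r" using False w0 Re by (intro powr_mono') auto
        have "ln (w powr (- r)) \<le> w powr (- r) - 1" using w0 by (intro ln_le_minus_one) auto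
        then have "- r * ln w \<le> w powr (- r)" using w0 by (simp add: ln_powr)
        then have "- r * ln w * w powr r \<le> w powr (- r) * w powr r" by (intro mult_right_mono) auto
        also have "\<dots> = 1" using w0 by (simp add: powr_minus)
        finally have "\<bar>ln w\<bar> * w powr r \<le> 1 / r" using False w0 r by (simp add: field_simps abs_if)
        moreover have "\<bar>ln w\<bar> * w powr Re s \<le> \<bar>ln w\<bar> * w powr r" using \<open>w powr Re s \<le> w powr r\<close> by (intro mult_left_mono) auto
        moreover have "0 \<le> b powr (3 * r) * b" using b by simp
        ultimately show ?thesis by (simp add: C_def)
      qed
      finally show ?thesis .
    qed (use r b in \<open>auto simp: g'_def C_def\<close>)
    have int: "integrable M (\<lambda>x. complex_of_real (W x) powr s)" if "Re s > 0" for s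
    proof (rule integrable_const_bound [of _ "b powr Re s"])
      show "AE x in M. norm (complex_of_real (W x) powr s) \<le> b powr Re s"
      proof (rule AE_I2)
        fix x assume "x \<in> space M"
        then have "0 \<le> W x" "W x \<le> b" using W(2) by (auto simp: b_def le_max_iff_disj)
        then show "norm (complex_of_real (W x) powr s) \<le> b powr Re s"
          using that by (auto simp: norm_powr_real_powr intro!: powr_mono2)
      qed
    qed (rule meas)
    have "((\<lambda>h. (F (s0 + h) - F s0) / h) \<longlongrightarrow> (\<integral>x. g' (W x) s0 \<partial>M)) (at 0)"
      unfolding tendsto_at_iff_sequentially
    proof (intro allI impI)
      fix X :: "nat \<Rightarrow> complex"
      assume X: "\<forall>i. X i \<in> UNIV - {0}" "X \<longlonglongrightarrow> 0"
      have "eventually (\<lambda>n. norm (X n) < r) sequentially"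
        using tendstoD [OF X(2) r] by (simp add: dist_norm)
      then obtain n0 where n0: "\<And>n. n \<ge> n0 \<Longrightarrow> norm (X n) < r" by (auto simp: eventually_sequentially)
      let ?q = "\<lambda>n x. (complex_of_real (W x) powr (s0 + X (n + n0)) - complex_of_real (W x) powr s0) / X (n + n0)"
      have "(\<lambda>n. \<integral>x. ?q n x \<partial>M) \<longlonglongrightarrow> (\<integral>x. g' (W x) s0 \<partial>M)"
      proof (rule integral_dominated_convergence [where w = "\<lambda>_. C"])
        show "(\<lambda>x. g' (W x) s0) \<in> borel_measurable M" unfolding g'_def using W(1) by measurable
        show "?q n \<in> borel_measurable M" for n using meas by (intro borel_measurable_divide borel_measurable_diff) auto
        show "integrable M (\<lambda>_. C)" by simp
        show "AE x in M. (\<lambda>n. ?q n x) \<longlonglongrightarrow> g' (W x) s0"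
        proof (rule AE_I2)
          fix x
          have "(\<lambda>h. (complex_of_real (W x) powr (s0 + h) - complex_of_real (W x) powr s0) / h) \<midarrow>0\<rightarrow> g' (W x) s0"
            using der [of "W x" s0 UNIV] by (simp add: DERIV_def)
          then have "(\<lambda>n. (complex_of_real (W x) powr (s0 + X n) - complex_of_real (W x) powr s0) / X n) \<longlonglongrightarrow> g' (W x) s0"
            using X unfolding tendsto_at_iff_sequentially o_def by blast
          then show "(\<lambda>n. ?q n x) \<longlonglongrightarrow> g' (W x) s0" by (rule LIMSEQ_ignore_initial_segment)
        qed
        show "AE x in M. norm (?q n x) \<le> C" for n
        proof (rule AE_I2)
          fix x assume x: "x \<in> space M"
          have "norm (complex_of_real (W x) powr (s0 + X (n + n0)) - complex_of_real (W x) powr s0) \<le> C * norm (s0 + X (n + n0) - s0)"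
            by (rule field_differentiable_bound [OF convex_cball [of s0 r] der bound [OF W(2) [OF x]]])
               (use r n0 [of "n + n0"] in \<open>auto simp: dist_norm\<close>)
          then show "norm (?q n x) \<le> C" using X(1) by (simp add: norm_divide field_simps)
        qed
      qed
      moreover have "(\<integral>x. ?q n x \<partial>M) = (F (s0 + X (n + n0)) - F s0) / X (n + n0)" for n
      proof -
        have "Re (s0 + X (n + n0)) > 0" using n0 [of "n + n0"] abs_Re_le_cmod [of "X (n + n0)"] s0 unfolding r_def by auto
        then show ?thesis unfolding F_def using int s0 by (subst integral_divide_zero) auto
      qed
      ultimately have "(\<lambda>n. (F (s0 + X (n + n0)) - F s0) / X (n + n0)) \<longlonglongrightarrow> (\<integral>x. g' (W x) s0 \<partial>M)" by (simp only:)
      then show "((\<lambda>h. (F (s0 + h) - F s0) / h) \<circ> X) \<longlonglongrightarrow> (\<integral>x. g' (W x) s0 \<partial>M)"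
        unfolding o_def by (rule LIMSEQ_offset [where k = n0])
    qed
    then show ?thesis by (auto simp: DERIV_def)
  qed
  then show ?thesis
    unfolding F_def [symmetric] by (auto simp: holomorphic_on_open [OF open_H])
qed

section \<open>Powers of the density at complex exponents\<close>

lemma vandermonde_sq_measurable [measurable]: "vandermonde_sq n \<in> borel_measurable (circ_base n)"
proof -
  have comp: "(\<lambda>\<theta>. \<theta> i) \<in> borel_measurable (circ_base n)" if "i \<in> {1..n}" for i
  proof -
    have "(\<lambda>x. x) \<in> borel_measurable circle_measure" by (rule measurable_circle_measure) simp
    from measurable_compose [OF measurable_component_singleton [OF that] this] show ?thesis
      by (simp add: circ_base_eq)
  qed
  have "(\<lambda>\<theta>. cmod (cis (\<theta> k) - cis (\<theta> j))) \<in> borel_measurable (circ_base n)" if "k \<in> {1..n}" "j \<in> {1..<k}" for j k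
  proof -
    have "j \<in> {1..n}" using that by auto
    note [measurable] = comp [OF that(1)] comp [OF this]
    show ?thesis by measurable
  qed
  then show ?thesis
    unfolding vandermonde_sq_def [abs_def] by (intro borel_measurable_prod borel_measurable_power)
qed

lemma vandermonde_sq_nonneg: "0 \<le> vandermonde_sq n \<theta>"
  by (simp add: vandermonde_sq_def prod_nonneg)

lemma vandermonde_sq_le: "vandermonde_sq n \<theta> \<le> (\<Prod>k\<in>{1..n}. \<Prod>j\<in>{1..<k}. 4)"
proof -
  have "(cmod (cis a - cis b))\<^sup>2 \<le> 4" for a b
  proof -
    have "cmod (cis a - cis b) \<le> 2" using norm_triangle_ineq4 [of "cis a" "cis b"] by simp
    then have "(cmod (cis a - cis b))\<^sup>2 \<le> 2\<^sup>2" by (intro power_mono) auto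
    then show ?thesis by simp
  qed
  then show ?thesis unfolding vandermonde_sq_def by (intro prod_mono conjI prod_nonneg) auto
qed

lemma finite_measure_circ_base: "finite_measure (circ_base n)"
  unfolding circ_base_eq by (rule finite_measure_circle_PiM) simp

text \<open>
  The squared Vandermonde determinant and the product of beta variables have the same integer moments up to the
  factor \<open>(2\<pi>)\<^sup>n\<close>, and both are bounded.
\<close>

lemma dyson_integral_real:
  assumes "n \<ge> 1" "s > 0"
  shows "(\<integral>\<theta>. vandermonde_sq n \<theta> powr s \<partial>circ_base n) = (2 * pi) ^ n * (Gamma (1 + real n * s) / Gamma (1 + s) ^ n)"
proof -
  obtain N :: "(nat \<Rightarrow> real) measure" and V where N: "finite_measure N" "V \<in> borel_measurable N"
    "\<And>x. x \<in> space N \<Longrightarrow> V x \<in> {0..real n powr n}"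
    "\<And>k. (\<integral>x. V x ^ k \<partial>N) = Gamma (1 + real n * real k) / Gamma (1 + real k) ^ n"
    "\<And>s. s > 0 \<Longrightarrow> (\<integral>x. V x powr s \<partial>N) = Gamma (1 + real n * s) / Gamma (1 + s) ^ n"
    using Gamma_ratio_as_moment [OF assms(1)] by metis
  define B where "B = max (real n powr n) (\<Prod>k\<in>{1..n}. \<Prod>j\<in>{1..<k}. 4)"
  have "(\<integral>\<theta>. vandermonde_sq n \<theta> powr s \<partial>circ_base n) = (2 * pi) ^ n * (\<integral>x. V x powr s \<partial>N)"
  proof (rule integral_eq_if_moments_eq [OF finite_measure_circ_base N(1) vandermonde_sq_measurable _ N(2)])
    show "vandermonde_sq n \<theta> \<in> {0..B}" for \<theta>
      using vandermonde_sq_nonneg vandermonde_sq_le [of n \<theta>] by (auto simp: B_def)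
    show "V x \<in> {0..B}" if "x \<in> space N" for x using N(3) [OF that] by (auto simp: B_def)
    show "(\<integral>\<theta>. vandermonde_sq n \<theta> ^ k \<partial>circ_base n) = (2 * pi) ^ n * (\<integral>x. V x ^ k \<partial>N)" for k
      using Gamma_fact [of "n * k", where 'a = real] Gamma_fact [of k, where 'a = real]
      by (simp add: integral_vandermonde_sq_power N(4))
    show "continuous_on {0..B} (\<lambda>x. x powr s)"
      using assms by (intro continuous_on_powr' continuous_intros) auto
  qed auto
  then show ?thesis using N(5) [OF assms(2)] by simp
qed

theorem dyson_integral:
  assumes n: "n \<ge> 1" and s: "Re s > 0"
  shows "(\<integral>\<theta>. complex_of_real (vandermonde_sq n \<theta>) powr s \<partial>circ_base n)
       = (2 * of_real pi) ^ n * (Gamma (1 + of_nat n * s) / Gamma (1 + s) ^ n)"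
proof -
  let ?H = "{s. Re s > 0}"
  let ?f = "\<lambda>s. (\<integral>\<theta>. complex_of_real (vandermonde_sq n \<theta>) powr s \<partial>circ_base n)
      - (2 * of_real pi) ^ n * (Gamma (1 + of_nat n * s) / Gamma (1 + s) ^ n)"
  have np: "1 + of_nat k * s \<notin> \<int>\<^sub>\<le>\<^sub>0" if "s \<in> ?H" for s :: complex and k
    using that by (auto elim!: nonpos_Ints_cases simp: complex_eq_iff)
      (metis add_pos_nonneg less_eq_real_def mult_nonneg_nonneg not_less of_int_le_0_iff of_nat_0_le_iff zero_less_one)
  have np': "1 + s \<notin> \<int>\<^sub>\<le>\<^sub>0" if "s \<in> ?H" for s :: complex using np [OF that, of 1] by simp
  have "?f s = 0"
  proof (rule analytic_continuation [where S = ?H and U = "complex_of_real ` {0<..}" and \<xi> = 1 and f = ?f])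
    have "(\<lambda>s. \<integral>\<theta>. complex_of_real (vandermonde_sq n \<theta>) powr s \<partial>circ_base n) holomorphic_on ?H"
      by (rule holomorphic_integral_powr [OF finite_measure_circ_base vandermonde_sq_measurable])
         (use vandermonde_sq_nonneg vandermonde_sq_le in auto)
    moreover have "(\<lambda>s. (2 * of_real pi) ^ n * (Gamma (1 + of_nat n * s) / Gamma (1 + s) ^ n)) holomorphic_on ?H"
      using np np' by (auto intro!: holomorphic_intros simp: Gamma_eq_zero_iff)
    ultimately show "?f holomorphic_on ?H" by (rule holomorphic_on_diff)
    show "open ?H" by (rule open_halfspace_Re_gt)
    show "connected ?H" by (intro convex_connected convex_halfspace_Re_gt)
    show "complex_of_real ` {0<..} \<subseteq> ?H" by auto
    have "(1 :: real) islimpt {0<..}" by (simp add: interior_limit_point interior_open)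
    then show "1 islimpt complex_of_real ` {0<..}"
      unfolding islimpt_sequential
    proof (elim exE conjE)
      fix f :: "nat \<Rightarrow> real" assume f: "\<forall>n. f n \<in> {0<..} - {1}" "f \<longlonglongrightarrow> 1"
      show "\<exists>f. (\<forall>n. f n \<in> complex_of_real ` {0<..} - {1}) \<and> f \<longlonglongrightarrow> 1"
        using f tendsto_of_real [OF f(2), where 'a = complex] by (intro exI [of _ "\<lambda>n. of_real (f n)"]) auto
    qed
    fix z assume "z \<in> complex_of_real ` {0<..}"
    then obtain x where x: "z = of_real x" "x > 0" by auto
    have "(\<integral>\<theta>. complex_of_real (vandermonde_sq n \<theta>) powr z \<partial>circ_base n)
        = (\<integral>\<theta>. complex_of_real (vandermonde_sq n \<theta> powr x) \<partial>circ_base n)"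
      unfolding x by (intro Bochner_Integration.integral_cong refl powr_of_real vandermonde_sq_nonneg)
    also have "\<dots> = of_real ((2 * pi) ^ n * (Gamma (1 + real n * x) / Gamma (1 + x) ^ n))"
      by (simp only: integral_complex_of_real dyson_integral_real [OF n x(2)])
    also have "\<dots> = (2 * of_real pi) ^ n * (Gamma (1 + of_nat n * z) / Gamma (1 + z) ^ n)"
      by (simp add: x Gamma_complex_of_real [symmetric])
    finally show "?f z = 0" by simp
  qed (use s in auto)
  then show ?thesis by simp
qed

lemma circ_Z_pos: "\<beta> > 0 \<Longrightarrow> circ_Z n \<beta> > 0"
  unfolding circ_Z_def by (intro mult_pos_pos divide_pos_pos zero_less_power Gamma_real_pos add_pos_nonneg) auto

lemma circ_density_eq: "circ_density n \<beta> \<theta> = vandermonde_sq n \<theta> powr (\<beta> / 2) / circ_Z n \<beta>"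
proof -
  have "x powr \<beta> = (x\<^sup>2) powr (\<beta> / 2)" if "x \<ge> 0" for x :: real
    using that by (cases "x = 0") (auto simp: powr_powr simp flip: powr_numeral)
  then have "(\<Prod>k\<in>{1..n}. \<Prod>j\<in>{1..<k}. cmod (cis (\<theta> k) - cis (\<theta> j)) powr \<beta>) = vandermonde_sq n \<theta> powr (\<beta> / 2)"
    unfolding vandermonde_sq_def by (simp add: prod_powr_distrib prod_nonneg)
  then show ?thesis by (simp add: circ_density_def)
qed

text \<open>
  Where the density vanishes, both sides are 0 because \<open>0 powr s = 0\<close>; the junk value of the log-likelihood
  is harmless there.
\<close>

lemma circ_density_times_power:
  assumes "\<beta> > 0"
  shows "complex_of_real (circ_density n \<beta> \<theta>) * exp (w * of_real (circ_loglik n \<beta> \<theta>)) =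
    complex_of_real (vandermonde_sq n \<theta>) powr ((1 + w) * of_real (\<beta> / 2)) * exp (- ((1 + w) * of_real (ln (circ_Z n \<beta>))))"
proof (cases "vandermonde_sq n \<theta> = 0")
  case False
  then have v: "vandermonde_sq n \<theta> > 0" using vandermonde_sq_nonneg [of n \<theta>] by linarith
  note Z = circ_Z_pos [OF assms, of n]
  have d: "circ_density n \<beta> \<theta> > 0" using v Z by (simp add: circ_density_eq)
  have L: "circ_loglik n \<beta> \<theta> = \<beta> / 2 * ln (vandermonde_sq n \<theta>) - ln (circ_Z n \<beta>)"
    using v Z by (simp add: circ_loglik_def circ_density_eq ln_div ln_powr)
  have "complex_of_real (circ_density n \<beta> \<theta>) = exp (of_real (circ_loglik n \<beta> \<theta>))"
    using d by (simp add: circ_loglik_def exp_of_real)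
  then have "complex_of_real (circ_density n \<beta> \<theta>) * exp (w * of_real (circ_loglik n \<beta> \<theta>)) = exp ((1 + w) * of_real (circ_loglik n \<beta> \<theta>))"
    by (simp add: exp_add algebra_simps)
  also have "\<dots> = exp ((1 + w) * of_real (\<beta> / 2) * of_real (ln (vandermonde_sq n \<theta>)) + (- ((1 + w) * of_real (ln (circ_Z n \<beta>)))))"
    unfolding L by (rule arg_cong [where f = exp]) (simp add: algebra_simps)
  also have "\<dots> = complex_of_real (vandermonde_sq n \<theta>) powr ((1 + w) * of_real (\<beta> / 2)) * exp (- ((1 + w) * of_real (ln (circ_Z n \<beta>))))"
    using v unfolding exp_add by (simp add: powr_def Ln_of_real)
  finally show ?thesis .
qed (simp add: circ_density_eq)

lemma circ_loglik_measurable [measurable]: "circ_loglik n \<beta> \<in> borel_measurable (circ_base n)"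
  unfolding circ_loglik_def [abs_def] circ_density_eq by measurable

lemma exp_loglik_expectation_Gamma:
  assumes \<beta>: "\<beta> > 0" and n: "n \<ge> 1" and w: "Re w > -1"
    and dist: "distributed M (circ_base n) \<theta> (\<lambda>x. ennreal (circ_density n \<beta> x))"
  shows "has_bochner_integral M (\<lambda>\<omega>. exp (w * of_real (circ_loglik n \<beta> (\<theta> \<omega>))))
    (exp (- ((1 + w) * of_real (ln (circ_Z n \<beta>)))) *
      ((2 * of_real pi) ^ n * (Gamma (1 + of_nat n * ((1 + w) * of_real (\<beta> / 2))) / Gamma (1 + (1 + w) * of_real (\<beta> / 2)) ^ n)))"
proof -
  let ?s = "(1 + w) * of_real (\<beta> / 2)"
  let ?g = "\<lambda>x. exp (w * of_real (circ_loglik n \<beta> x))"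
  have s: "Re ?s > 0" using w \<beta> by simp
  interpret finite_measure "circ_base n" by (rule finite_measure_circ_base)
  define B where "B = (\<Prod>k\<in>{1..n}. \<Prod>j\<in>{1..<k}. 4 :: real)"
  have "integrable (circ_base n) (\<lambda>\<theta>. complex_of_real (vandermonde_sq n \<theta>) powr ?s)"
  proof (rule integrable_const_bound [of _ "B powr Re ?s"])
    show "AE \<theta> in circ_base n. norm (complex_of_real (vandermonde_sq n \<theta>) powr ?s) \<le> B powr Re ?s"
      using s vandermonde_sq_nonneg vandermonde_sq_le
      by (intro AE_I2) (simp add: norm_powr_real_powr B_def powr_mono2)
  qed measurable
  then have "has_bochner_integral (circ_base n) (\<lambda>\<theta>. complex_of_real (vandermonde_sq n \<theta>) powr ?s)
     ((2 * of_real pi) ^ n * (Gamma (1 + of_nat n * ?s) / Gamma (1 + ?s) ^ n))"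
    by (simp only: has_bochner_integral_iff dyson_integral [OF n s])
  then have "has_bochner_integral (circ_base n)
     (\<lambda>\<theta>. exp (- ((1 + w) * of_real (ln (circ_Z n \<beta>)))) * complex_of_real (vandermonde_sq n \<theta>) powr ?s)
     (exp (- ((1 + w) * of_real (ln (circ_Z n \<beta>)))) * ((2 * of_real pi) ^ n * (Gamma (1 + of_nat n * ?s) / Gamma (1 + ?s) ^ n)))"
    by (rule has_bochner_integral_mult_right)
  then have "has_bochner_integral (circ_base n) (\<lambda>\<theta>. circ_density n \<beta> \<theta> *\<^sub>R ?g \<theta>)
    (exp (- ((1 + w) * of_real (ln (circ_Z n \<beta>)))) * ((2 * of_real pi) ^ n * (Gamma (1 + of_nat n * ?s) / Gamma (1 + ?s) ^ n)))"
    unfolding scaleR_conv_of_real circ_density_times_power [OF \<beta>] by (simp only: mult.commute [of "_ powr _" "exp _"])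
  then have "has_bochner_integral (density (circ_base n) (\<lambda>x. ennreal (circ_density n \<beta> x))) ?g
    (exp (- ((1 + w) * of_real (ln (circ_Z n \<beta>)))) * ((2 * of_real pi) ^ n * (Gamma (1 + of_nat n * ?s) / Gamma (1 + ?s) ^ n)))"
    using circ_Z_pos [OF \<beta>, of n]
    by (intro has_bochner_integral_density) (auto simp: circ_density_eq [abs_def])
  also have "density (circ_base n) (\<lambda>x. ennreal (circ_density n \<beta> x)) = distr M (circ_base n) \<theta>"
    using distributed_distr_eq_density [OF dist] by simp
  finally have *: "has_bochner_integral (distr M (circ_base n) \<theta>) ?g
    (exp (- ((1 + w) * of_real (ln (circ_Z n \<beta>)))) * ((2 * of_real pi) ^ n * (Gamma (1 + of_nat n * ?s) / Gamma (1 + ?s) ^ n)))" .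
  have g: "?g \<in> borel_measurable (circ_base n)" by measurable
  note \<theta> = distributed_measurable [OF dist]
  show ?thesis
    using * unfolding has_bochner_integral_iff integrable_distr_eq [OF \<theta> g] integral_distr [OF \<theta> g] .
qed

section \<open>Stirling's formula up to linear terms\<close>

text \<open>
  The difference between the trigamma series and the telescoping series of \<open>1 / x\<close>.
\<close>

lemma trigamma_series:
  fixes x :: "'a :: {real_normed_field, banach}"
  assumes "\<And>k. x + of_nat k \<noteq> 0"
  shows "(\<lambda>k. 1 / ((x + of_nat k) * (x + of_nat (Suc k))\<^sup>2)) sums (1 / x - Polygamma 1 (1 + x))"
proof -
  have "1 + x \<noteq> 0" using assms [of 1] by (simp add: add.commute)
  from Polygamma_LIMSEQ [OF this, of 1]
  have 1: "(\<lambda>k. inverse ((1 + x + of_nat k) ^ 2)) sums Polygamma 1 (1 + x)" by (simp add: numeral_2_eq_2)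
  have "(\<lambda>k. inverse (x + of_nat k)) \<longlonglongrightarrow> 0"
    by (intro filterlim_compose [OF tendsto_inverse_0] tendsto_add_filterlim_at_infinity [OF tendsto_const] tendsto_of_nat)
  from telescope_sums' [OF this]
  have 2: "(\<lambda>k. inverse (x + of_nat k) - inverse (x + of_nat (Suc k))) sums (inverse (x + of_nat 0) - 0)" .
  have eq: "inverse (x + of_nat k) - inverse (x + of_nat (Suc k)) - inverse ((1 + x + of_nat k) ^ 2)
     = 1 / ((x + of_nat k) * (x + of_nat (Suc k))\<^sup>2)" for k
  proof -
    have "inverse u - inverse (u + 1) - inverse ((u + 1)\<^sup>2) = 1 / (u * (u + 1)\<^sup>2)" if "u \<noteq> 0" "u + 1 \<noteq> 0" for u :: 'a
    proof -
      define v where "v = u + 1"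
      have v: "v \<noteq> 0" "u = v - 1" "v - 1 \<noteq> 0" using that by (auto simp: v_def)
      have "inverse u - inverse v - inverse (v\<^sup>2) = (v\<^sup>2 - u * v - u) / (u * v\<^sup>2)"
        using that(1) v(1) by (simp add: diff_divide_distrib power2_eq_square inverse_eq_divide)
      also have "v\<^sup>2 - u * v - u = 1" unfolding v(2) by (simp add: algebra_simps power2_eq_square)
      finally show ?thesis by (simp add: v_def)
    qed
    from this [of "x + of_nat k"] assms [of k] assms [of "Suc k"] show ?thesis by (simp add: add_ac)
  qed
  from sums_diff [OF 2 1] show ?thesis unfolding eq by (simp add: inverse_eq_divide)
qed

lemma trigamma_bound:
  assumes "Re x > 0"
  shows "norm (Polygamma 1 (1 + x) - 1 / x) \<le> 1 / (Re x)\<^sup>2"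
proof -
  let ?a = "Re x"
  have "x + of_nat k \<noteq> 0" for k using assms by (auto simp: complex_eq_iff)
  note s = trigamma_series [OF this]
  have "(\<lambda>k. inverse (?a + real k)) \<longlonglongrightarrow> 0" by real_asymp
  from sums_divide [OF telescope_sums' [OF this], of ?a]
  have t: "(\<lambda>k. (inverse (?a + real k) - inverse (?a + real (Suc k))) / ?a) sums (1 / ?a\<^sup>2)"
    using assms by (simp add: power2_eq_square field_simps)
  have "norm (1 / x - Polygamma 1 (1 + x)) \<le> 1 / ?a\<^sup>2"
  proof (rule norm_sums_le [OF s t])
    fix k
    have n: "norm (x + of_nat k) \<ge> ?a + real k" for k using complex_Re_le_cmod [of "x + of_nat k"] by simp
    have "norm (1 / ((x + of_nat k) * (x + of_nat (Suc k))\<^sup>2)) = 1 / (norm (x + of_nat k) * (norm (x + of_nat (Suc k)))\<^sup>2)"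
      by (simp add: norm_divide norm_mult norm_power)
    also have "\<dots> \<le> 1 / ((?a + real k) * (?a + real (Suc k))\<^sup>2)"
      using n [of k] n [of "Suc k"] assms by (intro divide_left_mono mult_mono power_mono mult_pos_pos) auto
    also have "\<dots> \<le> 1 / ((?a + real k) * ((?a + real (Suc k)) * ?a))"
      using assms by (intro divide_left_mono mult_left_mono mult_pos_pos) (auto simp: power2_eq_square intro!: mult_left_mono)
    also have "\<dots> = (inverse (?a + real k) - inverse (?a + real (Suc k))) / ?a"
      using assms by (simp add: field_simps)
    finally show "norm (1 / ((x + of_nat k) * (x + of_nat (Suc k))\<^sup>2)) \<le> (inverse (?a + real k) - inverse (?a + real (Suc k))) / ?a" .
  qed
  then show ?thesis by (simp add: norm_minus_commute)
qed

lemma trigamma_less: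
  fixes x :: real
  assumes "x > 0"
  shows "Polygamma 1 (1 + x) < 1 / x"
proof -
  have "x + of_nat k \<noteq> 0" for k using assms by auto
  note s = trigamma_series [OF this]
  have "0 < (\<Sum>k. 1 / ((x + of_nat k) * (x + of_nat (Suc k))\<^sup>2))"
    using assms by (intro suminf_pos sums_summable [OF s]) (simp add: add_pos_nonneg)
  then show ?thesis using sums_unique [OF s] by simp
qed

text \<open>
  By Stirling's formula this is \<open>- x + O(log x)\<close>. The bounds below need only its second derivative.
\<close>

definition stirling_remainder :: "complex \<Rightarrow> complex" where
  "stirling_remainder x = ln_Gamma (1 + x) - x * Ln x"

lemma not_nonpos_if_Re_pos: "Re x > 0 \<Longrightarrow> x \<notin> \<real>\<^sub>\<le>\<^sub>0" "Re x > 0 \<Longrightarrow> x \<notin> \<int>\<^sub>\<le>\<^sub>0"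
  by (auto simp: complex_nonpos_Reals_iff elim!: nonpos_Ints_cases)

lemma stirling_remainder_deriv:
  assumes "Re x > 0"
  shows "(stirling_remainder has_field_derivative (Digamma (1 + x) - Ln x - 1)) (at x within A)"
    and "((\<lambda>x. Digamma (1 + x) - Ln x - 1) has_field_derivative (Polygamma 1 (1 + x) - 1 / x)) (at x within A)"
proof -
  have "1 + x \<notin> \<real>\<^sub>\<le>\<^sub>0" "1 + x \<notin> \<int>\<^sub>\<le>\<^sub>0" "x \<notin> \<real>\<^sub>\<le>\<^sub>0" "x \<noteq> 0"
    using not_nonpos_if_Re_pos [of x] not_nonpos_if_Re_pos [of "1 + x"] assms by auto
  then show "(stirling_remainder has_field_derivative (Digamma (1 + x) - Ln x - 1)) (at x within A)"
    "((\<lambda>x. Digamma (1 + x) - Ln x - 1) has_field_derivative (Polygamma 1 (1 + x) - 1 / x)) (at x within A)"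
    unfolding stirling_remainder_def [abs_def]
    by (auto intro!: derivative_eq_intros simp: inverse_eq_divide)
qed

text \<open>
  The Legendre-type expression \<open>N \<phi>'(N) - \<phi>(N)\<close> for \<open>\<phi> = stirling_remainder\<close>; it annihilates the linear part of \<open>\<phi>\<close>.
\<close>

definition legendre_stirling :: "real \<Rightarrow> complex" where
  "legendre_stirling N = of_real N * (Digamma (1 + of_real N) - Ln (of_real N) - 1) - stirling_remainder (of_real N)"

text \<open>
  The error between \<open>n\<close> times the limiting cumulant generating function and the exact one. A linear function
  in place of \<open>stirling_remainder\<close> would give 0.
\<close>

definition stirling_gap :: "real \<Rightarrow> complex \<Rightarrow> complex" where
  "stirling_gap N w = stirling_remainder (of_real N * (1 + w)) - (1 + w) * stirling_remainder (of_real N)"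

text \<open>
  Taylor expansion of \<open>stirling_remainder\<close> around \<open>N\<close> to first order: the second derivative is at most
  \<open>1 / (r N)\<^sup>2\<close> on the half-plane, which cancels the factor \<open>N\<^sup>2\<close> of the squared increment \<open>(N w)\<^sup>2\<close>. The remaining
  terms combine to \<open>w * legendre_stirling N\<close>.
\<close>

lemma stirling_gap_bound:
  assumes "N > 0" "0 < r" "r \<le> 1" "Re (1 + w) \<ge> r"
  shows "norm (stirling_gap N w) \<le> (norm w / r)\<^sup>2 + norm w * norm (legendre_stirling N)"
proof -
  let ?S = "{z. r * N \<le> Re z}"
  let ?z = "of_real N * (1 + w)"
  define f where "f i x = (if i = 0 then stirling_remainder x else if i = 1 then Digamma (1 + x) - Ln x - 1
     else Polygamma 1 (1 + x) - 1 / x)" for i :: nat and x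
  have pos: "Re x > 0" if "x \<in> ?S" for x using less_le_trans [OF mult_pos_pos [OF assms(2,1)]] that by blast
  have "cmod (f 0 ?z - (\<Sum>i\<le>1. f i (of_real N) * (?z - of_real N) ^ i / fact i))
      \<le> (1 / (r * N)\<^sup>2) * cmod (?z - of_real N) ^ Suc 1 / fact 1"
  proof (rule complex_Taylor [where S = ?S])
    show "convex ?S" by (rule convex_halfspace_Re_ge)
    show "of_real N \<in> ?S" using assms by simp
    show "?z \<in> ?S" using assms by simp
    fix x assume x: "x \<in> ?S"
    show "(f i has_field_derivative f (Suc i) x) (at x within ?S)" if "i \<le> 1" for i
    proof (cases i)
      case 0
      then show ?thesis using stirling_remainder_deriv(1) [OF pos [OF x]] by (simp add: f_def [abs_def])
    next
      case (Suc j)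
      then show ?thesis using stirling_remainder_deriv(2) [OF pos [OF x]] that by (simp add: f_def [abs_def])
    qed
    have "cmod (f (Suc 1) x) \<le> 1 / (Re x)\<^sup>2" using trigamma_bound [OF pos [OF x]] by (simp add: f_def)
    also have "\<dots> \<le> 1 / (r * N)\<^sup>2"
      using x assms pos [OF x] by (intro divide_left_mono power_mono) (auto intro!: mult_pos_pos)
    finally show "cmod (f (Suc 1) x) \<le> 1 / (r * N)\<^sup>2" .
  qed
  also have "(1 / (r * N)\<^sup>2) * cmod (?z - of_real N) ^ Suc 1 / fact 1 = (norm w / r)\<^sup>2"
    using assms by (simp add: algebra_simps norm_mult power2_eq_square)
  also have "f 0 ?z - (\<Sum>i\<le>1. f i (of_real N) * (?z - of_real N) ^ i / fact i) = stirling_gap N w - w * legendre_stirling N"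
    by (simp add: f_def stirling_gap_def legendre_stirling_def algebra_simps)
  finally have 1: "cmod (stirling_gap N w - w * legendre_stirling N) \<le> (norm w / r)\<^sup>2" .
  have "norm (stirling_gap N w) \<le> cmod (stirling_gap N w - w * legendre_stirling N) + norm (w * legendre_stirling N)"
    using norm_triangle_sub [of "stirling_gap N w" "w * legendre_stirling N"] by simp
  with 1 show ?thesis by (simp add: norm_mult)
qed

text \<open>
  The derivative is \<open>N\<close> times the second derivative of \<open>stirling_remainder\<close>, hence at most \<open>1 / N\<close> in modulus;
  integration gives logarithmic growth.
\<close>

lemma legendre_stirling_bound:
  assumes "0 < a" "a \<le> N"
  shows "norm (legendre_stirling N) \<le> norm (legendre_stirling a) + ln (N / a)"
proof (cases "a = N")
  case False
  then have "a < N" using assms by simp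
  define d where "d x = complex_of_real x * (Polygamma 1 (1 + of_real x) - 1 / of_real x)" for x
  have der: "(legendre_stirling has_vector_derivative d x) (at x)" if "x > 0" for x
  proof -
    have "((\<lambda>z. z * (Digamma (1 + z) - Ln z - 1) - stirling_remainder z) has_field_derivative d x) (at (of_real x))"
    proof -
      have p: "Re (of_real x) > 0" using that by simp
      from DERIV_diff [OF DERIV_mult [OF DERIV_ident stirling_remainder_deriv(2) [OF p]] stirling_remainder_deriv(1) [OF p]]
      show ?thesis by (rule DERIV_cong) (simp add: d_def algebra_simps)
    qed
    from has_vector_derivative_real_field [OF this] show ?thesis
      unfolding legendre_stirling_def [abs_def] by simp
  qed
  have dl: "(ln has_vector_derivative 1 / x) (at x)" if "x > 0" for x :: real
    using that by (auto intro!: derivative_eq_intros simp: has_real_derivative_iff_has_vector_derivative [symmetric])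
  have "norm (legendre_stirling N - legendre_stirling a) \<le> ln N - ln a"
  proof (rule differentiable_bound_general [OF \<open>a < N\<close>])
    show "continuous_on {a..N} legendre_stirling"
      using der assms by (intro continuous_at_imp_continuous_on ballI has_vector_derivative_continuous [OF der]) auto
    show "continuous_on {a..N} ln" using assms by (intro continuous_on_ln continuous_on_id) auto
    show "(legendre_stirling has_vector_derivative d x) (at x)" if "a < x" "x < N" for x
      using that assms by (intro der) auto
    show "(ln has_vector_derivative 1 / x) (at x)" if "a < x" "x < N" for x
      using that assms by (intro dl) auto
    show "norm (d x) \<le> 1 / x" if "a < x" "x < N" for x
    proof -
      have "norm (d x) = x * norm (Polygamma 1 (1 + complex_of_real x) - 1 / of_real x)"
        using that assms by (simp add: d_def norm_mult)
      also have "\<dots> \<le> x * (1 / x\<^sup>2)"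
        using trigamma_bound [of "of_real x"] that assms by (intro mult_left_mono) auto
      finally show ?thesis using that assms by (simp add: power2_eq_square)
    qed
  qed
  moreover have "norm (legendre_stirling N) \<le> norm (legendre_stirling a) + norm (legendre_stirling N - legendre_stirling a)"
    by (rule norm_triangle_sub)
  ultimately show ?thesis using assms by (simp add: ln_div)
qed (use assms in auto)

section \<open>The limiting cumulant generating function\<close>

definition circ_Lambda :: "real \<Rightarrow> complex \<Rightarrow> complex" where
  "circ_Lambda \<beta> w = - w * of_real (ln (2 * pi)) - ln_Gamma (1 + of_real (\<beta> / 2) * (1 + w))
     + (1 + w) * of_real (ell (1 + \<beta> / 2)) + of_real (\<beta> / 2) * (1 + w) * Ln (1 + w)"

text \<open>
  An exact identity: all terms \<open>x log x\<close> of the logarithms of the Gamma functions that involve \<open>n\<close> cancel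
  except for \<open>N (1 + w) log (1 + w)\<close>, which is part of the limiting cumulant generating function.
\<close>

lemma power_normalisation_eq_exp:
  assumes \<beta>: "\<beta> > 0" and n: "n \<ge> 1" and w: "Re w > -1"
  shows "exp (- ((1 + w) * of_real (ln (circ_Z n \<beta>)))) *
      ((2 * of_real pi) ^ n * (Gamma (1 + of_nat n * ((1 + w) * of_real (\<beta> / 2))) / Gamma (1 + (1 + w) * of_real (\<beta> / 2)) ^ n))
    = exp (of_nat n * circ_Lambda \<beta> w + stirling_gap (real n * (\<beta> / 2)) w)"
proof -
  define b where "b = \<beta> / 2"
  define N where "N = real n * b"
  have b: "b > 0" using \<beta> by (simp add: b_def)
  have N: "N > 0" using b n by (simp add: N_def)
  have Gam: "Gamma z = exp (ln_Gamma z)" if "Re z > 0" for z :: complex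
    using not_nonpos_if_Re_pos(2) [OF that] by (simp add: Gamma_complex_altdef)
  have lnZ: "ln (circ_Z n \<beta>) = real n * ln (2 * pi) + ell (1 + N) - real n * ell (1 + b)"
  proof -
    have "Gamma (1 + N) > 0" "Gamma (1 + b) > 0" using N b by auto
    then show ?thesis
      unfolding circ_Z_def by (simp add: ln_mult ln_div ln_realpow ell_def N_def b_def distrib_left)
  qed
  have e1: "(2 * of_real pi) ^ n = exp (of_nat n * complex_of_real (ln (2 * pi)))"
  proof -
    have "exp (complex_of_real (ln (2 * pi))) = 2 * of_real pi" by (simp add: exp_of_real)
    then show ?thesis by (simp only: exp_of_nat_mult)
  qed
  have s: "Re ((1 + w) * of_real b) > 0" using w b by simp
  then have e2: "Gamma (1 + (1 + w) * of_real b) ^ n = exp (of_nat n * ln_Gamma (1 + (1 + w) * of_real b))"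
    by (subst Gam) (simp_all add: exp_of_nat_mult)
  have "Re (of_nat n * ((1 + w) * of_real b)) \<ge> 0" using s by simp
  then have e3: "Gamma (1 + of_nat n * ((1 + w) * of_real b)) = exp (ln_Gamma (1 + of_nat n * ((1 + w) * of_real b)))"
    by (intro Gam) simp
  have "1 + w \<noteq> 0" using w by (auto simp: complex_eq_iff)
  then have L: "Ln (of_real N * (1 + w)) = of_real (ln N) + Ln (1 + w)" using N Ln_times_of_real [of N "1 + w"] by (simp add: Ln_of_real)
  have LN: "Ln (of_real N) = of_real (ln N)" using N by (simp add: Ln_of_real)
  have GN: "ln_Gamma (1 + of_real N) = complex_of_real (ell (1 + N))"
    using N ln_Gamma_complex_of_real [of "1 + N"] by (simp add: ell_def ln_Gamma_real_pos)
  have "- ((1 + w) * of_real (ln (circ_Z n \<beta>))) + (of_nat n * complex_of_real (ln (2 * pi)) +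
      (ln_Gamma (1 + of_nat n * ((1 + w) * of_real b)) - of_nat n * ln_Gamma (1 + (1 + w) * of_real b)))
    = of_nat n * circ_Lambda \<beta> w + stirling_gap N w"
    unfolding stirling_gap_def stirling_remainder_def circ_Lambda_def L LN GN lnZ b_def [symmetric]
    by (simp add: N_def algebra_simps)
  then show ?thesis
    unfolding b_def [symmetric] N_def [symmetric] e1 e2 e3 exp_diff [symmetric] exp_add [symmetric] by simp
qed

definition circ_Lambda_real :: "real \<Rightarrow> real \<Rightarrow> real" where
  "circ_Lambda_real \<beta> t = - t * ln (2 * pi) - ln_Gamma (1 + \<beta> / 2 * (1 + t))
     + (1 + t) * ell (1 + \<beta> / 2) + \<beta> / 2 * (1 + t) * ln (1 + t)"

definition circ_Lambda_deriv :: "real \<Rightarrow> real \<Rightarrow> real" where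
  "circ_Lambda_deriv \<beta> t = - ln (2 * pi) - \<beta> / 2 * Digamma (1 + \<beta> / 2 * (1 + t))
     + ell (1 + \<beta> / 2) + \<beta> / 2 * (ln (1 + t) + 1)"

lemma circ_Lambda_of_real:
  assumes "\<beta> > 0" "t > -1"
  shows "circ_Lambda \<beta> (of_real t) = of_real (circ_Lambda_real \<beta> t)"
proof -
  have "1 + \<beta> / 2 * (1 + t) > 0" using assms by (intro add_pos_nonneg) auto
  then have "ln_Gamma (1 + of_real (\<beta> / 2) * (1 + of_real t)) = complex_of_real (ln_Gamma (1 + \<beta> / 2 * (1 + t)))"
    using ln_Gamma_complex_of_real [of "1 + \<beta> / 2 * (1 + t)"] by simp
  moreover have "Ln (1 + of_real t) = of_real (ln (1 + t))"
    using Ln_of_real [of "1 + t"] assms by simp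
  ultimately show ?thesis unfolding circ_Lambda_def circ_Lambda_real_def by simp
qed

lemma Lambda_H_eq:
  assumes "\<beta> > 0" "t > -1"
  shows "Lambda_H \<beta> t = circ_Lambda_real \<beta> t + t / 2"
proof -
  have 1: "1 + (1 + t) * \<beta> / 2 > 0" using assms by (intro add_pos_nonneg) auto
  have 2: "ln ((1 + t) * \<beta> / 2) = ln (1 + t) + ln (\<beta> / 2)"
    using ln_mult [of "1 + t" "\<beta> / 2"] assms by simp
  have "ell (1 + (1 + t) * \<beta> / 2) = ln_Gamma (1 + (1 + t) * \<beta> / 2)"
    using 1 by (simp add: ell_def ln_Gamma_real_pos)
  also have "(1 + t) * \<beta> / 2 = \<beta> / 2 * (1 + t)" by simp
  finally show ?thesis using 2
    unfolding Lambda_H_def f0_def circ_Lambda_real_def by (simp add: field_simps)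
qed

lemma circ_Lambda_real_deriv:
  assumes "\<beta> > 0" "t > -1"
  shows "(circ_Lambda_real \<beta> has_real_derivative circ_Lambda_deriv \<beta> t) (at t)"
proof -
  define F where "F t = ln_Gamma (1 + \<beta> / 2 * (1 + t))" for t
  define G where "G t = (1 + t) * ln (1 + t)" for t :: real
  have "1 + \<beta> / 2 * (1 + t) > 0" using assms by (intro add_pos_nonneg) auto
  then have F: "(F has_real_derivative \<beta> / 2 * Digamma (1 + \<beta> / 2 * (1 + t))) (at t)"
    unfolding F_def by (auto intro!: derivative_eq_intros)
  have G: "(G has_real_derivative ln (1 + t) + 1) (at t)"
    unfolding G_def using assms by (auto intro!: derivative_eq_intros)
  have "circ_Lambda_real \<beta> = (\<lambda>t. - t * ln (2 * pi) - F t + (1 + t) * ell (1 + \<beta> / 2) + \<beta> / 2 * G t)"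
    by (simp add: fun_eq_iff circ_Lambda_real_def F_def G_def)
  then show ?thesis
    unfolding circ_Lambda_deriv_def by (auto intro!: derivative_eq_intros F G)
qed

text \<open>
  Strict convexity is the inequality \<open>\<Psi>'(1 + x) < 1 / x\<close> at \<open>x = (1 + t) \<beta> / 2\<close>. At \<open>t = 0\<close> the second derivative is the
  variance \<open>\<sigma>\<^sup>2\<close>.
\<close>

lemma circ_Lambda_deriv_deriv:
  assumes "\<beta> > 0" "t > -1"
  shows "(circ_Lambda_deriv \<beta> has_real_derivative (\<beta> / 2 / (1 + t) - (\<beta> / 2)\<^sup>2 * Polygamma 1 (1 + \<beta> / 2 * (1 + t)))) (at t)"
    and "\<beta> / 2 / (1 + t) - (\<beta> / 2)\<^sup>2 * Polygamma 1 (1 + \<beta> / 2 * (1 + t)) > 0"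
proof -
  have p: "1 + \<beta> / 2 * (1 + t) > 0" using assms by (intro add_pos_nonneg) auto
  then have "1 + \<beta> / 2 * (1 + t) \<notin> \<int>\<^sub>\<le>\<^sub>0" by (meson nonpos_Ints_nonpos not_le)
  then have "(Digamma has_field_derivative Polygamma 1 (1 + \<beta> / 2 * (1 + t))) (at (1 + \<beta> / 2 * (1 + t)))"
    using has_field_derivative_Polygamma [of "1 + \<beta> / 2 * (1 + t)" 0] by simp
  then have "((\<lambda>t. Digamma (1 + \<beta> / 2 * (1 + t))) has_field_derivative Polygamma 1 (1 + \<beta> / 2 * (1 + t)) * (\<beta> / 2)) (at t)"
    by (rule DERIV_chain2) (auto intro!: derivative_eq_intros)
  moreover define F where "F t = Digamma (1 + \<beta> / 2 * (1 + t))" for t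
  ultimately have F: "(F has_field_derivative Polygamma 1 (1 + \<beta> / 2 * (1 + t)) * (\<beta> / 2)) (at t)"
    by (simp add: F_def [abs_def])
  define G where "G t = ln (1 + t)" for t :: real
  have G: "(G has_field_derivative 1 / (1 + t)) (at t)"
    unfolding G_def using assms by (auto intro!: derivative_eq_intros)
  have "circ_Lambda_deriv \<beta> = (\<lambda>t. - ln (2 * pi) - \<beta> / 2 * F t + ell (1 + \<beta> / 2) + \<beta> / 2 * (G t + 1))"
    by (simp add: fun_eq_iff circ_Lambda_deriv_def F_def G_def)
  then show "(circ_Lambda_deriv \<beta> has_real_derivative (\<beta> / 2 / (1 + t) - (\<beta> / 2)\<^sup>2 * Polygamma 1 (1 + \<beta> / 2 * (1 + t)))) (at t)"
    using assms by (auto intro!: derivative_eq_intros F G simp: power2_eq_square field_simps)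
  have "Polygamma 1 (1 + \<beta> / 2 * (1 + t)) < 1 / (\<beta> / 2 * (1 + t))" using assms by (intro trigamma_less) auto
  then have "(\<beta> / 2)\<^sup>2 * Polygamma 1 (1 + \<beta> / 2 * (1 + t)) < (\<beta> / 2)\<^sup>2 * (1 / (\<beta> / 2 * (1 + t)))"
    using assms by (intro mult_strict_left_mono) auto
  also have "\<dots> = \<beta> / 2 / (1 + t)" using assms by (simp add: power2_eq_square)
  finally show "\<beta> / 2 / (1 + t) - (\<beta> / 2)\<^sup>2 * Polygamma 1 (1 + \<beta> / 2 * (1 + t)) > 0" by simp
qed

lemma circ_Lambda_deriv_mono:
  assumes "\<beta> > 0" "-1 < s" "s \<le> t"
  shows "circ_Lambda_deriv \<beta> s \<le> circ_Lambda_deriv \<beta> t"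
  using assms circ_Lambda_deriv_deriv [OF assms(1)]
  by (intro DERIV_nonneg_imp_nondecreasing [OF assms(3)]) (metis less_eq_real_def less_le_trans)

lemma circ_Lambda_deriv_cont: "\<beta> > 0 \<Longrightarrow> continuous_on {-1<..} (circ_Lambda_deriv \<beta>)"
  using circ_Lambda_deriv_deriv(1) by (intro continuous_at_imp_continuous_on ballI) (auto intro: DERIV_isCont)

text \<open>
  The logarithm drives the derivative to \<open>-\<infinity>\<close> at \<open>-1\<close>, while the digamma term stays bounded there.
\<close>

lemma circ_Lambda_deriv_steep:
  assumes "\<beta> > 0"
  shows "\<exists>t>-1. circ_Lambda_deriv \<beta> t < K"
proof -
  define C where "C = - ln (2 * pi) - \<beta> / 2 * Digamma 1 + ell (1 + \<beta> / 2) + \<beta> / 2"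
  define y where "y = (K - C) / (\<beta> / 2) - 1"
  define t where "t = exp y - 1"
  have "Digamma 1 \<le> Digamma (1 + \<beta> / 2 * (1 + t))"
    using assms by (intro Digamma_real_mono) (auto simp: t_def)
  then have "\<beta> / 2 * Digamma 1 \<le> \<beta> / 2 * Digamma (1 + \<beta> / 2 * (1 + t))" using assms by (intro mult_left_mono) auto
  then have "circ_Lambda_deriv \<beta> t \<le> C + \<beta> / 2 * y"
    unfolding circ_Lambda_deriv_def C_def distrib_left by (simp add: t_def)
  also have "\<dots> < K" using assms by (simp add: y_def field_simps)
  finally show ?thesis by (intro exI [of _ t]) (simp add: t_def)
qed

lemma higher_deriv_ell:
  assumes "x > 0"
  shows "(deriv ^^ Suc j) ell x = Polygamma j x"
proof -
  have "eventually (\<lambda>y. ell y = ln_Gamma y) (nhds x)"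
    using eventually_nhds_in_open [of "{0<..}" x] assms
    by (auto elim!: eventually_mono simp: ell_def ln_Gamma_real_pos)
  then have "(deriv ^^ Suc j) ell x = (deriv ^^ Suc j) ln_Gamma x"
    by (rule higher_deriv_cong_ev) simp
  then show ?thesis using higher_deriv_ln_Gamma_real [OF assms, of "Suc j"] by simp
qed

lemma sigma2_pos: "\<beta> > 0 \<Longrightarrow> sigma2 \<beta> > 0"
  using circ_Lambda_deriv_deriv(2) [of \<beta> 0] higher_deriv_ell [of "1 + \<beta> / 2" 1]
  by (simp add: sigma2_def numeral_2_eq_2)

text \<open>
  The value and, by the choice of \<open>E_C \<beta>\<close>, the first derivative at 0 vanish. The second and third derivatives are
  \<open>\<sigma>\<^sup>2\<close> and \<open>- A\<close>.
\<close>

lemma circ_Lambda_taylor: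
  assumes "\<beta> > 0"
  obtains C where "C \<ge> 0" "\<And>w. norm w \<le> 1 / 2 \<Longrightarrow>
    norm (circ_Lambda \<beta> w + of_real (E_C \<beta>) * w - (of_real (sigma2 \<beta>) * w\<^sup>2 / 2 - of_real (A_const \<beta>) * w ^ 3 / 6)) \<le> C * norm w ^ 4"
proof -
  define b where "b = \<beta> / 2"
  have b: "b > 0" using assms by (simp add: b_def)
  define I where "I w = inverse (1 + w)" for w :: complex
  define P where "P j w = Polygamma j (1 + of_real b * (1 + w))" for j and w :: complex
  define f :: "nat \<Rightarrow> complex \<Rightarrow> complex" where "f i = [
      (\<lambda>w. circ_Lambda \<beta> w + of_real (E_C \<beta>) * w),
      (\<lambda>w. of_real (E_C \<beta> - ln (2 * pi) + ell (1 + b)) - of_real b * P 0 w + of_real b * (Ln (1 + w) + 1)),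
      (\<lambda>w. of_real b * I w - of_real b ^ 2 * P 1 w),
      (\<lambda>w. - of_real b * I w ^ 2 - of_real b ^ 3 * P 2 w),
      (\<lambda>w. 2 * of_real b * I w ^ 3 - of_real b ^ 4 * P 3 w)] ! i" for i
  let ?S = "cball (0 :: complex) (1 / 2)"
  have Re: "Re (1 + w) > 0" "Re (1 + of_real b * (1 + w)) > 0" if "w \<in> ?S" for w
  proof -
    have "Re w \<ge> - (1 / 2)" using that abs_Re_le_cmod [of w] by (auto simp: dist_norm)
    then show 1: "Re (1 + w) > 0" by simp
    then have "b * Re (1 + w) > 0" using b by (rule mult_pos_pos [rotated])
    then show "Re (1 + of_real b * (1 + w)) > 0" by simp
  qed
  have notin: "1 + w \<noteq> 0" "1 + w \<notin> \<real>\<^sub>\<le>\<^sub>0" "1 + of_real b * (1 + w) \<notin> \<real>\<^sub>\<le>\<^sub>0" "1 + of_real b * (1 + w) \<notin> \<int>\<^sub>\<le>\<^sub>0" if "w \<in> ?S" for w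
    using not_nonpos_if_Re_pos [OF Re(1) [OF that]] not_nonpos_if_Re_pos [OF Re(2) [OF that]] by auto
  have P': "(P j has_field_derivative of_real b * P (Suc j) w) (at w within A)" if "w \<in> ?S" for w j A
    unfolding P_def using notin [OF that] by (auto intro!: derivative_eq_intros)
  have P: "(P 0 has_field_derivative of_real b * P 1 w) (at w within A)"
    "(P 1 has_field_derivative of_real b * P 2 w) (at w within A)"
    "(P 2 has_field_derivative of_real b * P 3 w) (at w within A)" if "w \<in> ?S" for w A
    using P' [OF that, of 0] P' [OF that, of 1] P' [OF that, of 2] by (simp_all add: numeral_2_eq_2 numeral_3_eq_3)
  have I: "(I has_field_derivative - (I w)\<^sup>2) (at w within A)" if "w \<in> ?S" for w A
    unfolding I_def using notin(1) [OF that] by (auto intro!: derivative_eq_intros simp: power2_eq_square)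
  have der: "(f i has_field_derivative f (Suc i) w) (at w within ?S)" if w: "w \<in> ?S" and i: "i \<le> 3" for i w
  proof -
    consider "i = 0" | "i = 1" | "i = 2" | "i = 3" using i by linarith
    then show ?thesis
    proof cases
      case 1
      define F where "F w = ln_Gamma (1 + of_real b * (1 + w))" for w :: complex
      define G where "G w = (1 + w) * Ln (1 + w)" for w :: complex
      have F: "(F has_field_derivative of_real b * Digamma (1 + of_real b * (1 + w))) (at w within ?S)"
        unfolding F_def using notin [OF w] by (auto intro!: derivative_eq_intros)
      have G: "(G has_field_derivative Ln (1 + w) + 1) (at w within ?S)"
        unfolding G_def using notin [OF w] by (auto intro!: derivative_eq_intros)
      have "f 0 = (\<lambda>w. - w * of_real (ln (2 * pi)) - F w + (1 + w) * of_real (ell (1 + b)) + of_real b * G w + of_real (E_C \<beta>) * w)"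
        by (simp add: fun_eq_iff f_def circ_Lambda_def F_def G_def b_def)
      moreover have "((\<lambda>w. - w * of_real (ln (2 * pi)) - F w + (1 + w) * of_real (ell (1 + b)) + of_real b * G w + of_real (E_C \<beta>) * w)
          has_field_derivative f 1 w) (at w within ?S)"
        by (auto intro!: derivative_eq_intros F G simp: f_def P_def algebra_simps)
      ultimately show ?thesis unfolding 1 by simp
    next
      case 2
      show ?thesis unfolding 2 f_def using notin [OF w]
        by (auto intro!: derivative_eq_intros P [OF w, simplified] simp: I_def inverse_eq_divide power2_eq_square algebra_simps)
    next
      case 3
      show ?thesis unfolding 3 f_def
        by (auto intro!: derivative_eq_intros P [OF w, simplified] I [OF w] simp: power2_eq_square power3_eq_cube algebra_simps)
    next
      case 4
      show ?thesis unfolding 4 f_def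
        by (auto intro!: derivative_eq_intros P [OF w, simplified] I [OF w] simp: power2_eq_square power3_eq_cube power4_eq_xxxx algebra_simps)
    qed
  qed
  have "continuous_on ?S (P 3)" by (rule DERIV_continuous_on [OF P'])
  moreover have "continuous_on ?S I" by (rule DERIV_continuous_on [OF I])
  ultimately have "continuous_on ?S (f 4)"
    unfolding f_def by (auto intro!: continuous_intros)
  then have "compact (f 4 ` ?S)" by (intro compact_continuous_image compact_cball)
  then have "bounded (f 4 ` ?S)" by (rule compact_imp_bounded)
  then obtain C where "\<forall>x \<in> f 4 ` ?S. norm x \<le> C" unfolding bounded_iff by blast
  then have C: "\<And>w. w \<in> ?S \<Longrightarrow> norm (f 4 w) \<le> C" by blast
  have C0: "C \<ge> 0" by (rule order_trans [OF norm_ge_zero C [of 0]]) simp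
  have val: "f 0 0 = 0" "f 1 0 = 0" "f 2 0 = of_real (sigma2 \<beta>)" "f 3 0 = - of_real (A_const \<beta>)"
  proof -
    have b1: "1 + b > 0" using b by simp
    have Pr: "Polygamma i (1 + complex_of_real b) = of_real (Polygamma i (1 + b))" for i
      using Polygamma_of_real [of "1 + b" i, where 'a = complex] b1 by simp
    have "ln_Gamma (1 + complex_of_real b) = of_real (ell (1 + b))"
      using b1 ln_Gamma_complex_of_real [of "1 + b"] by (simp add: ell_def ln_Gamma_real_pos)
    then show "f 0 0 = 0" by (simp add: f_def circ_Lambda_def b_def)
    have "E_C \<beta> = ln (2 * pi) - b + b * Digamma (1 + b) - ell (1 + b)"
      by (simp add: E_C_def E_H_def b_def)
    then show "f 1 0 = 0" by (simp add: f_def P_def Pr)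
    have "sigma2 \<beta> = b - b\<^sup>2 * Polygamma 1 (1 + b)"
      using higher_deriv_ell [OF b1, of 1] by (simp add: sigma2_def b_def numeral_2_eq_2)
    then show "f 2 0 = of_real (sigma2 \<beta>)" by (simp add: f_def I_def P_def Pr)
    have "A_const \<beta> = b ^ 3 * Polygamma 2 (1 + b) + b"
      unfolding A_const_def b_def [symmetric] numeral_3_eq_3 numeral_2_eq_2 higher_deriv_ell [OF b1] ..
    then show "f 3 0 = - of_real (A_const \<beta>)" by (simp add: f_def I_def P_def Pr)
  qed
  show thesis
  proof (rule that [OF C0])
    fix w :: complex assume "norm w \<le> 1 / 2"
    then have w: "w \<in> ?S" by simp
    have "cmod (f 0 w - (\<Sum>i\<le>3. f i 0 * (w - 0) ^ i / fact i)) \<le> C * cmod (w - 0) ^ Suc 3 / fact 3"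
      using der C w by (intro complex_Taylor [where S = ?S]) auto
    also have "\<dots> \<le> C * norm w ^ 4"
      using C0 by (simp add: fact_numeral field_simps mult_left_mono)
    also have "f 0 w - (\<Sum>i\<le>3. f i 0 * (w - 0) ^ i / fact i) = f 0 w - (f 0 0 + f 1 0 * w + f 2 0 * w\<^sup>2 / 2 + f 3 0 * w ^ 3 / 6)"
      by (simp add: numeral_eq_Suc)
    also have "\<dots> = circ_Lambda \<beta> w + of_real (E_C \<beta>) * w - (of_real (sigma2 \<beta>) * w\<^sup>2 / 2 - of_real (A_const \<beta>) * w ^ 3 / 6)"
      unfolding val by (simp add: f_def)
    finally show "norm (circ_Lambda \<beta> w + of_real (E_C \<beta>) * w - (of_real (sigma2 \<beta>) * w\<^sup>2 / 2 - of_real (A_const \<beta>) * w ^ 3 / 6)) \<le> C * norm w ^ 4" .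
  qed
qed

section \<open>Large deviations from a steep limiting cumulant generating function\<close>

text \<open>
  The Legendre transform of a function on the half-line \<open>t > -1\<close>.
\<close>

definition legendre :: "(real \<Rightarrow> real) \<Rightarrow> real \<Rightarrow> ereal" where
  "legendre \<Lambda> x = (SUP t\<in>{-1<..}. ereal (t * x - \<Lambda> t))"

lemma legendre_ge: "t > -1 \<Longrightarrow> ereal (t * x - \<Lambda> t) \<le> legendre \<Lambda> x"
  unfolding legendre_def by (rule SUP_upper) simp

lemma lower_semicontinuous_legendre: "lower_semicontinuous (legendre \<Lambda>)"
  unfolding lower_semicontinuous_def le_Liminf_iff
proof (intro allI impI)
  fix x y assume "y < legendre \<Lambda> x"
  then obtain t where t: "t > -1" "y < ereal (t * x - \<Lambda> t)"
    by (auto simp: legendre_def less_SUP_iff)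
  have "((\<lambda>x'. ereal (t * x' - \<Lambda> t)) \<longlongrightarrow> ereal (t * x - \<Lambda> t)) (at x)"
    by (intro tendsto_intros)
  from order_tendstoD(1) [OF this t(2)] show "\<forall>\<^sub>F x' in at x. y < legendre \<Lambda> x'"
    by eventually_elim (rule less_le_trans [OF _ legendre_ge [OF t(1)]])
qed

lemma good_rate_function_legendre: "good_rate_function (legendre \<Lambda>)"
  unfolding good_rate_function_def
proof
  fix a :: real
  have eq: "{x. legendre \<Lambda> x \<le> ereal a} = (\<Inter>t\<in>{-1<..}. {x. t * x - \<Lambda> t \<le> a})"
    by (auto simp: legendre_def SUP_le_iff)
  have "closed {x. legendre \<Lambda> x \<le> ereal a}"
    unfolding eq by (intro closed_INT ballI closed_Collect_le continuous_intros)
  moreover have "{x. legendre \<Lambda> x \<le> ereal a} \<subseteq> {- 2 * (a + \<Lambda> (- 1 / 2))..2 * (a + \<Lambda> (1 / 2))}"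
  proof
    fix x assume "x \<in> {x. legendre \<Lambda> x \<le> ereal a}"
    then have le: "t * x - \<Lambda> t \<le> a" if "t > -1" for t using that unfolding eq by auto
    from le [of "1 / 2"] le [of "- 1 / 2"] show "x \<in> {- 2 * (a + \<Lambda> (- 1 / 2))..2 * (a + \<Lambda> (1 / 2))}" by auto
  qed
  ultimately show "compact {x. legendre \<Lambda> x \<le> ereal a}"
    by (metis bounded_closed_interval bounded_subset compact_eq_bounded_closed)
qed

lemma log_prob_le: "0 \<le> p \<Longrightarrow> p \<le> q \<Longrightarrow> 0 < q \<Longrightarrow> log_prob p \<le> ereal (ln q)"
  by (auto simp: log_prob_def)

lemma log_prob_ge: "0 < q \<Longrightarrow> q \<le> p \<Longrightarrow> ereal (ln q) \<le> log_prob p"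
  by (auto simp: log_prob_def)

text \<open>
  The setting of the Gaertner-Ellis theorem when cumulant generating functions are controlled on \<open>t > -1\<close> only.
  Steepness is required at the left end; at the right end \<open>\<Lambda>'\<close> may have a finite limit, so that the large
  deviation principle also has to be verified for values that are not attained by \<open>\<Lambda>'\<close>.
\<close>

locale gaertner_ellis =
  fixes M :: "nat \<Rightarrow> 'a measure" and X :: "nat \<Rightarrow> 'a \<Rightarrow> real" and \<Lambda> \<Lambda>' :: "real \<Rightarrow> real"
  assumes rv: "real_random_variables M X"
    and mgf_integrable: "\<And>n t. n \<ge> 1 \<Longrightarrow> t > -1 \<Longrightarrow> integrable (M n) (\<lambda>\<omega>. exp (t * (real n * X n \<omega>)))"
    and mgf_limit: "\<And>t. t > -1 \<Longrightarrow> (\<lambda>n. ln (\<integral>\<omega>. exp (t * (real n * X n \<omega>)) \<partial>M n) / real n) \<longlonglongrightarrow> \<Lambda> t"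
    and deriv: "\<And>t. t > -1 \<Longrightarrow> (\<Lambda> has_real_derivative \<Lambda>' t) (at t)"
    and cont: "continuous_on {-1<..} \<Lambda>'"
    and mono: "\<And>s t. -1 < s \<Longrightarrow> s \<le> t \<Longrightarrow> \<Lambda>' s \<le> \<Lambda>' t"
    and steep: "\<And>K. \<exists>t>-1. \<Lambda>' t < K"
begin

definition mgf :: "nat \<Rightarrow> real \<Rightarrow> real" where
  "mgf n t = (\<integral>\<omega>. exp (t * (real n * X n \<omega>)) \<partial>M n)"

definition P :: "nat \<Rightarrow> real set \<Rightarrow> real" where
  "P n A = measure (M n) {\<omega> \<in> space (M n). X n \<omega> \<in> A}"

lemma prob: "n \<ge> 1 \<Longrightarrow> prob_space (M n)" and meas: "n \<ge> 1 \<Longrightarrow> X n \<in> borel_measurable (M n)"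
  using rv by (auto simp: real_random_variables_def)

lemma event: "n \<ge> 1 \<Longrightarrow> A \<in> sets borel \<Longrightarrow> {\<omega> \<in> space (M n). X n \<omega> \<in> A} \<in> sets (M n)"
proof -
  assume n: "n \<ge> 1" and A: "A \<in> sets borel"
  have "{\<omega> \<in> space (M n). X n \<omega> \<in> A} = X n -` A \<inter> space (M n)" by auto
  also have "\<dots> \<in> sets (M n)" by (rule measurable_sets [OF meas [OF n] A])
  finally show ?thesis .
qed

lemma P_mono: "n \<ge> 1 \<Longrightarrow> A \<subseteq> B \<Longrightarrow> B \<in> sets borel \<Longrightarrow> P n A \<le> P n B"
proof -
  assume n: "n \<ge> 1" and AB: "A \<subseteq> B" "B \<in> sets borel"
  interpret prob_space "M n" by (rule prob) fact
  show ?thesis unfolding P_def using AB by (intro finite_measure_mono event n) auto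
qed

lemma P_Un: "n \<ge> 1 \<Longrightarrow> A \<in> sets borel \<Longrightarrow> B \<in> sets borel \<Longrightarrow> P n (A \<union> B) \<le> P n A + P n B"
proof -
  assume n: "n \<ge> 1" and AB: "A \<in> sets borel" "B \<in> sets borel"
  interpret prob_space "M n" by (rule prob) fact
  have "{\<omega> \<in> space (M n). X n \<omega> \<in> A \<union> B} = {\<omega> \<in> space (M n). X n \<omega> \<in> A} \<union> {\<omega> \<in> space (M n). X n \<omega> \<in> B}" by auto
  then show ?thesis unfolding P_def using event [OF n AB(1)] event [OF n AB(2)]
    by (simp add: measure_Un_le)
qed

lemma P_nonneg: "P n A \<ge> 0" by (simp add: P_def)

lemma mgf_pos: "n \<ge> 1 \<Longrightarrow> t > -1 \<Longrightarrow> mgf n t > 0"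
proof -
  assume n: "n \<ge> 1" and t: "t > -1"
  interpret prob_space "M n" by (rule prob) fact
  have "mgf n t \<noteq> 0"
    unfolding mgf_def using integral_nonneg_eq_0_iff_AE [OF mgf_integrable [OF n t]] by simp
  moreover have "mgf n t \<ge> 0" unfolding mgf_def by (intro Bochner_Integration.integral_nonneg) auto
  ultimately show ?thesis by simp
qed

lemma mgf_eq: "n \<ge> 1 \<Longrightarrow> t > -1 \<Longrightarrow> mgf n t = exp (real n * (ln (mgf n t) / real n))"
  using mgf_pos by simp

lemma mgf_le_eventually:
  assumes "t > -1" "\<Lambda> t < c"
  shows "eventually (\<lambda>n. mgf n t \<le> exp (real n * c)) sequentially"
  using order_tendstoD(2) [OF mgf_limit [OF assms(1), folded mgf_def] assms(2)] eventually_ge_at_top [of 1]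
proof eventually_elim
  case (elim n)
  then have "real n * (ln (mgf n t) / real n) \<le> real n * c" by (intro mult_left_mono) auto
  then show ?case using mgf_eq [OF elim(2) assms(1)] by (metis exp_le_cancel_iff)
qed

lemma mgf_ge_eventually:
  assumes "t > -1" "c < \<Lambda> t"
  shows "eventually (\<lambda>n. exp (real n * c) \<le> mgf n t) sequentially"
  using order_tendstoD(1) [OF mgf_limit [OF assms(1), folded mgf_def] assms(2)] eventually_ge_at_top [of 1]
proof eventually_elim
  case (elim n)
  then have "real n * c \<le> real n * (ln (mgf n t) / real n)" by (intro mult_left_mono) auto
  then show ?case using mgf_eq [OF elim(2) assms(1)] by (metis exp_le_cancel_iff)
qed

lemma Lambda_0: "\<Lambda> 0 = 0"
proof -
  have "(\<lambda>n. ln (mgf n 0) / real n) \<longlonglongrightarrow> \<Lambda> 0" using mgf_limit [of 0] by (simp add: mgf_def)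
  moreover have "(\<lambda>n. ln (mgf n 0) / real n) \<longlonglongrightarrow> 0"
  proof (rule tendsto_eventually)
    show "eventually (\<lambda>n. ln (mgf n 0) / real n = 0) sequentially"
    using eventually_ge_at_top [of 1]
  proof eventually_elim
    case (elim n)
    then show ?case using prob_space.prob_space [OF prob [OF elim]] by (simp add: mgf_def)
  qed
  qed
  ultimately show ?thesis by (rule LIMSEQ_unique)
qed

text \<open>
  Convexity at 0. Consequently only \<open>t \<ge> 0\<close> matters in the Legendre transform to the right of the mean
  \<open>\<Lambda>' 0\<close>, and only \<open>t \<le> 0\<close> to the left of it.
\<close>

lemma Lambda_ge_tangent: "t > -1 \<Longrightarrow> t * \<Lambda>' 0 \<le> \<Lambda> t"
proof -
  assume t: "t > -1"
  consider "t = 0" | "t > 0" | "t < 0" by linarith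
  then show ?thesis
  proof cases
    case 2
    obtain z where z: "0 < z" "z < t" "\<Lambda> t - \<Lambda> 0 = (t - 0) * \<Lambda>' z"
      using MVT2 [of 0 t \<Lambda> \<Lambda>'] 2 deriv by auto
    then show ?thesis using mono [of 0 z] 2 by (simp add: Lambda_0)
  next
    case 3
    obtain z where z: "t < z" "z < 0" "\<Lambda> 0 - \<Lambda> t = (0 - t) * \<Lambda>' z"
      using MVT2 [of t 0 \<Lambda> \<Lambda>'] 3 t deriv by auto
    then show ?thesis using mono [of z 0] 3 t mult_left_mono_neg [of "\<Lambda>' z" "\<Lambda>' 0" t] by (simp add: Lambda_0)
  qed (simp add: Lambda_0)
qed

lemma legendre_nonneg: "0 \<le> legendre \<Lambda> x"
  using legendre_ge [of 0 x \<Lambda>] by (simp add: Lambda_0 zero_ereal_def)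

lemma chernoff:
  assumes n: "n \<ge> 1" and t: "t > -1" and A: "A \<in> sets borel" "\<And>x. x \<in> A \<Longrightarrow> t * y \<le> t * x"
  shows "P n A \<le> exp (- (real n * (t * y))) * mgf n t"
proof -
  interpret prob_space "M n" by (rule prob) fact
  note ev = event [OF n A(1)]
  have int: "integrable (M n) (indicat_real {\<omega> \<in> space (M n). X n \<omega> \<in> A})"
    using ev by (intro integrable_real_indicator) (simp_all add: emeasure_eq_measure)
  have "P n A = (\<integral>\<omega>. indicator {\<omega> \<in> space (M n). X n \<omega> \<in> A} \<omega> \<partial>M n)"
    unfolding P_def using ev by simp
  also have "\<dots> \<le> (\<integral>\<omega>. exp (- (real n * (t * y))) * exp (t * (real n * X n \<omega>)) \<partial>M n)"
  proof (rule integral_mono)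
    fix \<omega>
    show "indicator {\<omega> \<in> space (M n). X n \<omega> \<in> A} \<omega> \<le> exp (- (real n * (t * y))) * exp (t * (real n * X n \<omega>))"
    proof (cases "X n \<omega> \<in> A")
      case True
      have "0 \<le> real n * (t * X n \<omega> - t * y)" using A(2) [OF True] by simp
      then show ?thesis by (auto simp: indicator_def exp_add [symmetric] algebra_simps)
    qed (auto simp: indicator_def)
  qed (use int mgf_integrable [OF n t] in auto)
  also have "\<dots> = exp (- (real n * (t * y))) * mgf n t" by (simp add: mgf_def)
  finally show ?thesis .
qed

lemma chernoff_eventually:
  assumes t: "t > -1" "c < t * y - \<Lambda> t" and A: "A \<in> sets borel" "\<And>x. x \<in> A \<Longrightarrow> t * y \<le> t * x"
  shows "eventually (\<lambda>n. P n A \<le> exp (- (real n * c))) sequentially"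
proof -
  have "\<Lambda> t < t * y - c" using t by simp
  from mgf_le_eventually [OF t(1) this] eventually_ge_at_top [of 1] show ?thesis
  proof eventually_elim
    case (elim n)
    have "P n A \<le> exp (- (real n * (t * y))) * mgf n t" by (rule chernoff [OF elim(2) t(1) A])
    also have "\<dots> \<le> exp (- (real n * (t * y))) * exp (real n * (t * y - c))"
      by (intro mult_left_mono elim) auto
    also have "\<dots> = exp (- (real n * c))" by (simp add: exp_add [symmetric] algebra_simps)
    finally show ?case .
  qed
qed

text \<open>
  The closed set has a smallest point \<open>y\<close>, and the Chernoff bound at \<open>y\<close> with a parameter \<open>t \<ge> 0\<close> covers all of it.
\<close>

lemma upper_right:
  assumes "closed F" "F \<subseteq> {\<Lambda>' 0..}" "\<And>x. x \<in> F \<Longrightarrow> ereal c < legendre \<Lambda> x"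
  shows "eventually (\<lambda>n. P n F \<le> exp (- (real n * c))) sequentially"
proof (cases "F = {}")
  case False
  have bdd: "bdd_below F" using assms(2) by (meson bdd_below_Ici bdd_below_mono)
  define y where "y = Inf F"
  have y: "y \<in> F" unfolding y_def by (rule closed_contains_Inf) fact+
  have ym: "\<Lambda>' 0 \<le> y" using y assms(2) by auto
  have yle: "y \<le> x" if "x \<in> F" for x unfolding y_def by (rule cInf_lower [OF that bdd])
  obtain t where t: "t > -1" "c < t * y - \<Lambda> t" using assms(3) [OF y] by (auto simp: legendre_def less_SUP_iff)
  have "\<exists>t\<ge>0. c < t * y - \<Lambda> t"
  proof (cases "t \<ge> 0")
    case False
    then have "t * y \<le> t * \<Lambda>' 0" using ym by (intro mult_left_mono_neg) auto
    with t Lambda_ge_tangent [OF t(1)] have "c < 0" by linarith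
    then show ?thesis by (intro exI [of _ 0]) (simp add: Lambda_0)
  qed (use t in auto)
  then obtain t where t: "t \<ge> 0" "c < t * y - \<Lambda> t" by auto
  show ?thesis
    using t yle by (intro chernoff_eventually [of t c y]) (auto intro: mult_left_mono borel_closed assms(1))
qed (simp add: P_def)

lemma upper_left:
  assumes "closed F" "F \<subseteq> {..\<Lambda>' 0}" "\<And>x. x \<in> F \<Longrightarrow> ereal c < legendre \<Lambda> x"
  shows "eventually (\<lambda>n. P n F \<le> exp (- (real n * c))) sequentially"
proof (cases "F = {}")
  case False
  have bdd: "bdd_above F" using assms(2) by (meson bdd_above_Iic bdd_above_mono)
  define y where "y = Sup F"
  have y: "y \<in> F" unfolding y_def by (rule closed_contains_Sup) fact+
  have ym: "y \<le> \<Lambda>' 0" using y assms(2) by auto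
  have yge: "x \<le> y" if "x \<in> F" for x unfolding y_def by (rule cSup_upper [OF that bdd])
  obtain t where t: "t > -1" "c < t * y - \<Lambda> t" using assms(3) [OF y] by (auto simp: legendre_def less_SUP_iff)
  have "\<exists>t\<le>0. t > -1 \<and> c < t * y - \<Lambda> t"
  proof (cases "t \<le> 0")
    case False
    then have "t * y \<le> t * \<Lambda>' 0" using ym by (intro mult_left_mono) auto
    with t Lambda_ge_tangent [OF t(1)] have "c < 0" by linarith
    then show ?thesis by (intro exI [of _ 0]) (simp add: Lambda_0)
  qed (use t in auto)
  then obtain t where t: "t \<le> 0" "t > -1" "c < t * y - \<Lambda> t" by auto
  show ?thesis
    using t yge by (intro chernoff_eventually [of t c y]) (auto intro: mult_left_mono_neg borel_closed assms(1))
qed (simp add: P_def)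

text \<open>
  A closed set is split at the mean, and each half is controlled by its point nearest to the mean.
\<close>

lemma upper_bound:
  assumes A: "A \<in> sets borel"
  shows "limsup (\<lambda>n. ereal (1 / real n) * log_prob (P n A)) \<le> - (INF x\<in>closure A. legendre \<Lambda> x)"
proof -
  have "(INF x\<in>closure A. legendre \<Lambda> x) \<le> - limsup (\<lambda>n. ereal (1 / real n) * log_prob (P n A))"
  proof (rule dense_le)
    fix y assume y: "y < (INF x\<in>closure A. legendre \<Lambda> x)"
    show "y \<le> - limsup (\<lambda>n. ereal (1 / real n) * log_prob (P n A))"
    proof (cases y)
      case (real c)
      have c: "ereal c < legendre \<Lambda> x" if "x \<in> closure A" for x
        using y that real by (auto dest: less_INF_D)
      let ?R = "closure A \<inter> {\<Lambda>' 0..}" and ?L = "closure A \<inter> {..\<Lambda>' 0}"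
      have "eventually (\<lambda>n. P n ?R \<le> exp (- (real n * c))) sequentially"
        using c by (intro upper_right closed_Int closed_closure closed_atLeast) auto
      moreover have "eventually (\<lambda>n. P n ?L \<le> exp (- (real n * c))) sequentially"
        using c by (intro upper_left closed_Int closed_closure closed_atMost) auto
      ultimately have "eventually (\<lambda>n. ereal (1 / real n) * log_prob (P n A) \<le> ereal (ln 2 / real n - c)) sequentially"
        using eventually_ge_at_top [of 1]
      proof eventually_elim
        case (elim n)
        have "P n A \<le> P n (?R \<union> ?L)"
          using closure_subset [of A] elim(3) by (intro P_mono) auto
        also have "\<dots> \<le> P n ?R + P n ?L" using elim(3) by (intro P_Un) auto
        also have "\<dots> \<le> 2 * exp (- (real n * c))" using elim by linarith
        finally have "log_prob (P n A) \<le> ereal (ln (2 * exp (- (real n * c))))"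
          by (intro log_prob_le P_nonneg) auto
        also have "ln (2 * exp (- (real n * c))) = ln 2 - real n * c" by (simp add: ln_mult)
        finally have "ereal (1 / real n) * log_prob (P n A) \<le> ereal (1 / real n) * ereal (ln 2 - real n * c)"
          by (intro ereal_mult_left_mono) auto
        also have "\<dots> = ereal (ln 2 / real n - c)" using elim(3) by (simp add: field_simps)
        finally show ?case .
      qed
      then have "limsup (\<lambda>n. ereal (1 / real n) * log_prob (P n A)) \<le> limsup (\<lambda>n. ereal (ln 2 / real n - c))"
        by (rule Limsup_mono)
      also have "\<dots> = ereal (- c)"
      proof (rule lim_imp_Limsup)
        have "(\<lambda>n. ln 2 / real n - c) \<longlonglongrightarrow> - c" by real_asymp
        then show "(\<lambda>n. ereal (ln 2 / real n - c)) \<longlonglongrightarrow> ereal (- c)" by (rule tendsto_ereal)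
      qed simp
      finally have "- ereal (- c) \<le> - limsup (\<lambda>n. ereal (1 / real n) * log_prob (P n A))"
        by (simp only: ereal_minus_le_minus)
      then show ?thesis by (simp add: real)
    qed (use y in auto)
  qed
  then have "- (- limsup (\<lambda>n. ereal (1 / real n) * log_prob (P n A))) \<le> - (INF x\<in>closure A. legendre \<Lambda> x)"
    by (simp only: ereal_minus_le_minus)
  then show ?thesis by simp
qed

text \<open>
  Exponential tilting. Under the measure with density proportional to \<open>exp (t n X)\<close> the variable concentrates at
  \<open>\<Lambda>' t\<close>: the tilted mass of the two outer half-lines is exponentially small by Chernoff bounds with parameters
  \<open>t + s\<close> and \<open>t - s\<close>. Hence \<open>G\<close> carries most of the tilted mass, and undoing the tilt near \<open>\<Lambda>' t\<close> costs
  \<open>exp (- n t \<Lambda>' t)\<close> up to a small exponential factor.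
\<close>

lemma lower_local:
  assumes t: "t > -1" and G: "open G" "\<Lambda>' t \<in> G" and e: "e > 0"
  shows "eventually (\<lambda>n. exp (real n * (\<Lambda> t - t * \<Lambda>' t - e)) / 2 \<le> P n G) sequentially"
proof -
  define x where "x = \<Lambda>' t"
  obtain d0 where d0: "d0 > 0" "ball x d0 \<subseteq> G" using G unfolding x_def by (meson openE)
  \<comment> \<open>So small that the tilt varies by at most \<open>e / 2\<close> on the interval.\<close>
  define d where "d = min d0 (e / (2 * (\<bar>t\<bar> + 1)))"
  have d: "d > 0" "\<bar>t\<bar> * d \<le> e / 2" "ball x d \<subseteq> G"
  proof -
    show "d > 0" using d0 e by (auto simp: d_def intro!: divide_pos_pos)
    have "\<bar>t\<bar> * d \<le> \<bar>t\<bar> * (e / (2 * (\<bar>t\<bar> + 1)))" by (intro mult_left_mono) (auto simp: d_def)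
    also have "\<dots> \<le> e / 2" using e by (simp add: field_simps)
    finally show "\<bar>t\<bar> * d \<le> e / 2" .
    show "ball x d \<subseteq> G" using d0 by (auto simp: d_def)
  qed
  have "((\<lambda>h. (\<Lambda> (t + h) - \<Lambda> t) / h) \<longlongrightarrow> x) (at 0)"
    using deriv [OF t] by (simp add: DERIV_def x_def)
  then have "eventually (\<lambda>h. dist ((\<Lambda> (t + h) - \<Lambda> t) / h) x < d / 2) (at 0)"
    using d by (intro tendstoD) auto
  then obtain r where r: "r > 0" "\<And>h. h \<noteq> 0 \<Longrightarrow> \<bar>h\<bar> < r \<Longrightarrow> \<bar>(\<Lambda> (t + h) - \<Lambda> t) / h - x\<bar> < d / 2"
    by (auto simp: eventually_at dist_real_def)
  define s where "s = min (r / 2) ((t + 1) / 2)"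
  have s: "s > 0" "s < r" "t - s > -1" "t + s > -1" using r t by (auto simp: s_def min_def field_simps)
  \<comment> \<open>The increments of \<open>\<Lambda>\<close> over the steps \<open>s\<close> and \<open>- s\<close> deviate from their linearisation by less than \<open>s * d / 2\<close>; this leaves an exponential gain of \<open>s * d / 2\<close> on the two outer half-lines.\<close>
  define \<eta> where "\<eta> = s * d / 2"
  have \<eta>: "\<eta> > 0" using s d by (simp add: \<eta>_def)
  have up: "\<Lambda> (t + s) - s * (x + d) < \<Lambda> t - \<eta>"
  proof -
    have "\<bar>(\<Lambda> (t + s) - \<Lambda> t) / s - x\<bar> < d / 2" using r(2) [of s] s by simp
    then have "(\<Lambda> (t + s) - \<Lambda> t) / s < x + d / 2" unfolding abs_less_iff by linarith
    then have "\<Lambda> (t + s) - \<Lambda> t < (x + d / 2) * s" using s by (simp add: pos_divide_less_eq)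
    then show ?thesis by (simp add: \<eta>_def algebra_simps)
  qed
  have down: "\<Lambda> (t - s) + s * (x - d) < \<Lambda> t - \<eta>"
  proof -
    have "\<bar>(\<Lambda> (t + - s) - \<Lambda> t) / (- s) - x\<bar> < d / 2" using r(2) [of "- s"] s by simp
    then have "(\<Lambda> (t + - s) - \<Lambda> t) / (- s) > x - d / 2" unfolding abs_less_iff by linarith
    then have "\<Lambda> t - \<Lambda> (t - s) > (x - d / 2) * s" using s by (simp add: field_simps)
    then show ?thesis by (simp add: \<eta>_def algebra_simps)
  qed
  define \<kappa> where "\<kappa> = min (\<eta> / 2) (e / 2)"
  have \<kappa>: "\<kappa> > 0" "\<kappa> \<le> \<eta> / 2" "\<kappa> \<le> e / 2" using \<eta> e by (auto simp: \<kappa>_def)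
  have "eventually (\<lambda>n. mgf n (t + s) \<le> exp (real n * (\<Lambda> t - \<eta> + s * (x + d)))) sequentially"
    using up s by (intro mgf_le_eventually) auto
  moreover have "eventually (\<lambda>n. mgf n (t - s) \<le> exp (real n * (\<Lambda> t - \<eta> - s * (x - d)))) sequentially"
    using down s by (intro mgf_le_eventually) auto
  moreover have "eventually (\<lambda>n. exp (real n * (\<Lambda> t - \<kappa>)) \<le> mgf n t) sequentially"
    using \<kappa> t by (intro mgf_ge_eventually) auto
  moreover have "eventually (\<lambda>n. exp (real n * (\<eta> / 2)) \<ge> 4) sequentially"
    using \<eta> by real_asymp
  moreover note eventually_ge_at_top [of 1]
  ultimately show ?thesis
  proof eventually_elim
    case (elim n)
    note n = elim(5)
    interpret prob_space "M n" by (rule prob) fact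
    have ballm: "ball x d \<in> sets borel" by simp
    note ev = event [OF n ballm]
    have int: "integrable (M n) (indicat_real {\<omega> \<in> space (M n). X n \<omega> \<in> ball x d})"
      using ev by (intro integrable_real_indicator) (simp_all add: emeasure_eq_measure del: mem_ball)
    define a1 where "a1 = exp (real n * (t * x + \<bar>t\<bar> * d))"
    define a2 where "a2 = exp (- (real n * (s * (x + d))))"
    define a3 where "a3 = exp (real n * (s * (x - d)))"
    have "mgf n t \<le> (\<integral>\<omega>. a1 * indicator {\<omega> \<in> space (M n). X n \<omega> \<in> ball x d} \<omega> + a2 * exp ((t + s) * (real n * X n \<omega>))
        + a3 * exp ((t - s) * (real n * X n \<omega>)) \<partial>M n)"
      unfolding mgf_def
    proof (rule integral_mono)
      fix \<omega> assume \<omega>: "\<omega> \<in> space (M n)"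
      define y where "y = X n \<omega>"
      have nonneg: "a1 * indicator {\<omega> \<in> space (M n). X n \<omega> \<in> ball x d} \<omega> \<ge> 0" "a2 * exp ((t + s) * (real n * y)) \<ge> 0"
        "a3 * exp ((t - s) * (real n * y)) \<ge> 0" by (auto simp: a1_def a2_def a3_def)
      have "y \<in> ball x d \<or> y \<ge> x + d \<or> y \<le> x - d" unfolding mem_ball dist_real_def by linarith
      then consider "y \<in> ball x d" | "y \<ge> x + d" | "y \<le> x - d" by blast
      then have "exp (t * (real n * y)) \<le> a1 * indicator {\<omega> \<in> space (M n). X n \<omega> \<in> ball x d} \<omega> + a2 * exp ((t + s) * (real n * y))
        + a3 * exp ((t - s) * (real n * y))"
      proof cases
        case 1
        have "t * y \<le> t * x + \<bar>t\<bar> * d"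
        proof -
          have "t * (y - x) \<le> \<bar>t\<bar> * \<bar>y - x\<bar>" by (metis abs_ge_self abs_mult)
          also have "\<dots> \<le> \<bar>t\<bar> * d" using 1 by (intro mult_left_mono) (auto simp: dist_real_def)
          finally show ?thesis by (simp add: algebra_simps)
        qed
        then have "real n * (t * y) \<le> real n * (t * x + \<bar>t\<bar> * d)" by (intro mult_left_mono) auto
        then have "exp (t * (real n * y)) \<le> a1" by (simp add: a1_def algebra_simps)
        moreover have "indicator {\<omega> \<in> space (M n). X n \<omega> \<in> ball x d} \<omega> = (1 :: real)" using 1 \<omega> by (simp add: y_def)
        ultimately show ?thesis using nonneg by simp
      next
        case 2
        have "0 \<le> real n * (s * (y - (x + d)))" using 2 s by simp
        then have "exp (t * (real n * y)) \<le> a2 * exp ((t + s) * (real n * y))"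
          by (simp add: a2_def exp_add [symmetric] algebra_simps)
        then show ?thesis using nonneg by linarith
      next
        case 3
        have "0 \<le> real n * (s * ((x - d) - y))" using 3 s by simp
        then have "exp (t * (real n * y)) \<le> a3 * exp ((t - s) * (real n * y))"
          by (simp add: a3_def exp_add [symmetric] algebra_simps)
        then show ?thesis using nonneg by linarith
      qed
      then show "exp (t * (real n * X n \<omega>)) \<le> a1 * indicator {\<omega> \<in> space (M n). X n \<omega> \<in> ball x d} \<omega> + a2 * exp ((t + s) * (real n * X n \<omega>))
        + a3 * exp ((t - s) * (real n * X n \<omega>))" by (simp add: y_def)
    qed (intro Bochner_Integration.integrable_add integrable_mult_right int mgf_integrable n t s)+
    also have "\<dots> = a1 * P n (ball x d) + a2 * mgf n (t + s) + a3 * mgf n (t - s)"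
      using mgf_integrable [OF n s(3)] mgf_integrable [OF n s(4)] ev int by (simp add: mgf_def P_def del: mem_ball)
    also have "a2 * mgf n (t + s) \<le> a2 * exp (real n * (\<Lambda> t - \<eta> + s * (x + d)))"
      using elim by (intro mult_left_mono) (auto simp: a2_def)
    also have "a2 * exp (real n * (\<Lambda> t - \<eta> + s * (x + d))) = exp (real n * (\<Lambda> t - \<eta>))"
      by (simp add: a2_def exp_add [symmetric] algebra_simps)
    also have "a3 * mgf n (t - s) \<le> a3 * exp (real n * (\<Lambda> t - \<eta> - s * (x - d)))"
      using elim by (intro mult_left_mono) (auto simp: a3_def)
    also have "a3 * exp (real n * (\<Lambda> t - \<eta> - s * (x - d))) = exp (real n * (\<Lambda> t - \<eta>))"
      by (simp add: a3_def exp_add [symmetric] algebra_simps)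
    finally have 1: "mgf n t \<le> a1 * P n (ball x d) + 2 * exp (real n * (\<Lambda> t - \<eta>))" by simp
    have "4 * exp (real n * (\<Lambda> t - \<eta>)) \<le> exp (real n * (\<eta> / 2)) * exp (real n * (\<Lambda> t - \<eta>))"
      using elim by (intro mult_right_mono) auto
    also have "\<dots> = exp (real n * (\<Lambda> t - \<eta> / 2))" by (simp add: exp_add [symmetric] algebra_simps)
    also have "\<dots> \<le> exp (real n * (\<Lambda> t - \<kappa>))" using \<kappa> by (simp add: mult_left_mono)
    also have "\<dots> \<le> mgf n t" by (rule elim)
    finally have 2: "exp (real n * (\<Lambda> t - \<kappa>)) / 2 \<le> a1 * P n (ball x d)" using 1 elim(3) by linarith
    have "exp (real n * (\<Lambda> t - t * \<Lambda>' t - e)) / 2 \<le> exp (real n * (\<Lambda> t - \<kappa> - (t * x + \<bar>t\<bar> * d))) / 2"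
      using \<kappa> d by (simp add: x_def mult_left_mono)
    also have "\<dots> = (exp (real n * (\<Lambda> t - \<kappa>)) / 2) / a1"
      by (simp add: a1_def exp_diff [symmetric] algebra_simps)
    also have "\<dots> \<le> P n (ball x d)" using 2 by (simp add: a1_def pos_divide_le_eq mult.commute)
    also have "\<dots> \<le> P n G" using d(3) n G by (intro P_mono borel_open) auto
    finally show ?case .
  qed
qed

lemma lower_exposed:
  assumes t: "t > -1" and G: "open G" "\<Lambda>' t \<in> G" "G \<subseteq> A" and A: "A \<in> sets borel"
  shows "ereal (\<Lambda> t - t * \<Lambda>' t) \<le> liminf (\<lambda>n. ereal (1 / real n) * log_prob (P n A))"
proof (rule ereal_le_epsilon2)
  fix e :: real assume e: "0 < e"
  from lower_local [OF t G(1,2) e] eventually_ge_at_top [of 1]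
  have "eventually (\<lambda>n. ereal (- ln 2 / real n + (\<Lambda> t - t * \<Lambda>' t - e)) \<le> ereal (1 / real n) * log_prob (P n A)) sequentially"
  proof eventually_elim
    case (elim n)
    have "ereal (ln (exp (real n * (\<Lambda> t - t * \<Lambda>' t - e)) / 2)) \<le> log_prob (P n A)"
      using elim P_mono [OF elim(2) G(3) A] by (intro log_prob_ge) auto
    then have "ereal (1 / real n) * ereal (ln (exp (real n * (\<Lambda> t - t * \<Lambda>' t - e)) / 2)) \<le> ereal (1 / real n) * log_prob (P n A)"
      by (intro ereal_mult_left_mono) auto
    also have "ereal (1 / real n) * ereal (ln (exp (real n * (\<Lambda> t - t * \<Lambda>' t - e)) / 2)) = ereal (- ln 2 / real n + (\<Lambda> t - t * \<Lambda>' t - e))"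
      using elim(2) by (simp add: ln_div field_simps)
    finally show ?case .
  qed
  then have "liminf (\<lambda>n. ereal (- ln 2 / real n + (\<Lambda> t - t * \<Lambda>' t - e))) \<le> liminf (\<lambda>n. ereal (1 / real n) * log_prob (P n A))"
    by (rule Liminf_mono)
  moreover have "liminf (\<lambda>n. ereal (- ln 2 / real n + (\<Lambda> t - t * \<Lambda>' t - e))) = ereal (\<Lambda> t - t * \<Lambda>' t - e)"
  proof (rule lim_imp_Liminf)
    have "(\<lambda>n. - ln 2 / real n + (\<Lambda> t - t * \<Lambda>' t - e)) \<longlonglongrightarrow> 0 + (\<Lambda> t - t * \<Lambda>' t - e)"
      by (intro tendsto_add tendsto_const) real_asymp
    then show "(\<lambda>n. ereal (- ln 2 / real n + (\<Lambda> t - t * \<Lambda>' t - e))) \<longlonglongrightarrow> ereal (\<Lambda> t - t * \<Lambda>' t - e)"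
      by (auto intro: tendsto_ereal)
  qed simp
  ultimately have "ereal (\<Lambda> t - t * \<Lambda>' t - e) \<le> liminf (\<lambda>n. ereal (1 / real n) * log_prob (P n A))" by simp
  then have "ereal (\<Lambda> t - t * \<Lambda>' t - e) + ereal e \<le> liminf (\<lambda>n. ereal (1 / real n) * log_prob (P n A)) + ereal e"
    by (rule add_right_mono)
  then show "ereal (\<Lambda> t - t * \<Lambda>' t) \<le> liminf (\<lambda>n. ereal (1 / real n) * log_prob (P n A)) + ereal e" by simp
qed

text \<open>
  Let \<open>x\<close> be a point of the interior with finite rate. If \<open>x\<close> is not a value of \<open>\<Lambda>'\<close>, then it lies above all of them, by
  steepness and the intermediate value theorem. It must be their supremum, since otherwise
  \<open>t x - \<Lambda> t\<close> would grow without bound. Then some \<open>\<Lambda>' t\<close> with \<open>t \<ge> 0\<close> lies in the interior just below \<open>x\<close>, and its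
  rate is at most that of \<open>x\<close>.
\<close>

lemma lower_bound:
  assumes A: "A \<in> sets borel"
  shows "- (INF x\<in>interior A. legendre \<Lambda> x) \<le> liminf (\<lambda>n. ereal (1 / real n) * log_prob (P n A))"
proof -
  let ?l = "liminf (\<lambda>n. ereal (1 / real n) * log_prob (P n A))"
  note low = lower_exposed [OF _ open_interior _ interior_subset A]
  have "- ?l \<le> (INF x\<in>interior A. legendre \<Lambda> x)"
  proof (rule INF_greatest)
    fix x assume x: "x \<in> interior A"
    have key: "- ?l \<le> legendre \<Lambda> x" if "t > -1" "\<Lambda>' t \<in> interior A" "t * \<Lambda>' t \<le> t * x" for t
    proof -
      have "- ?l \<le> ereal (t * \<Lambda>' t - \<Lambda> t)"
        using low [OF that(1,2)] by (simp add: ereal_uminus_le_reorder)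
      also have "\<dots> \<le> ereal (t * x - \<Lambda> t)" using that by simp
      also have "\<dots> \<le> legendre \<Lambda> x" by (rule legendre_ge) fact
      finally show ?thesis .
    qed
    show "- ?l \<le> legendre \<Lambda> x"
    proof (cases "\<exists>t>-1. \<Lambda>' t = x")
      case True
      then show ?thesis using key x by auto
    next
      case False
      obtain t0 where t0: "t0 > -1" "\<Lambda>' t0 < x" using steep by blast
      have below: "\<Lambda>' t \<le> x" if t: "t > -1" for t
      proof (rule ccontr)
        assume "\<not> \<Lambda>' t \<le> x"
        then have gt: "\<Lambda>' t > x" by simp
        then have "t0 \<le> t" using mono [of t t0] t t0 by (cases "t0 \<le> t") auto
        moreover have "continuous_on {t0..t} \<Lambda>'" using t0 by (intro continuous_on_subset [OF cont]) auto
        ultimately obtain u where "t0 \<le> u" "u \<le> t" "\<Lambda>' u = x"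
          using IVT' [of \<Lambda>' t0 x t] t0 gt by auto
        then show False using False t0 by (metis less_le_trans)
      qed
      obtain d where d: "d > 0" "ball x d \<subseteq> interior A" using x open_interior by (meson openE)
      show ?thesis
      proof (cases "\<exists>t\<ge>0. \<Lambda>' t > x - d")
        case True
        then obtain t where t: "t \<ge> 0" "\<Lambda>' t > x - d" by auto
        then have "\<Lambda>' t \<in> ball x d" using below [of t] d by (auto simp: dist_real_def)
        then have "\<Lambda>' t \<in> interior A" using d by blast
        moreover have "t * \<Lambda>' t \<le> t * x" using below [of t] t by (intro mult_left_mono) auto
        ultimately show ?thesis using key [of t] t by simp
      next
        case False
        have "legendre \<Lambda> x = \<infinity>"
        proof (rule ereal_top)
          fix B :: real
          \<comment> \<open>Here \<open>\<Lambda>' \<le> x - d\<close> to the right of 0, so \<open>t * x - \<Lambda> t \<ge> t * d\<close>.\<close>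
          define t where "t = max 0 B / d + 1"
          have t: "t > 0" using d by (simp add: t_def add_nonneg_pos)
          obtain z where z: "0 < z" "z < t" "\<Lambda> t - \<Lambda> 0 = (t - 0) * \<Lambda>' z"
            using MVT2 [of 0 t \<Lambda> \<Lambda>'] t deriv by auto
          have "\<Lambda>' z \<le> x - d" using False z by (metis less_eq_real_def not_le)
          then have "\<Lambda> t \<le> t * (x - d)" using z t by (simp add: Lambda_0)
          moreover have "t * d \<ge> B" using d by (simp add: t_def algebra_simps)
          ultimately have "B \<le> t * x - \<Lambda> t" by (simp add: algebra_simps)
          then show "ereal B \<le> legendre \<Lambda> x" using legendre_ge [of t x \<Lambda>] t by (metis ereal_less_eq(3) less_trans neg_less_0_iff_less order_trans zero_less_one)
        qed
        then show ?thesis by simp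
      qed
    qed
  qed
  then show ?thesis by (simp add: ereal_uminus_le_reorder)
qed

theorem LDP: "satisfies_LDP M X (\<lambda>n. real n) (legendre \<Lambda>)"
  unfolding satisfies_LDP_def
  using rv legendre_nonneg lower_semicontinuous_legendre lower_bound upper_bound
  by (auto simp: P_def incseq_def filterlim_real_sequentially)

end

section \<open>Large deviations and mod-Gaussian convergence of the log-likelihood\<close>

text \<open>
  The exact moment generating function that both limit theorems start from.
\<close>

lemma exp_loglik_expectation:
  assumes "\<beta> > 0" "n \<ge> 1" "Re w > -1"
    and "distributed M (circ_base n) \<theta> (\<lambda>x. ennreal (circ_density n \<beta> x))"
  shows "has_bochner_integral M (\<lambda>\<omega>. exp (w * of_real (circ_loglik n \<beta> (\<theta> \<omega>))))
    (exp (of_nat n * circ_Lambda \<beta> w + stirling_gap (real n * (\<beta> / 2)) w))"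
  using exp_loglik_expectation_Gamma [OF assms] unfolding power_normalisation_eq_exp [OF assms(1-3)] .

lemma legendre_eq_Lambda_C_star:
  assumes "\<beta> > 0"
  shows "legendre (circ_Lambda_real \<beta>) = Lambda_C_star \<beta>"
proof
  fix x
  show "legendre (circ_Lambda_real \<beta>) x = Lambda_C_star \<beta> x"
    unfolding legendre_def Lambda_C_star_def Lambda_H_star_def
    using Lambda_H_eq [OF assms] by (intro SUP_cong refl) (simp add: algebra_simps)
qed

lemma stirling_gap_bound_at:
  assumes "\<beta> > 0" "n \<ge> 1" "0 < r" "r \<le> 1" "Re (1 + w) \<ge> r"
  shows "norm (stirling_gap (real n * (\<beta> / 2)) w)
    \<le> (norm w / r)\<^sup>2 + norm w * (norm (legendre_stirling (\<beta> / 2)) + ln (real n))"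
proof -
  have "norm (stirling_gap (real n * (\<beta> / 2)) w) \<le> (norm w / r)\<^sup>2 + norm w * norm (legendre_stirling (real n * (\<beta> / 2)))"
    using assms by (intro stirling_gap_bound) auto
  also have "norm (legendre_stirling (real n * (\<beta> / 2))) \<le> norm (legendre_stirling (\<beta> / 2)) + ln (real n * (\<beta> / 2) / (\<beta> / 2))"
    using assms by (intro legendre_stirling_bound) auto
  also have "real n * (\<beta> / 2) / (\<beta> / 2) = real n" using assms by simp
  finally show ?thesis by (simp add: mult_left_mono)
qed

lemma gaertner_ellis_circ_loglik:
  fixes M :: "nat \<Rightarrow> 'a measure"
  assumes \<beta>: "\<beta> > 0"
    and prob: "\<And>n. n \<ge> 1 \<Longrightarrow> prob_space (M n)"
    and dist: "\<And>n. n \<ge> 1 \<Longrightarrow> distributed (M n) (circ_base n) (\<theta> n) (\<lambda>x. ennreal (circ_density n \<beta> x))"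
  shows "gaertner_ellis M (\<lambda>n \<omega>. circ_loglik n \<beta> (\<theta> n \<omega>) / real n) (circ_Lambda_real \<beta>) (circ_Lambda_deriv \<beta>)"
proof
  let ?X = "\<lambda>n \<omega>. circ_loglik n \<beta> (\<theta> n \<omega>) / real n"
  show "real_random_variables M ?X"
    unfolding real_random_variables_def
  proof (intro allI impI conjI)
    fix n :: nat assume n: "n \<ge> 1"
    show "prob_space (M n)" by (rule prob) fact
    have "(\<lambda>\<omega>. circ_loglik n \<beta> (\<theta> n \<omega>)) \<in> borel_measurable (M n)"
      by (rule measurable_compose [OF distributed_measurable [OF dist [OF n]] circ_loglik_measurable])
    then show "?X n \<in> borel_measurable (M n)" by simp
  qed
  have mgf: "integrable (M n) (\<lambda>\<omega>. exp (t * (real n * ?X n \<omega>)))"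
    "ln (\<integral>\<omega>. exp (t * (real n * ?X n \<omega>)) \<partial>M n) = real n * circ_Lambda_real \<beta> t + Re (stirling_gap (real n * (\<beta> / 2)) (of_real t))"
    if n: "n \<ge> 1" and t: "t > -1" for n t
  proof -
    let ?z = "of_nat n * circ_Lambda \<beta> (of_real t) + stirling_gap (real n * (\<beta> / 2)) (of_real t)"
    have "has_bochner_integral (M n) (\<lambda>\<omega>. exp (of_real t * of_real (circ_loglik n \<beta> (\<theta> n \<omega>)))) (exp ?z)"
      using t by (intro exp_loglik_expectation \<beta> n dist) simp
    also have "(\<lambda>\<omega>. exp (of_real t * of_real (circ_loglik n \<beta> (\<theta> n \<omega>)))) = (\<lambda>\<omega>. complex_of_real (exp (t * (real n * ?X n \<omega>))))"
      using n by (simp add: fun_eq_iff flip: exp_of_real)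
    finally have h: "has_bochner_integral (M n) (\<lambda>\<omega>. complex_of_real (exp (t * (real n * ?X n \<omega>)))) (exp ?z)" .
    then show int: "integrable (M n) (\<lambda>\<omega>. exp (t * (real n * ?X n \<omega>)))"
      by (simp only: has_bochner_integral_iff complex_of_real_integrable_eq)
    let ?m = "\<integral>\<omega>. exp (t * (real n * ?X n \<omega>)) \<partial>M n"
    have m: "complex_of_real ?m = exp ?z"
      using h by (simp only: has_bochner_integral_iff integral_complex_of_real)
    have "?m \<ge> 0" by (intro Bochner_Integration.integral_nonneg) auto
    then have "?m = norm (complex_of_real ?m)" by simp
    also have "\<dots> = exp (Re ?z)" unfolding m by simp
    finally have "ln ?m = Re ?z" by simp
    then show "ln ?m = real n * circ_Lambda_real \<beta> t + Re (stirling_gap (real n * (\<beta> / 2)) (of_real t))"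
      using circ_Lambda_of_real [OF \<beta> t] by simp
  qed
  show "integrable (M n) (\<lambda>\<omega>. exp (t * (real n * ?X n \<omega>)))" if "n \<ge> 1" "t > -1" for n t
    by (rule mgf(1) [OF that])
  show "(\<lambda>n. ln (\<integral>\<omega>. exp (t * (real n * ?X n \<omega>)) \<partial>M n) / real n) \<longlonglongrightarrow> circ_Lambda_real \<beta> t" if t: "t > -1" for t
  proof -
    define r where "r = min 1 (1 + t)"
    define c where "c = norm (legendre_stirling (\<beta> / 2))"
    have r: "0 < r" "r \<le> 1" "Re (1 + of_real t) \<ge> r" using t by (auto simp: r_def)
    have gap: "(\<lambda>n. Re (stirling_gap (real n * (\<beta> / 2)) (of_real t)) / real n) \<longlonglongrightarrow> 0"
    proof (rule Lim_null_comparison)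
      show "eventually (\<lambda>n. norm (Re (stirling_gap (real n * (\<beta> / 2)) (of_real t)) / real n)
          \<le> ((\<bar>t\<bar> / r)\<^sup>2 + \<bar>t\<bar> * (c + ln (real n))) / real n) sequentially"
        using eventually_ge_at_top [of 1]
      proof eventually_elim
        case (elim n)
        have "\<bar>Re (stirling_gap (real n * (\<beta> / 2)) (of_real t))\<bar> \<le> (\<bar>t\<bar> / r)\<^sup>2 + \<bar>t\<bar> * (c + ln (real n))"
          using order_trans [OF abs_Re_le_cmod stirling_gap_bound_at [OF \<beta> elim r]]
          by (simp only: c_def norm_of_real)
        then show ?case by (simp add: divide_right_mono)
      qed
      have "(\<lambda>n. 1 / real n) \<longlonglongrightarrow> 0" "(\<lambda>n. ln (real n) / real n) \<longlonglongrightarrow> 0" by real_asymp+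
      then have "(\<lambda>n. ((\<bar>t\<bar> / r)\<^sup>2 + \<bar>t\<bar> * c) * (1 / real n) + \<bar>t\<bar> * (ln (real n) / real n)) \<longlonglongrightarrow>
          ((\<bar>t\<bar> / r)\<^sup>2 + \<bar>t\<bar> * c) * 0 + \<bar>t\<bar> * 0"
        by (intro tendsto_add tendsto_mult tendsto_const)
      then show "(\<lambda>n. ((\<bar>t\<bar> / r)\<^sup>2 + \<bar>t\<bar> * (c + ln (real n))) / real n) \<longlonglongrightarrow> 0"
        by (simp add: add_divide_distrib distrib_left add.assoc)
    qed
    have "(\<lambda>n. circ_Lambda_real \<beta> t + Re (stirling_gap (real n * (\<beta> / 2)) (of_real t)) / real n) \<longlonglongrightarrow> circ_Lambda_real \<beta> t + 0"
      by (intro tendsto_add tendsto_const gap)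
    moreover have "eventually (\<lambda>n. circ_Lambda_real \<beta> t + Re (stirling_gap (real n * (\<beta> / 2)) (of_real t)) / real n
       = ln (\<integral>\<omega>. exp (t * (real n * ?X n \<omega>)) \<partial>M n) / real n) sequentially"
      using eventually_ge_at_top [of 1]
    proof eventually_elim
      case (elim n)
      show ?case unfolding mgf(2) [OF elim t] using elim by (simp add: add_divide_distrib)
    qed
    ultimately have "(\<lambda>n. ln (\<integral>\<omega>. exp (t * (real n * ?X n \<omega>)) \<partial>M n) / real n) \<longlonglongrightarrow> circ_Lambda_real \<beta> t + 0"
      by (rule Lim_transform_eventually)
    then show ?thesis by simp
  qed
qed (use circ_Lambda_real_deriv circ_Lambda_deriv_cont circ_Lambda_deriv_mono circ_Lambda_deriv_steep \<beta> in auto)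

lemma uniform_limit_exp_mult:
  fixes \<delta> :: "nat \<Rightarrow> complex \<Rightarrow> complex" and \<psi> :: "complex \<Rightarrow> complex"
  assumes K: "\<And>z. z \<in> U \<Longrightarrow> norm (\<psi> z) \<le> K"
    and d: "d \<longlonglongrightarrow> (0 :: real)"
    and \<delta>: "eventually (\<lambda>n. \<forall>z\<in>U. norm (\<delta> n z) \<le> d n) sequentially"
  shows "uniform_limit U (\<lambda>n z. exp (\<delta> n z) * \<psi> z) \<psi> sequentially"
proof (rule uniform_limitI)
  fix e :: real assume e: "e > 0"
  define K' where "K' = \<bar>K\<bar> + 1"
  have K': "K' > 0" by (simp add: K'_def)
  have "isCont (exp :: complex \<Rightarrow> complex) 0" by simp
  then obtain s where s: "s > 0" "\<And>x :: complex. norm x < s \<Longrightarrow> norm (exp x - 1) < e / K'"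
    unfolding continuous_at_eps_delta using divide_pos_pos [OF e K'] by (auto simp: dist_norm)
  from order_tendstoD(2) [OF d s(1)] \<delta>
  show "eventually (\<lambda>n. \<forall>z\<in>U. dist (exp (\<delta> n z) * \<psi> z) (\<psi> z) < e) sequentially"
  proof eventually_elim
    case (elim n)
    show ?case
    proof
      fix z assume z: "z \<in> U"
      have "norm (exp (\<delta> n z) - 1) < e / K'" using elim z by (intro s(2)) force
      moreover have "norm (\<psi> z) < K'" using K [OF z] by (simp add: K'_def)
      ultimately have "norm (exp (\<delta> n z) - 1) * norm (\<psi> z) < e / K' * K'"
        using e K' by (intro mult_strict_mono) auto
      also have "\<dots> = e" using K' by simp
      also have "norm (exp (\<delta> n z) - 1) * norm (\<psi> z) = dist (exp (\<delta> n z) * \<psi> z) (\<psi> z)"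
        by (simp add: dist_norm norm_mult [symmetric] algebra_simps)
      finally show "dist (exp (\<delta> n z) * \<psi> z) (\<psi> z) < e" .
    qed
  qed
qed

text \<open>
  With \<open>a n = n powr (- 1 / 3)\<close> and \<open>w = z * a n\<close>, one has \<open>n * (a n)\<^sup>3 = 1\<close>. So the third-order Taylor polynomial
  of the exponent accounts exactly for the Gaussian factor and the limiting function, and \<open>\<delta> n z\<close> collects
  everything else. The strip is preserved because \<open>a n \<le> 1\<close>.
\<close>

lemma mod_gaussian_circ_loglik:
  fixes M :: "nat \<Rightarrow> 'a measure"
  assumes \<beta>: "\<beta> > 0"
    and prob: "\<And>n. n \<ge> 1 \<Longrightarrow> prob_space (M n)"
    and dist: "\<And>n. n \<ge> 1 \<Longrightarrow> distributed (M n) (circ_base n) (\<theta> n) (\<lambda>x. ennreal (circ_density n \<beta> x))"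
  shows "mod_gaussian_convergent M (\<lambda>n \<omega>. real n powr (- 1 / 3) * Y_C n \<beta> (\<theta> n \<omega>))
           (- 1) \<infinity> (\<lambda>n. real n powr (1 / 3) * sigma2 \<beta>)
           (\<lambda>z. exp (- complex_of_real (A_const \<beta>) * z ^ 3 / 6))"
proof -
  let ?X = "\<lambda>n \<omega>. real n powr (- 1 / 3) * Y_C n \<beta> (\<theta> n \<omega>)"
  let ?\<psi> = "\<lambda>z. exp (- complex_of_real (A_const \<beta>) * z ^ 3 / 6)"
  have strip: "strip (- 1) \<infinity> = {z. Re z > -1}"
    by (auto simp: strip_def one_ereal_def)
  define a where "a n = real n powr (- 1 / 3)" for n :: nat
  have a: "0 < a n" "a n \<le> 1" if "n \<ge> 1" for n
    using that powr_mono2' [of "- 1 / 3" 1 "real n"] by (auto simp: a_def)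
  have a_lim: "a \<longlonglongrightarrow> 0" "(\<lambda>n. a n * ln (real n)) \<longlonglongrightarrow> 0"
    unfolding a_def [abs_def] by real_asymp+
  have a3: "real n * a n ^ 3 = 1" "real n * a n ^ 2 = real n powr (1 / 3)" if "n \<ge> 1" for n
  proof -
    have n: "real n > 0" using that by simp
    then have "a n ^ 3 = real n powr (- 1)" "a n ^ 2 = real n powr (- 2 / 3)" by (simp_all add: a_def powr_power)
    then have "real n * a n ^ 3 = real n powr (1 + - 1)" "real n * a n ^ 2 = real n powr (1 + - 2 / 3)"
      using n by (simp_all only: powr_add powr_one)
    then show "real n * a n ^ 3 = 1" "real n * a n ^ 2 = real n powr (1 / 3)" using n by simp_all
  qed
  have Re: "Re (z * of_real (a n)) > -1" if "n \<ge> 1" "Re z > -1" for z n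
  proof (cases "Re z \<ge> 0")
    case True
    then show ?thesis using a [OF that(1)] by (simp add: less_le_trans [of "-1" 0])
  next
    case False
    then have "Re z * 1 \<le> Re z * a n" using a [OF that(1)] by (intro mult_left_mono_neg) auto
    then show ?thesis using that by simp
  qed
  have mgf: "has_bochner_integral (M n) (\<lambda>\<omega>. exp (z * of_real (?X n \<omega>)))
      (exp (of_nat n * (circ_Lambda \<beta> (z * of_real (a n)) + of_real (E_C \<beta>) * (z * of_real (a n))) + stirling_gap (real n * (\<beta> / 2)) (z * of_real (a n))))"
    if n: "n \<ge> 1" and z: "Re z > -1" for n z
  proof -
    let ?w = "z * of_real (a n)"
    have "has_bochner_integral (M n) (\<lambda>\<omega>. exp (?w * of_real (circ_loglik n \<beta> (\<theta> n \<omega>))))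
       (exp (of_nat n * circ_Lambda \<beta> ?w + stirling_gap (real n * (\<beta> / 2)) ?w))"
      by (intro exp_loglik_expectation \<beta> n dist Re z)
    then have "has_bochner_integral (M n) (\<lambda>\<omega>. exp (of_nat n * (of_real (E_C \<beta>) * ?w)) * exp (?w * of_real (circ_loglik n \<beta> (\<theta> n \<omega>))))
       (exp (of_nat n * (of_real (E_C \<beta>) * ?w)) * exp (of_nat n * circ_Lambda \<beta> ?w + stirling_gap (real n * (\<beta> / 2)) ?w))"
      by (rule has_bochner_integral_mult_right)
    then show ?thesis
      unfolding exp_add [symmetric] Y_C_def a_def by (simp add: algebra_simps)
  qed
  have rv: "real_random_variables M ?X"
    unfolding real_random_variables_def
  proof (intro allI impI conjI)
    fix n :: nat assume n: "n \<ge> 1"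
    show "prob_space (M n)" by (rule prob) fact
    have "(\<lambda>\<omega>. circ_loglik n \<beta> (\<theta> n \<omega>)) \<in> borel_measurable (M n)"
      by (rule measurable_compose [OF distributed_measurable [OF dist [OF n]] circ_loglik_measurable])
    then show "?X n \<in> borel_measurable (M n)" unfolding Y_C_def by simp
  qed
  obtain C where C: "C \<ge> 0" "\<And>w. norm w \<le> 1 / 2 \<Longrightarrow>
    norm (circ_Lambda \<beta> w + of_real (E_C \<beta>) * w - (of_real (sigma2 \<beta>) * w\<^sup>2 / 2 - of_real (A_const \<beta>) * w ^ 3 / 6)) \<le> C * norm w ^ 4"
    using circ_Lambda_taylor [OF \<beta>] by metis
  define c where "c = norm (legendre_stirling (\<beta> / 2))"
  define \<delta> where "\<delta> n z = of_nat n * (circ_Lambda \<beta> (z * of_real (a n)) + of_real (E_C \<beta>) * (z * of_real (a n)))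
      + stirling_gap (real n * (\<beta> / 2)) (z * of_real (a n))
      - complex_of_real (real n powr (1 / 3) * sigma2 \<beta>) * z\<^sup>2 / 2 + of_real (A_const \<beta>) * z ^ 3 / 6" for n z
  have \<delta>_bound: "norm (\<delta> n z) \<le> C * R ^ 4 * a n + (4 * R\<^sup>2 * (a n)\<^sup>2 + R * a n * (c + ln (real n)))"
    if n: "n \<ge> 1" and R: "norm z \<le> R" "R * a n \<le> 1 / 2" for n z R
  proof -
    let ?w = "z * of_real (a n)"
    note an = a [OF n]
    have w: "norm ?w \<le> R * a n" using R an by (simp add: norm_mult mult_right_mono)
    then have w2: "norm ?w \<le> 1 / 2" using R by simp
    have 1: "complex_of_real (real n powr (1 / 3) * sigma2 \<beta>) * z\<^sup>2 / 2 = of_nat n * (of_real (sigma2 \<beta>) * ?w\<^sup>2 / 2)"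
      unfolding a3(2) [OF n, symmetric] by (simp add: power_mult_distrib algebra_simps)
    have 2: "of_real (A_const \<beta>) * z ^ 3 / 6 = of_nat n * (of_real (A_const \<beta>) * ?w ^ 3 / 6)"
    proof -
      have "of_real (real n * a n ^ 3) = (1 :: complex)" unfolding a3(1) [OF n] by simp
      then have "of_real (A_const \<beta>) * z ^ 3 / 6 = of_real (real n * a n ^ 3) * (of_real (A_const \<beta>) * z ^ 3 / 6)" by simp
      then show ?thesis by (simp add: power_mult_distrib algebra_simps)
    qed
    have "\<delta> n z = of_nat n * (circ_Lambda \<beta> ?w + of_real (E_C \<beta>) * ?w - (of_real (sigma2 \<beta>) * ?w\<^sup>2 / 2 - of_real (A_const \<beta>) * ?w ^ 3 / 6))
       + stirling_gap (real n * (\<beta> / 2)) ?w"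
      unfolding \<delta>_def 1 2 by (simp add: algebra_simps)
    then have "norm (\<delta> n z) \<le> real n * norm (circ_Lambda \<beta> ?w + of_real (E_C \<beta>) * ?w - (of_real (sigma2 \<beta>) * ?w\<^sup>2 / 2 - of_real (A_const \<beta>) * ?w ^ 3 / 6))
       + norm (stirling_gap (real n * (\<beta> / 2)) ?w)"
      by (metis norm_mult norm_of_nat norm_triangle_ineq)
    also have "\<dots> \<le> real n * (C * norm ?w ^ 4) + ((norm ?w / (1 / 2))\<^sup>2 + norm ?w * (c + ln (real n)))"
    proof (intro add_mono mult_left_mono C w2)
      have "Re (1 + ?w) \<ge> 1 / 2" using w2 abs_Re_le_cmod [of ?w] by auto
      then show "norm (stirling_gap (real n * (\<beta> / 2)) ?w) \<le> (norm ?w / (1 / 2))\<^sup>2 + norm ?w * (c + ln (real n))"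
        unfolding c_def by (intro stirling_gap_bound_at \<beta> n) auto
    qed simp
    also have "\<dots> \<le> real n * (C * (R * a n) ^ 4) + ((R * a n / (1 / 2))\<^sup>2 + R * a n * (c + ln (real n)))"
      using w C n by (intro add_mono mult_left_mono mult_right_mono power_mono divide_right_mono) (auto simp: c_def)
    also have "real n * (C * (R * a n) ^ 4) = C * R ^ 4 * a n * (real n * a n ^ 3)"
      by (simp add: power_mult_distrib eval_nat_numeral algebra_simps)
    also have "\<dots> = C * R ^ 4 * a n" unfolding a3(1) [OF n] by simp
    also have "(R * a n / (1 / 2))\<^sup>2 = 4 * R\<^sup>2 * (a n)\<^sup>2" by (simp add: power2_eq_square)
    finally show ?thesis .
  qed
  have "locally_uniform_limit {z. Re z > -1}
     (\<lambda>n z. (LINT \<omega>|M n. exp (z * complex_of_real (?X n \<omega>))) * exp (- complex_of_real (real n powr (1 / 3) * sigma2 \<beta>) * z\<^sup>2 / 2)) ?\<psi>"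
    unfolding locally_uniform_limit_def
  proof
    fix z0 :: complex assume z0: "z0 \<in> {z. Re z > -1}"
    define U where "U = ball z0 1 \<inter> {z. Re z > -1}"
    define R where "R = norm z0 + 1"
    have R: "norm z \<le> R" if "z \<in> U" for z
      using that norm_triangle_sub [of z z0] by (auto simp: U_def R_def dist_norm norm_minus_commute)
    have "uniform_limit U (\<lambda>n z. exp (\<delta> n z) * ?\<psi> z) ?\<psi> sequentially"
    proof (rule uniform_limit_exp_mult)
      show "norm (?\<psi> z) \<le> exp (\<bar>A_const \<beta>\<bar> * R ^ 3 / 6)" if "z \<in> U" for z
      proof -
        have "norm (?\<psi> z) \<le> exp (norm (- complex_of_real (A_const \<beta>) * z ^ 3 / 6))" by (rule norm_exp)
        also have "norm (- complex_of_real (A_const \<beta>) * z ^ 3 / 6) = \<bar>A_const \<beta>\<bar> * norm z ^ 3 / 6"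
          by (simp add: norm_mult norm_divide norm_power)
        also have "exp (\<bar>A_const \<beta>\<bar> * norm z ^ 3 / 6) \<le> exp (\<bar>A_const \<beta>\<bar> * R ^ 3 / 6)"
          using R [OF that] by (simp add: mult_left_mono power_mono divide_right_mono)
        finally show ?thesis .
      qed
      show "(\<lambda>n. C * R ^ 4 * a n + (4 * R\<^sup>2 * (a n)\<^sup>2 + R * a n * (c + ln (real n)))) \<longlonglongrightarrow> 0"
      proof -
        have "(\<lambda>n. C * R ^ 4 * a n + (4 * R\<^sup>2 * (a n)\<^sup>2 + (R * c * a n + R * (a n * ln (real n)))))
            \<longlonglongrightarrow> C * R ^ 4 * 0 + (4 * R\<^sup>2 * 0\<^sup>2 + (R * c * 0 + R * 0))"
          by (intro tendsto_add tendsto_mult tendsto_const tendsto_power a_lim)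
        then show ?thesis by (simp add: algebra_simps)
      qed
      have "(\<lambda>n. R * a n) \<longlonglongrightarrow> R * 0" by (intro tendsto_mult tendsto_const a_lim)
      then have "(\<lambda>n. R * a n) \<longlonglongrightarrow> 0" by simp
      then have "eventually (\<lambda>n. R * a n < 1 / 2) sequentially" by (rule order_tendstoD) simp
      then show "eventually (\<lambda>n. \<forall>z\<in>U. norm (\<delta> n z) \<le> C * R ^ 4 * a n + (4 * R\<^sup>2 * (a n)\<^sup>2 + R * a n * (c + ln (real n)))) sequentially"
        using eventually_ge_at_top [of 1]
        by eventually_elim (use R \<delta>_bound in auto)
    qed
    moreover have "eventually (\<lambda>n. \<forall>z\<in>U. exp (\<delta> n z) * ?\<psi> z = (LINT \<omega>|M n. exp (z * complex_of_real (?X n \<omega>))) * exp (- complex_of_real (real n powr (1 / 3) * sigma2 \<beta>) * z\<^sup>2 / 2)) sequentially"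
      using eventually_ge_at_top [of 1]
    proof eventually_elim
      case (elim n)
      show ?case
      proof
        fix z assume "z \<in> U"
        then have z: "Re z > -1" by (simp add: U_def)
        have "(LINT \<omega>|M n. exp (z * complex_of_real (?X n \<omega>))) =
          exp (of_nat n * (circ_Lambda \<beta> (z * of_real (a n)) + of_real (E_C \<beta>) * (z * of_real (a n))) + stirling_gap (real n * (\<beta> / 2)) (z * of_real (a n)))"
          by (rule has_bochner_integral_integral_eq [OF mgf [OF elim z]])
        then show "exp (\<delta> n z) * ?\<psi> z = (LINT \<omega>|M n. exp (z * complex_of_real (?X n \<omega>))) * exp (- complex_of_real (real n powr (1 / 3) * sigma2 \<beta>) * z\<^sup>2 / 2)"
          by (simp add: \<delta>_def flip: exp_add)
      qed
    qed
    ultimately have "uniform_limit U (\<lambda>n z. (LINT \<omega>|M n. exp (z * complex_of_real (?X n \<omega>))) * exp (- complex_of_real (real n powr (1 / 3) * sigma2 \<beta>) * z\<^sup>2 / 2)) ?\<psi> sequentially"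
      by (subst (asm) uniform_limit_cong) auto
    moreover have "open U" unfolding U_def by (intro open_Int open_ball open_halfspace_Re_gt)
    moreover have "z0 \<in> U" "U \<subseteq> {z. Re z > -1}" using z0 by (auto simp: U_def)
    ultimately show "\<exists>U. open U \<and> z0 \<in> U \<and> U \<subseteq> {z. Re z > -1} \<and>
       uniform_limit U (\<lambda>n z. (LINT \<omega>|M n. exp (z * complex_of_real (?X n \<omega>))) * exp (- complex_of_real (real n powr (1 / 3) * sigma2 \<beta>) * z\<^sup>2 / 2)) ?\<psi> sequentially"
      by blast
  qed
  moreover have "filterlim (\<lambda>n. real n powr (1 / 3) * sigma2 \<beta>) at_top sequentially"
    using sigma2_pos [OF \<beta>] by real_asymp
  moreover have "?\<psi> analytic_on {z. Re z > -1}" by (intro analytic_intros) auto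
  moreover have "integrable (M n) (\<lambda>\<omega>. exp (z * complex_of_real (?X n \<omega>)))" if "n \<ge> 1" "Re z > -1" for n z
    using mgf [OF that] by (simp only: has_bochner_integral_iff)
  ultimately show ?thesis
    unfolding mod_gaussian_convergent_def strip using rv by auto
qed

theorem theorem5p8:
  fixes \<beta> :: real
    and M :: "nat \<Rightarrow> 'a measure"
    and \<theta> :: "nat \<Rightarrow> 'a \<Rightarrow> nat \<Rightarrow> real"
  assumes "\<beta> > 0"
    and "\<And>n. n \<ge> 1 \<Longrightarrow> prob_space (M n)"
    and "\<And>n. n \<ge> 1 \<Longrightarrow> distributed (M n) (circ_base n) (\<theta> n) (\<lambda>x. ennreal (circ_density n \<beta> x))"
  shows "(satisfies_LDP M (\<lambda>n \<omega>. circ_loglik n \<beta> (\<theta> n \<omega>) / real n) (\<lambda>n. real n) (Lambda_C_star \<beta>)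
          \<and> good_rate_function (Lambda_C_star \<beta>))
       \<and> mod_gaussian_convergent M (\<lambda>n \<omega>. real n powr (- 1 / 3) * Y_C n \<beta> (\<theta> n \<omega>))
           (- 1) \<infinity> (\<lambda>n. real n powr (1 / 3) * sigma2 \<beta>)
           (\<lambda>z. exp (- complex_of_real (A_const \<beta>) * z ^ 3 / 6))"
proof -
  interpret gaertner_ellis M "\<lambda>n \<omega>. circ_loglik n \<beta> (\<theta> n \<omega>) / real n" "circ_Lambda_real \<beta>" "circ_Lambda_deriv \<beta>"
    by (rule gaertner_ellis_circ_loglik [OF assms])
  show ?thesis
    using LDP good_rate_function_legendre [of "circ_Lambda_real \<beta>"] mod_gaussian_circ_loglik [OF assms]
    by (simp only: legendre_eq_Lambda_C_star [OF assms(1)])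
qed

end
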